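(* Let $k$ be a field of characteristic $0$. For each dga $(A,\phi)$ over $k$ there is a (cohomological) spectral sequence with $$E_2^{p,q}\simeq H^p\Big(H^q\big(\textstyle\bigoplus\Sigma C(A)^*\big)\Big)$$ that converges to the cyclic cohomology $HC^{p+q}_{dg}(A)$.
   Context: **Dgas.** A dga $(A,\phi)$ over $k$ is a unital associative graded $k$-algebra $A=\bigoplus_{m\ge 0}A^m$ with a $k$-linear map $\phi$ lowering degree by one such that $\phi^2=0$ and $\phi(xy)=\phi(x)y+(-1)^{|x|}x\phi(y)$, where $|x|$ is the degree of a homogeneous element. $(A^{\otimes n})^m$ is the total-degree-$m$ part of $A^{\otimes n}$, and $\phi^{\otimes n}$ denotes the induced differential $\phi^{\otimes n}(a_1\otimes\dots\otimes a_n)=\sum_i(-1)^{|a_1|+\dots+|a_{i-1}|}a_1\otimes\dots\otimes\phi(a_i)\otimes\dots\otimes a_n$. For $n,m\ge 0$ put $C^n(A)^m=\mathrm{Hom}_k((A^{\otimes n+1})^m,k)$. **Operators** (on homogeneous $a_i$, with $\gamma_n=|a_n|(|a_0|+\dots+|a_{n-1}|)$): - $\delta:C^n(A)^m\to C^n(A)^{m+1}$, $\delta f=(-1)^m f\circ\phi^{\otimes n+1}$. - $b:C^{n-1}(A)^m\to C^n(A)^m$, $b(f)(a_0\otimes\dots\otimes a_n)=\sum_{i=0}^{n-1}(-1)^i f(a_0\otimes\dots\otimes a_ia_{i+1}\otimes\dots\otimes a_n)+(-1)^{n+\gamma_n}f(a_na_0\otimes a_1\otimes\dots\otimes a_{n-1})$.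 - $\tau:C^n(A)^m\to C^n(A)^m$, $\tau(f)(a_0\otimes\dots\otimes a_n)=(-1)^{n+\gamma_n}f(a_n\otimes a_0\otimes\dots\otimes a_{n-1})$; $N=\sum_{i=0}^n\tau^i$ on $C^n(A)^m$. - $s:C^{n+1}(A)^m\to C^n(A)^m$, $s(f)(a_0\otimes\dots\otimes a_n)=(-1)^n f(a_0\otimes\dots\otimes a_n\otimes 1)$. - $B=Ns(\mathbf 1-\tau):C^{n+1}(A)^m\to C^n(A)^m$ (and $B=0$ on $C^0(A)^m$). **Cyclic cohomology.** $EC(A)$ is the tricomplex with $EC(A)^{p,q,r}=C^{q-p}(A)^r$ for $0\le p\le q$, $r\ge 0$, and $0$ otherwise. $\mathcal T(EC(A))^n=\bigoplus_{p+q+r=n}EC(A)^{p,q,r}$ has differential $b+B+(-1)^{q-p}\delta$, where $b$ raises $q$, $B$ raises $p$, $\delta$ raises $r$ by one. $HC^n_{dg}(A)=H^n(\mathcal T(EC(A)))$. **The complex $H^q(\bigoplus\Sigma C(A)^* )$.** For fixed $p\ge 0$ let $\bigoplus_{i=0}^p\Sigma^{-i}C^{p-i}(A)^*$ be the cochain complex whose degree-$t$ part is $\bigoplus_{i=0}^pC^{p-i}(A)^{t-i}$ (terms with negative upper index are $0$), with differential $B+(-1)^{p-i}\delta$ on the summand $C^{p-i}(A)^{t-i}$. $H^q(\bigoplus\Sigma C(A)^* )$ denotes, for fixed $q$, the cochain complex whose degree-$p$ term is $H^q\big(\bigoplus_{i=0}^p\Sigma^{-i}C^{p-i}(A)^*\big)$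 and whose differential (degree $p$ to degree $p+1$) is induced by $b$. **Convergence.** A spectral sequence $(E_r^{p,q},d_r)$, $d_r:E_r^{p,q}\to E_r^{p+r,q-r+1}$, converges to $H^*$ if there is a decreasing filtration of each $H^n$, finite in each degree, with $E_\infty^{p,q}\simeq F^pH^{p+q}/F^{p+1}H^{p+q}$. *)

theory Defs
  imports "HOL-Algebra.Algebraic_Closure_Type" "HOL-Algebra.AbelCoset" "HOL-Algebra.Module"
    "HOL-Library.Poly_Mapping"
begin

section \<open>Linear algebra with carriers\<close>

(* Vector spaces over the type 'k are HOL-Algebra modules over the ring structure of 'k. The ring
   multiplication and unit inherited by the module record play no role and are left undefined. *)

definition mod_hom ::
  "('r, 'm) ring_scheme \<Rightarrow> ('r, 'v, 'x) module_scheme \<Rightarrow> ('r, 'w, 'y) module_scheme \<Rightarrow> ('v \<Rightarrow> 'w) set"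
  where "mod_hom R M N = {h \<in> carrier M \<rightarrow> carrier N.
    (\<forall>x\<in>carrier M. \<forall>y\<in>carrier M. h (x \<oplus>\<^bsub>M\<^esub> y) = h x \<oplus>\<^bsub>N\<^esub> h y) \<and>
    (\<forall>c\<in>carrier R. \<forall>x\<in>carrier M. h (c \<odot>\<^bsub>M\<^esub> x) = c \<odot>\<^bsub>N\<^esub> h x)}"

definition mod_isomorphic ::
  "('r, 'm) ring_scheme \<Rightarrow> ('r, 'v, 'x) module_scheme \<Rightarrow> ('r, 'w, 'y) module_scheme \<Rightarrow> bool"
  where "mod_isomorphic R M N \<longleftrightarrow> (\<exists>h \<in> mod_hom R M N. bij_betw h (carrier M) (carrier N))"

definition quot_module :: "('r, 'v) module \<Rightarrow> 'v set \<Rightarrow> ('r, 'v set) module"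
  where "quot_module M B =
    \<lparr>carrier = a_rcosets\<^bsub>M\<^esub> B, monoid.mult = undefined, one = undefined,
     zero = B, add = (<+>\<^bsub>M\<^esub>),
     module.smult = (\<lambda>c U. \<Union>x\<in>U. B +>\<^bsub>M\<^esub> (c \<odot>\<^bsub>M\<^esub> x))\<rparr>"

(* The map on quotients induced by f, where B is the submodule divided out in the target N. *)
definition quot_map :: "('r, 'w) module \<Rightarrow> 'w set \<Rightarrow> ('v \<Rightarrow> 'w) \<Rightarrow> 'v set \<Rightarrow> 'w set"
  where "quot_map N B f U = (\<Union>x\<in>U. B +>\<^bsub>N\<^esub> f x)"

definition direct_sum_module :: "'i set \<Rightarrow> ('i \<Rightarrow> ('r, 'v) module) \<Rightarrow> ('r, 'i \<Rightarrow> 'v) module"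
  where "direct_sum_module I M =
    \<lparr>carrier = {x \<in> (\<Pi>\<^sub>E i\<in>I. carrier (M i)). finite {i \<in> I. x i \<noteq> \<zero>\<^bsub>M i\<^esub>}},
     monoid.mult = undefined, one = undefined,
     zero = (\<lambda>i\<in>I. \<zero>\<^bsub>M i\<^esub>),
     add = (\<lambda>x y. \<lambda>i\<in>I. x i \<oplus>\<^bsub>M i\<^esub> y i),
     module.smult = (\<lambda>c x. \<lambda>i\<in>I. c \<odot>\<^bsub>M i\<^esub> x i)\<rparr>"

(* Hom_k(M, k); functionals are extended by 0 outside the carrier of M, so that the operations
   are pointwise. *)
definition dual_module :: "('k::field, 'v) module \<Rightarrow> ('k, 'v \<Rightarrow> 'k) module"
  where "dual_module M =
    \<lparr>carrier = {f. (\<forall>s\<in>carrier M. \<forall>t\<in>carrier M. f (s \<oplus>\<^bsub>M\<^esub> t) = f s + f t) \<and>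
                   (\<forall>c. \<forall>t\<in>carrier M. f (c \<odot>\<^bsub>M\<^esub> t) = c * f t) \<and>
                   (\<forall>t. t \<notin> carrier M \<longrightarrow> f t = 0)},
     monoid.mult = undefined, one = undefined,
     zero = (\<lambda>t. 0), add = (\<lambda>f g t. f t + g t), module.smult = (\<lambda>c f t. c * f t)\<rparr>"

section \<open>Cochain complexes and spectral sequences\<close>

definition cocycles :: "(int \<Rightarrow> ('r, 'v) module) \<Rightarrow> (int \<Rightarrow> 'v \<Rightarrow> 'v) \<Rightarrow> int \<Rightarrow> 'v set"
  where "cocycles C d n = {x \<in> carrier (C n). d n x = \<zero>\<^bsub>C (n + 1)\<^esub>}"

definition coboundaries :: "(int \<Rightarrow> ('r, 'v) module) \<Rightarrow> (int \<Rightarrow> 'v \<Rightarrow> 'v) \<Rightarrow> int \<Rightarrow> 'v set"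
  where "coboundaries C d n = d (n - 1) ` carrier (C (n - 1))"

definition cohomology ::
  "(int \<Rightarrow> ('r, 'v) module) \<Rightarrow> (int \<Rightarrow> 'v \<Rightarrow> 'v) \<Rightarrow> int \<Rightarrow> ('r, 'v set) module"
  where "cohomology C d n = quot_module ((C n)\<lparr>carrier := cocycles C d n\<rparr>) (coboundaries C d n)"

(* Here E r p q is $E_r^{p,q}$, and d r p q is the differential leaving $E_r^{p,q}$; the differential
   arriving at $E_r^{p,q}$ is thus d r (p - r) (q + r - 1). *)
definition spectral_sequence ::
  "('r, 'm) ring_scheme \<Rightarrow> (nat \<Rightarrow> int \<Rightarrow> int \<Rightarrow> ('r, 'e) module) \<Rightarrow>
   (nat \<Rightarrow> int \<Rightarrow> int \<Rightarrow> 'e \<Rightarrow> 'e) \<Rightarrow> bool"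
  where "spectral_sequence R E d \<longleftrightarrow> (\<forall>r\<ge>1. \<forall>p q.
    Module.module R (E r p q) \<and>
    d r p q \<in> mod_hom R (E r p q) (E r (p + int r) (q - int r + 1)) \<and>
    (\<forall>x\<in>carrier (E r p q). d r (p + int r) (q - int r + 1) (d r p q x)
        = \<zero>\<^bsub>E r (p + 2 * int r) (q - 2 * int r + 2)\<^esub>) \<and>
    mod_isomorphic R (E (r + 1) p q)
      (quot_module
        ((E r p q)\<lparr>carrier := {x \<in> carrier (E r p q).
            d r p q x = \<zero>\<^bsub>E r (p + int r) (q - int r + 1)\<^esub>}\<rparr>)
        (d r (p - int r) (q + int r - 1) ` carrier (E r (p - int r) (q + int r - 1)))))"

(* M is $E_\infty^{p,q}$: from some page on, all differentials leaving and arriving at position (p,q)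
   vanish, and M is the stable value. *)
definition is_E_infinity ::
  "('r, 'm) ring_scheme \<Rightarrow> (nat \<Rightarrow> int \<Rightarrow> int \<Rightarrow> ('r, 'e) module) \<Rightarrow>
   (nat \<Rightarrow> int \<Rightarrow> int \<Rightarrow> 'e \<Rightarrow> 'e) \<Rightarrow> int \<Rightarrow> int \<Rightarrow> ('r, 'h) module \<Rightarrow> bool"
  where "is_E_infinity R E d p q M \<longleftrightarrow> (\<exists>r0\<ge>1. \<forall>r\<ge>r0.
    (\<forall>x\<in>carrier (E r p q). d r p q x = \<zero>\<^bsub>E r (p + int r) (q - int r + 1)\<^esub>) \<and>
    (\<forall>x\<in>carrier (E r (p - int r) (q + int r - 1)).
        d r (p - int r) (q + int r - 1) x = \<zero>\<^bsub>E r p q\<^esub>) \<and>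
    mod_isomorphic R (E r p q) M)"

(* F n p stands for $F^p H^n$. *)
definition ss_converges ::
  "('r, 'm) ring_scheme \<Rightarrow> (nat \<Rightarrow> int \<Rightarrow> int \<Rightarrow> ('r, 'e) module) \<Rightarrow>
   (nat \<Rightarrow> int \<Rightarrow> int \<Rightarrow> 'e \<Rightarrow> 'e) \<Rightarrow> (int \<Rightarrow> ('r, 'h) module) \<Rightarrow> bool"
  where "ss_converges R E d H \<longleftrightarrow> (\<exists>F :: int \<Rightarrow> int \<Rightarrow> 'h set.
    (\<forall>n p. submodule (F n p) R (H n) \<and> F n (p + 1) \<subseteq> F n p) \<and>
    (\<forall>n. \<exists>s t. F n s = carrier (H n) \<and> F n t = {\<zero>\<^bsub>H n\<^esub>}) \<and>
    (\<forall>p q. is_E_infinity R E d p q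
      (quot_module ((H (p + q))\<lparr>carrier := F (p + q) p\<rparr>) (F (p + q) (p + 1)))))"

section \<open>Differential graded algebras\<close>

definition pm_scale :: "'k::field \<Rightarrow> ('x \<Rightarrow>\<^sub>0 'k) \<Rightarrow> ('x \<Rightarrow>\<^sub>0 'k)"
  where "pm_scale c f = Poly_Mapping.map ((*) c) f"

(* The unit e is a parameter (rather than 1 of class ring_1) so that the zero algebra is allowed.
   G m is the homogeneous part $A^m$. *)
locale dga = vector_space scale
  for scale :: "'k::field \<Rightarrow> 'a::ring \<Rightarrow> 'a" +
  fixes e :: 'a
    and G :: "nat \<Rightarrow> 'a set"
    and phi :: "'a \<Rightarrow> 'a"
  assumes unit_left: "e * x = x"
    and unit_right: "x * e = x"
    and scale_mult_left: "scale c x * y = scale c (x * y)"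
    and scale_mult_right: "x * scale c y = scale c (x * y)"
    and graded_subspace: "subspace (G m)"
    and graded_direct_sum:
      "\<exists>!u :: nat \<Rightarrow> 'a. (\<forall>m. u m \<in> G m) \<and> finite {m. u m \<noteq> 0} \<and> x = (\<Sum>m | u m \<noteq> 0. u m)"
    and unit_graded: "e \<in> G 0"
    and mult_graded: "x \<in> G i \<Longrightarrow> y \<in> G j \<Longrightarrow> x * y \<in> G (i + j)"
    and phi_linear: "Vector_Spaces.linear scale scale phi"
    and phi_graded: "x \<in> G (Suc m) \<Longrightarrow> phi x \<in> G m"
    and phi_graded_0: "x \<in> G 0 \<Longrightarrow> phi x = 0"
    and phi_phi: "phi (phi x) = 0"
    and phi_leibniz: "x \<in> G i \<Longrightarrow> phi (x * y) = phi x * y + scale ((-1) ^ i) (x * phi y)"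
begin

subsection \<open>Tensor powers\<close>

definition free_words :: "nat \<Rightarrow> ('k, 'a list \<Rightarrow>\<^sub>0 'k) module"
  where "free_words n =
    \<lparr>carrier = {f. \<forall>xs\<in>Poly_Mapping.keys f. length xs = n},
     monoid.mult = undefined, one = undefined, zero = 0, add = (+), module.smult = pm_scale\<rparr>"

definition tensor_relations :: "nat \<Rightarrow> ('a list \<Rightarrow>\<^sub>0 'k) set"
  where "tensor_relations n = module.span pm_scale
    ({Poly_Mapping.single (us @ (x + y) # vs) 1 - Poly_Mapping.single (us @ x # vs) 1
        - Poly_Mapping.single (us @ y # vs) 1 | us vs x y. length us + 1 + length vs = n} \<union>
     {Poly_Mapping.single (us @ scale c x # vs) 1 - pm_scale c (Poly_Mapping.single (us @ x # vs) 1)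
        | us vs c x. length us + 1 + length vs = n})"

definition tensor_power :: "nat \<Rightarrow> ('k, ('a list \<Rightarrow>\<^sub>0 'k) set) module"
  where "tensor_power n = quot_module (free_words n) (tensor_relations n)"

definition tensor :: "'a list \<Rightarrow> ('a list \<Rightarrow>\<^sub>0 'k) set"
  where "tensor xs =
    tensor_relations (length xs) +>\<^bsub>free_words (length xs)\<^esub> Poly_Mapping.single xs 1"

(* ds lists degrees of the entries of xs; the list ds is explicit because 0 has every degree. *)
definition homogeneous :: "nat list \<Rightarrow> 'a list \<Rightarrow> bool"
  where "homogeneous ds xs \<longleftrightarrow> list_all2 (\<lambda>d x. x \<in> G d) ds xs"

(* $(A^{\otimes n})^m$, the span of the tensors of homogeneous elements of total degree m *)
definition tensor_graded :: "nat \<Rightarrow> nat \<Rightarrow> ('k, ('a list \<Rightarrow>\<^sub>0 'k) set) module"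
  where "tensor_graded n m = (tensor_power n)\<lparr>carrier :=
    (\<lambda>f. tensor_relations n +>\<^bsub>free_words n\<^esub> f) `
      module.span pm_scale
        {Poly_Mapping.single xs 1 | ds xs. homogeneous ds xs \<and> length xs = n \<and> sum_list ds = m}\<rparr>"

(* $\phi^{\otimes n}$ *)
definition tensor_diff :: "nat \<Rightarrow> ('a list \<Rightarrow>\<^sub>0 'k) set \<Rightarrow> ('a list \<Rightarrow>\<^sub>0 'k) set"
  where "tensor_diff n =
    (THE D. D \<in> mod_hom ring_of_type_algebra (tensor_power n) (tensor_power n) \<and>
       D \<in> extensional (carrier (tensor_power n)) \<and>
       (\<forall>ds xs. homogeneous ds xs \<and> length xs = n \<longrightarrow>
          D (tensor xs) = (\<Oplus>\<^bsub>tensor_power n\<^esub> i \<in> {..<n}.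
            (-1) ^ sum_list (take i ds) \<odot>\<^bsub>tensor_power n\<^esub> tensor (xs[i := phi (xs ! i)]))))"

subsection \<open>Cochains and operators\<close>

definition cochains :: "nat \<Rightarrow> nat \<Rightarrow> ('k, ('a list \<Rightarrow>\<^sub>0 'k) set \<Rightarrow> 'k) module"
  where "cochains n m = dual_module (tensor_graded (n + 1) m)"

(* The element of $C^n(A)^m$ with value h ds xs on the tensor of xs, for xs homogeneous of degrees ds *)
definition cochain_of ::
  "nat \<Rightarrow> nat \<Rightarrow> (nat list \<Rightarrow> 'a list \<Rightarrow> 'k) \<Rightarrow> ('a list \<Rightarrow>\<^sub>0 'k) set \<Rightarrow> 'k"
  where "cochain_of n m h =
    (THE f. f \<in> carrier (cochains n m) \<and>
      (\<forall>ds xs. homogeneous ds xs \<and> length xs = n + 1 \<and> sum_list ds = m \<longrightarrow>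
         f (tensor xs) = h ds xs))"

(* In all operators except op_delta, the indices n m are those of the target $C^n(A)^m$. *)

definition op_delta ::
  "nat \<Rightarrow> nat \<Rightarrow> (('a list \<Rightarrow>\<^sub>0 'k) set \<Rightarrow> 'k) \<Rightarrow> (('a list \<Rightarrow>\<^sub>0 'k) set \<Rightarrow> 'k)"
  where "op_delta n m f = (\<lambda>t. if t \<in> carrier (tensor_graded (n + 1) (m + 1))
    then (-1) ^ m * f (tensor_diff (n + 1) t) else 0)"

definition gamma :: "nat list \<Rightarrow> nat"
  where "gamma ds = last ds * sum_list (butlast ds)"

definition op_b ::
  "nat \<Rightarrow> nat \<Rightarrow> (('a list \<Rightarrow>\<^sub>0 'k) set \<Rightarrow> 'k) \<Rightarrow> (('a list \<Rightarrow>\<^sub>0 'k) set \<Rightarrow> 'k)"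
  where "op_b n m f = cochain_of n m (\<lambda>ds xs.
    (\<Sum>i<n. (-1) ^ i * f (tensor (take i xs @ (xs ! i * xs ! (i + 1)) # drop (i + 2) xs)))
    + (-1) ^ (n + gamma ds) * f (tensor ((last xs * hd xs) # butlast (tl xs))))"

definition op_tau ::
  "nat \<Rightarrow> nat \<Rightarrow> (('a list \<Rightarrow>\<^sub>0 'k) set \<Rightarrow> 'k) \<Rightarrow> (('a list \<Rightarrow>\<^sub>0 'k) set \<Rightarrow> 'k)"
  where "op_tau n m f = cochain_of n m (\<lambda>ds xs.
    (-1) ^ (n + gamma ds) * f (tensor (last xs # butlast xs)))"

definition op_N ::
  "nat \<Rightarrow> nat \<Rightarrow> (('a list \<Rightarrow>\<^sub>0 'k) set \<Rightarrow> 'k) \<Rightarrow> (('a list \<Rightarrow>\<^sub>0 'k) set \<Rightarrow> 'k)"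
  where "op_N n m f = (\<lambda>t. \<Sum>i\<le>n. (op_tau n m ^^ i) f t)"

definition op_s ::
  "nat \<Rightarrow> nat \<Rightarrow> (('a list \<Rightarrow>\<^sub>0 'k) set \<Rightarrow> 'k) \<Rightarrow> (('a list \<Rightarrow>\<^sub>0 'k) set \<Rightarrow> 'k)"
  where "op_s n m f = cochain_of n m (\<lambda>ds xs. (-1) ^ n * f (tensor (xs @ [e])))"

definition op_B ::
  "nat \<Rightarrow> nat \<Rightarrow> (('a list \<Rightarrow>\<^sub>0 'k) set \<Rightarrow> 'k) \<Rightarrow> (('a list \<Rightarrow>\<^sub>0 'k) set \<Rightarrow> 'k)"
  where "op_B n m f = op_N n m (op_s n m (\<lambda>t. f t - op_tau (n + 1) m f t))"

subsection \<open>Cyclic cohomology\<close>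

definition EC :: "nat \<Rightarrow> nat \<Rightarrow> nat \<Rightarrow> ('k, ('a list \<Rightarrow>\<^sub>0 'k) set \<Rightarrow> 'k) module"
  where "EC p q r = cochains (q - p) r"

(* positions (p,q,r) of total degree n at which the tricomplex is not 0 by definition *)
definition tot_index :: "int \<Rightarrow> (nat \<times> nat \<times> nat) set"
  where "tot_index n = {(p, q, r). p \<le> q \<and> int (p + q + r) = n}"

definition tot :: "int \<Rightarrow> ('k, nat \<times> nat \<times> nat \<Rightarrow> ('a list \<Rightarrow>\<^sub>0 'k) set \<Rightarrow> 'k) module"
  where "tot n = direct_sum_module (tot_index n) (\<lambda>(p, q, r). EC p q r)"

(* The component at (p,q,r) collects what arrives from (p,q-1,r), (p-1,q,r) and (p,q,r-1). *)
definition tot_diff ::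
  "int \<Rightarrow> (nat \<times> nat \<times> nat \<Rightarrow> ('a list \<Rightarrow>\<^sub>0 'k) set \<Rightarrow> 'k) \<Rightarrow>
   (nat \<times> nat \<times> nat \<Rightarrow> ('a list \<Rightarrow>\<^sub>0 'k) set \<Rightarrow> 'k)"
  where "tot_diff n x = restrict (\<lambda>(p, q, r) t.
      (if p < q then op_b (q - p) r (x (p, q - 1, r)) t else 0)
    + (if 0 < p then op_B (q - p) r (x (p - 1, q, r)) t else 0)
    + (if 0 < r then (-1) ^ (q - p) * op_delta (q - p) (r - 1) (x (p, q, r - 1)) t else 0))
    (tot_index (n + 1))"

definition HC :: "int \<Rightarrow> ('k, (nat \<times> nat \<times> nat \<Rightarrow> ('a list \<Rightarrow>\<^sub>0 'k) set \<Rightarrow> 'k) set) module"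
  where "HC n = cohomology tot tot_diff n"

subsection \<open>The column complexes and their cohomology\<close>

(* For p < 0 or t < 0 the index set is empty, so the direct sum is the zero module. *)
definition col_index :: "int \<Rightarrow> int \<Rightarrow> nat set"
  where "col_index p t = {i. int i \<le> p \<and> int i \<le> t}"

definition col :: "int \<Rightarrow> int \<Rightarrow> ('k, nat \<Rightarrow> ('a list \<Rightarrow>\<^sub>0 'k) set \<Rightarrow> 'k) module"
  where "col p t = direct_sum_module (col_index p t)
    (\<lambda>i. cochains (nat (p - int i)) (nat (t - int i)))"

(* B maps the summand i - 1 in degree t to the summand i in degree t + 1. *)
definition col_diff ::
  "int \<Rightarrow> int \<Rightarrow> (nat \<Rightarrow> ('a list \<Rightarrow>\<^sub>0 'k) set \<Rightarrow> 'k) \<Rightarrow> (nat \<Rightarrow> ('a list \<Rightarrow>\<^sub>0 'k) set \<Rightarrow> 'k)"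
  where "col_diff p t x = restrict (\<lambda>i s.
      (if 0 < i then op_B (nat (p - int i)) (nat (t + 1 - int i)) (x (i - 1)) s else 0)
    + (if int i \<le> t then (-1) ^ nat (p - int i)
          * op_delta (nat (p - int i)) (nat (t - int i)) (x i) s else 0))
    (col_index p (t + 1))"

(* b from degree t of column p to degree t of column p + 1 *)
definition col_b ::
  "int \<Rightarrow> int \<Rightarrow> (nat \<Rightarrow> ('a list \<Rightarrow>\<^sub>0 'k) set \<Rightarrow> 'k) \<Rightarrow> (nat \<Rightarrow> ('a list \<Rightarrow>\<^sub>0 'k) set \<Rightarrow> 'k)"
  where "col_b p t x = restrict (\<lambda>i s.
      if int i \<le> p then op_b (nat (p + 1 - int i)) (nat (t - int i)) (x i) s else 0)
    (col_index (p + 1) t)"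

(* degree p of the complex with terms H^q of the p-th column, and its differential induced by b *)
definition col_cohomology ::
  "int \<Rightarrow> int \<Rightarrow> ('k, (nat \<Rightarrow> ('a list \<Rightarrow>\<^sub>0 'k) set \<Rightarrow> 'k) set) module"
  where "col_cohomology q p = cohomology (col p) (col_diff p) q"

definition col_cohomology_diff ::
  "int \<Rightarrow> int \<Rightarrow> (nat \<Rightarrow> ('a list \<Rightarrow>\<^sub>0 'k) set \<Rightarrow> 'k) set \<Rightarrow>
   (nat \<Rightarrow> ('a list \<Rightarrow>\<^sub>0 'k) set \<Rightarrow> 'k) set"
  where "col_cohomology_diff q p =
    quot_map (col (p + 1) q) (coboundaries (col (p + 1)) (col_diff (p + 1)) q) (col_b p q)"

end

end

theory Submission
  imports Defs "HOL-Library.Function_Algebras"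
begin

text \<open>
Put the component \<open>EC(A)\<^sup>p\<^sup>,\<^sup>q\<^sup>,\<^sup>r\<close> of the tricomplex into column \<open>q\<close> and row \<open>p + r\<close>. This gives a double complex
in the first quadrant whose horizontal differential is \<open>b\<close> and whose vertical differential is \<open>B\<close> plus the
signed \<open>\<delta>\<close>. Its total complex is \<open>T(EC(A))\<close> and its columns are the complexes \<open>\<Oplus> \<Sigma> C(A)\<^sup>*\<close>. The spectral
sequence of the theorem is the one of the filtration by columns: \<open>E\<^sub>1\<close> is the cohomology of the columns,
with the differential induced by \<open>b\<close>, so that \<open>E\<^sub>2\<close> is as stated, and the filtration is finite in each
total degree. The general facts are \<open>spectral_sequence_E\<close>, \<open>E2_isomorphic\<close> and \<open>converges_E\<close>.

It has to be shown that the operators form a double complex. Once the values of cochains on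
homogeneous tensors are regarded as functions of words, this is a calculation with words. Adding
rotation \<open>\<tau>\<close>, its norm \<open>N\<close>, the operator \<open>b'\<close> without the last term of \<open>b\<close>, and the insertion \<open>s\<close> of the unit, one has
\<open>\<tau>\<^sup>n\<^sup>+\<^sup>1 = 1\<close>, \<open>(1 - \<tau>) b = b' (1 - \<tau>)\<close>, \<open>b N = N b'\<close> and \<open>b' s + s b' = 1\<close>, and these imply \<open>b b = 0\<close>
(\<open>hoch_hoch\<close>), \<open>B B = 0\<close> (\<open>connes_connes\<close>) and \<open>b B + B b = 0\<close> (\<open>hoch_connes\<close>). By the Leibniz rule the
differential of the tensor powers commutes with \<open>b\<close> and \<open>B\<close>; the signs turn this into anticommuting
with the vertical \<open>\<delta>\<close> (\<open>hoch_delta\<close>, \<open>connes_delta\<close>). These identities combine to \<open>hor_ver_square\<close>.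

The operators on cochains are defined by unique existence. The existence of a functional with given
values on homogeneous tensors is lemma \<open>word_cochain\<close>; it makes cochains the same as multilinear
functions of homogeneous words. The lemmas \<open>op_b_word_cochain\<close>, \<open>op_B_word_cochain\<close> and
\<open>op_delta_word_cochain\<close> identify the operators with those on words, the last one after the differential of
the tensor powers has been constructed by means of the grading involution.

The total complex, the columns and everything formed from them, up to the cohomology of the cohomology of
the columns, are presented as quotients of subspaces of a single vector space of families of functions
of words (\<open>presents\<close>). The construction of the spectral sequence is thereby reduced to subspaces and
linear maps. The tensor powers are presented in the same way by the free vector space on lists.
\<close>

section \<open>Modules presented as subquotients of a vector space\<close>

locale linear_quotients = vector_space scale
  for scale :: "'k::field \<Rightarrow> 'v::ab_group_add \<Rightarrow> 'v"
begin

definition endo :: "('v \<Rightarrow> 'v) \<Rightarrow> bool"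
  where "endo f \<longleftrightarrow> (\<forall>x y. f (x + y) = f x + f y) \<and> (\<forall>c x. f (scale c x) = scale c (f x))"

lemma endo_add: "endo f \<Longrightarrow> f (x + y) = f x + f y"
  and endo_scale: "endo f \<Longrightarrow> f (scale c x) = scale c (f x)"
  unfolding endo_def by blast+

lemma endo_0: "endo f \<Longrightarrow> f 0 = 0"
  using endo_scale[of f 0 0] by simp

lemma endo_diff: "endo f \<Longrightarrow> f (x - y) = f x - f y"
  using endo_add[of f "x - y" y] by (simp add: algebra_simps)

lemma endo_neg: "endo f \<Longrightarrow> f (- x) = - f x"
  using endo_diff[of f 0 x] endo_0[of f] by simp

lemma endo_subspace_image:
  assumes "endo f" "subspace S"
  shows "subspace (f ` S)"
  unfolding subspace_def
proof (intro conjI ballI allI)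
  show "0 \<in> f ` S" using endo_0[OF assms(1)] subspace_0[OF assms(2)] by (metis imageI)
qed (use assms(2) in \<open>force simp flip: endo_add[OF assms(1)] endo_scale[OF assms(1)]
    simp: subspace_add subspace_scale\<close>)+

text \<open>\<open>presents M Z B \<pi>\<close> says that \<open>\<pi>\<close> induces an isomorphism from \<open>Z / B\<close> onto \<open>M\<close>. Modules with
carriers are described in this way by subspaces of a vector space, so that kernels, images and
isomorphisms become statements about subspaces.\<close>

definition presents :: "('k, 'm) module \<Rightarrow> 'v set \<Rightarrow> 'v set \<Rightarrow> ('v \<Rightarrow> 'm) \<Rightarrow> bool"
  where "presents M Z B \<pi> \<longleftrightarrow>
    subspace Z \<and> subspace B \<and> B \<subseteq> Z \<and> \<pi> ` Z = carrier M \<and>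
    (\<forall>x\<in>Z. \<forall>y\<in>Z. \<pi> (x + y) = \<pi> x \<oplus>\<^bsub>M\<^esub> \<pi> y) \<and>
    (\<forall>c. \<forall>x\<in>Z. \<pi> (scale c x) = c \<odot>\<^bsub>M\<^esub> \<pi> x) \<and>
    (\<forall>x\<in>Z. \<pi> x = \<zero>\<^bsub>M\<^esub> \<longleftrightarrow> x \<in> B)"

lemma presentsD:
  assumes "presents M Z B \<pi>"
  shows "subspace Z" "subspace B" "B \<subseteq> Z" "\<pi> ` Z = carrier M"
    "\<And>x y. x \<in> Z \<Longrightarrow> y \<in> Z \<Longrightarrow> \<pi> (x + y) = \<pi> x \<oplus>\<^bsub>M\<^esub> \<pi> y"
    "\<And>c x. x \<in> Z \<Longrightarrow> \<pi> (scale c x) = c \<odot>\<^bsub>M\<^esub> \<pi> x"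
    "\<And>x. x \<in> Z \<Longrightarrow> \<pi> x = \<zero>\<^bsub>M\<^esub> \<longleftrightarrow> x \<in> B"
    "\<And>x. x \<in> Z \<Longrightarrow> \<pi> x \<in> carrier M"
  using assms unfolding presents_def by blast+

lemma presents_zero:
  assumes "presents M Z B \<pi>"
  shows "\<pi> 0 = \<zero>\<^bsub>M\<^esub>"
  using presentsD[OF assms] subspace_0 by blast

text \<open>The module laws hold for representatives in \<open>Z\<close>, and \<open>\<pi>\<close> carries them over to \<open>M\<close>.\<close>

lemma presents_module:
  assumes "presents M Z B \<pi>"
  shows "Module.module (ring_of_type_algebra :: 'k ring) M"
proof (rule Module.moduleI)
  note P = presentsD[OF assms]
  note sub = subspace_add[OF P(1)] subspace_scale[OF P(1)] subspace_0[OF P(1)]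
  have rep: "\<exists>x\<in>Z. u = \<pi> x" if "u \<in> carrier M" for u
    using that P(4) by blast
  show "cring (ring_of_type_algebra :: 'k ring)" by (rule cring_from_type_algebra)
  show "abelian_group M"
  proof (rule abelian_groupI)
    fix u v w assume "u \<in> carrier M" "v \<in> carrier M" "w \<in> carrier M"
    then obtain x y z where [simp]: "x \<in> Z" "u = \<pi> x" "y \<in> Z" "v = \<pi> y" "z \<in> Z" "w = \<pi> z"
      using rep by metis
    show "u \<oplus>\<^bsub>M\<^esub> v \<oplus>\<^bsub>M\<^esub> w = u \<oplus>\<^bsub>M\<^esub> (v \<oplus>\<^bsub>M\<^esub> w)"
      by (simp flip: P(5) add: sub add.assoc)
  next
    fix u v assume "u \<in> carrier M" "v \<in> carrier M"
    then obtain x y where [simp]: "x \<in> Z" "u = \<pi> x" "y \<in> Z" "v = \<pi> y" using rep by metis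
    show "u \<oplus>\<^bsub>M\<^esub> v \<in> carrier M" by (simp flip: P(5) add: sub P(8))
    show "u \<oplus>\<^bsub>M\<^esub> v = v \<oplus>\<^bsub>M\<^esub> u" by (simp flip: P(5) add: sub add.commute)
  next
    fix u assume "u \<in> carrier M"
    then obtain x where [simp]: "x \<in> Z" "u = \<pi> x" using rep by metis
    have "\<pi> (0 + x) = \<zero>\<^bsub>M\<^esub> \<oplus>\<^bsub>M\<^esub> \<pi> x"
      using P(5)[of 0 x] by (simp add: sub presents_zero[OF assms])
    then show "\<zero>\<^bsub>M\<^esub> \<oplus>\<^bsub>M\<^esub> u = u" by simp
    have "\<pi> (- x) \<oplus>\<^bsub>M\<^esub> u = \<zero>\<^bsub>M\<^esub>"
      using P(5)[of "- x" x] presents_zero[OF assms] subspace_neg[OF P(1)] by simp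
    then show "\<exists>y\<in>carrier M. y \<oplus>\<^bsub>M\<^esub> u = \<zero>\<^bsub>M\<^esub>"
      using P(8)[of "- x"] subspace_neg[OF P(1)] by auto
  next
    show "\<zero>\<^bsub>M\<^esub> \<in> carrier M" using presents_zero[OF assms] P(8)[of 0] sub(3) by simp
  qed
next
  note P = presentsD[OF assms]
  note sub = subspace_add[OF P(1)] subspace_scale[OF P(1)] subspace_0[OF P(1)]
  have rep: "\<exists>x\<in>Z. u = \<pi> x" if "u \<in> carrier M" for u
    using that P(4) by blast
  fix c d :: 'k and u v assume "u \<in> carrier M" "v \<in> carrier M"
  then obtain x y where [simp]: "x \<in> Z" "u = \<pi> x" "y \<in> Z" "v = \<pi> y" using rep by metis
  show "c \<odot>\<^bsub>M\<^esub> (u \<oplus>\<^bsub>M\<^esub> v) = c \<odot>\<^bsub>M\<^esub> u \<oplus>\<^bsub>M\<^esub> c \<odot>\<^bsub>M\<^esub> v"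
    by (simp flip: P(5) P(6) add: sub scale_right_distrib)
next
  note P = presentsD[OF assms]
  note sub = subspace_add[OF P(1)] subspace_scale[OF P(1)] subspace_0[OF P(1)]
  have rep: "\<exists>x\<in>Z. u = \<pi> x" if "u \<in> carrier M" for u
    using that P(4) by blast
  fix c d :: 'k and u assume "u \<in> carrier M"
  then obtain x where [simp]: "x \<in> Z" "u = \<pi> x" using rep by metis
  show "c \<odot>\<^bsub>M\<^esub> u \<in> carrier M" by (simp flip: P(6) add: sub P(8))
  show "(c \<oplus>\<^bsub>ring_of_type_algebra\<^esub> d) \<odot>\<^bsub>M\<^esub> u = c \<odot>\<^bsub>M\<^esub> u \<oplus>\<^bsub>M\<^esub> d \<odot>\<^bsub>M\<^esub> u"
    by (simp flip: P(5) P(6) add: sub scale_left_distrib ring_of_type_algebra_def)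
  show "(c \<otimes>\<^bsub>ring_of_type_algebra\<^esub> d) \<odot>\<^bsub>M\<^esub> u = c \<odot>\<^bsub>M\<^esub> (d \<odot>\<^bsub>M\<^esub> u)"
    by (simp flip: P(6) add: sub ring_of_type_algebra_def)
  show "\<one>\<^bsub>ring_of_type_algebra\<^esub> \<odot>\<^bsub>M\<^esub> u = u"
    by (simp flip: P(6) add: sub ring_of_type_algebra_def)
qed

lemma presents_eq_iff:
  assumes "presents M Z B \<pi>" "x \<in> Z" "y \<in> Z"
  shows "\<pi> x = \<pi> y \<longleftrightarrow> x - y \<in> B"
proof -
  note P = presentsD[OF assms(1)]
  interpret M: Module.module "ring_of_type_algebra :: 'k ring" M
    by (rule presents_module[OF assms(1)])
  have D: "x - y \<in> Z" using assms P(1) subspace_diff by blast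
  have "\<pi> x = \<pi> (x - y) \<oplus>\<^bsub>M\<^esub> \<pi> y"
    using P(5)[OF D assms(3)] by simp
  then have "\<pi> x = \<pi> y \<longleftrightarrow> \<pi> (x - y) \<oplus>\<^bsub>M\<^esub> \<pi> y = \<zero>\<^bsub>M\<^esub> \<oplus>\<^bsub>M\<^esub> \<pi> y"
    using M.l_zero[OF P(8)[OF assms(3)]] by simp
  then have "\<pi> x = \<pi> y \<longleftrightarrow> \<pi> (x - y) = \<zero>\<^bsub>M\<^esub>"
    using M.add.r_cancel[OF _ P(8)[OF D] M.zero_closed P(8)[OF assms(3)]] by auto
  then show ?thesis using P(7)[OF D] by simp
qed

lemma presents_submodule:
  assumes "presents M Z B \<pi>" "subspace Z1" "Z1 \<subseteq> Z"
  shows "submodule (\<pi> ` Z1) (ring_of_type_algebra :: 'k ring) M"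
proof -
  note P = presentsD[OF assms(1)]
  interpret M: Module.module "ring_of_type_algebra :: 'k ring" M
    by (rule presents_module[OF assms(1)])
  show ?thesis
  proof (rule M.submoduleI)
    show "\<pi> ` Z1 \<subseteq> carrier M" using P(4) assms(3) by blast
    show "\<zero>\<^bsub>M\<^esub> \<in> \<pi> ` Z1"
      using presents_zero[OF assms(1)] subspace_0[OF assms(2)] by (metis imageI)
  next
    fix a assume "a \<in> \<pi> ` Z1"
    then obtain z where z: "z \<in> Z1" "a = \<pi> z" by blast
    have "\<pi> (- z) \<oplus>\<^bsub>M\<^esub> \<pi> z = \<zero>\<^bsub>M\<^esub>"
      using P(5)[of "- z" z] z assms(3) subspace_neg[OF assms(2)] presents_zero[OF assms(1)]
      by (metis add.left_inverse subsetD)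
    then have "\<ominus>\<^bsub>M\<^esub> a = \<pi> (- z)"
      using z P(8) assms(3) subspace_neg[OF assms(2)] by (metis M.minus_equality subsetD)
    then show "\<ominus>\<^bsub>M\<^esub> a \<in> \<pi> ` Z1" using z subspace_neg[OF assms(2)] by blast
  next
    fix a b assume "a \<in> \<pi> ` Z1" "b \<in> \<pi> ` Z1"
    then obtain x y where xy: "x \<in> Z1" "y \<in> Z1" "a = \<pi> x" "b = \<pi> y" by blast
    then have "a \<oplus>\<^bsub>M\<^esub> b = \<pi> (x + y)" using P(5) assms(3) by (metis subsetD)
    then show "a \<oplus>\<^bsub>M\<^esub> b \<in> \<pi> ` Z1" using subspace_add[OF assms(2)] xy by blast
  next
    fix c :: 'k and a assume "a \<in> \<pi> ` Z1"
    then obtain x where x: "x \<in> Z1" "a = \<pi> x" by blast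
    then have "c \<odot>\<^bsub>M\<^esub> a = \<pi> (scale c x)" using P(6) assms(3) by (metis subsetD)
    then show "c \<odot>\<^bsub>M\<^esub> a \<in> \<pi> ` Z1" using subspace_scale[OF assms(2)] x by blast
  qed
qed

text \<open>A coset of \<open>\<pi> ` B1\<close> is the image of the coset \<open>z + B1\<close>, also when it is formed in a submodule with
carrier \<open>W\<close>.\<close>

lemma presents_coset:
  assumes "presents M Z B \<pi>" "B1 \<subseteq> Z" "z \<in> Z"
  shows "\<pi> ` B1 +>\<^bsub>M\<lparr>carrier := W\<rparr>\<^esub> \<pi> z = \<pi> ` ((\<lambda>b. b + z) ` B1)"
    and "\<pi> ` B1 +>\<^bsub>M\<^esub> \<pi> z = \<pi> ` ((\<lambda>b. b + z) ` B1)"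
  using presentsD(5)[OF assms(1)] assms(2,3)
  by (auto simp: a_r_coset_def' image_def subset_iff)

text \<open>Quotients of submodules are presented by the corresponding preimages. This is what allows
cohomology to be taken repeatedly without leaving the vector space of representatives.\<close>

lemma presents_quot_module:
  assumes P0: "presents M Z B \<pi>"
    and Z1: "subspace Z1" "Z1 \<subseteq> Z" and B1: "subspace B1" "B \<subseteq> B1" "B1 \<subseteq> Z1"
  shows "presents (quot_module (M\<lparr>carrier := \<pi> ` Z1\<rparr>) (\<pi> ` B1)) Z1 B1
    (\<lambda>z. \<pi> ` B1 +>\<^bsub>M\<^esub> \<pi> z)"
proof -
  note P = presentsD[OF P0]
  let ?C = "\<lambda>z. \<pi> ` ((\<lambda>b. b + z) ` B1)"
  have B1Z: "B1 \<subseteq> Z" using Z1 B1 by blast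
  have co: "\<pi> ` B1 +>\<^bsub>M\<^esub> \<pi> z = ?C z" "\<pi> ` B1 +>\<^bsub>M\<lparr>carrier := W\<rparr>\<^esub> \<pi> z = ?C z" if "z \<in> Z1" for z W
    using presents_coset[OF P0 B1Z] Z1 that by blast+
  have inZ: "b + z \<in> Z1" if "b \<in> B1" "z \<in> Z1" for b z
    using that B1 Z1 subspace_add by blast
  have add: "?C x <+>\<^bsub>M\<lparr>carrier := W\<rparr>\<^esub> ?C y = ?C (x + y)" if "x \<in> Z1" "y \<in> Z1" for x y W
  proof (intro equalityI subsetI)
    fix u assume "u \<in> ?C x <+>\<^bsub>M\<lparr>carrier := W\<rparr>\<^esub> ?C y"
    then obtain b b' where b: "b \<in> B1" "b' \<in> B1" "u = \<pi> (b + x) \<oplus>\<^bsub>M\<^esub> \<pi> (b' + y)"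
      by (auto simp: set_add_def')
    have "u = \<pi> ((b + x) + (b' + y))"
      using b P(5) inZ that Z1 by (metis subsetD)
    also have "(b + x) + (b' + y) = (b + b') + (x + y)" by (simp add: algebra_simps)
    finally show "u \<in> ?C (x + y)" using b subspace_add[OF B1(1)] by blast
  next
    fix u assume "u \<in> ?C (x + y)"
    then obtain b where b: "b \<in> B1" "u = \<pi> (b + (x + y))" by blast
    have "b + (x + y) = (b + x) + (0 + y)" by (simp add: algebra_simps)
    then have "u = \<pi> (b + x) \<oplus>\<^bsub>M\<^esub> \<pi> (0 + y)"
      using b P(5)[of "b + x" "0 + y"] inZ[OF b(1) that(1)] inZ[OF subspace_0[OF B1(1)] that(2)] Z1
      by (metis subsetD)
    then show "u \<in> ?C x <+>\<^bsub>M\<lparr>carrier := W\<rparr>\<^esub> ?C y"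
      using b subspace_0[OF B1(1)] unfolding set_add_def' by fastforce
  qed
  have scal: "(\<Union>u\<in>?C x. \<pi> ` B1 +>\<^bsub>M\<lparr>carrier := W\<rparr>\<^esub> (c \<odot>\<^bsub>M\<^esub> u)) = ?C (scale c x)" if "x \<in> Z1" for c x W
  proof -
    have "\<pi> ` B1 +>\<^bsub>M\<lparr>carrier := W\<rparr>\<^esub> (c \<odot>\<^bsub>M\<^esub> u) = ?C (scale c x)" if "u \<in> ?C x" for u
    proof -
      obtain b where b: "b \<in> B1" "u = \<pi> (b + x)" using \<open>u \<in> ?C x\<close> by blast
      have bx: "b + x \<in> Z" "scale c (b + x) \<in> Z1"
        using inZ b \<open>x \<in> Z1\<close> Z1 subspace_scale[OF Z1(1)] by blast+
      have "c \<odot>\<^bsub>M\<^esub> u = \<pi> (scale c (b + x))" using P(6)[OF bx(1)] b by simp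
      then have "\<pi> ` B1 +>\<^bsub>M\<lparr>carrier := W\<rparr>\<^esub> (c \<odot>\<^bsub>M\<^esub> u) = ?C (scale c (b + x))"
        using co(2)[OF bx(2)] by simp
      also have "(\<lambda>b'. b' + scale c (b + x)) ` B1 = (\<lambda>b'. b' + scale c x) ` B1"
      proof (intro equalityI subsetI)
        fix y assume "y \<in> (\<lambda>b'. b' + scale c (b + x)) ` B1"
        then obtain b' where "b' \<in> B1" "y = (b' + scale c b) + scale c x"
          by (auto simp: scale_right_distrib add.assoc)
        then show "y \<in> (\<lambda>b'. b' + scale c x) ` B1"
          using subspace_add[OF B1(1)] subspace_scale[OF B1(1)] b by blast
      next
        fix y assume "y \<in> (\<lambda>b'. b' + scale c x) ` B1"
        then obtain b' where "b' \<in> B1" "y = (b' - scale c b) + scale c (b + x)"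
          by (auto simp: scale_right_distrib)
        then show "y \<in> (\<lambda>b'. b' + scale c (b + x)) ` B1"
          using subspace_diff[OF B1(1)] subspace_scale[OF B1(1)] b by blast
      qed
      finally show ?thesis .
    qed
    moreover have "?C x \<noteq> {}" using subspace_0[OF B1(1)] by blast
    ultimately show ?thesis by (intro SUP_eq_const) auto
  qed
  have zero: "?C x = \<pi> ` B1 \<longleftrightarrow> x \<in> B1" if x: "x \<in> Z1" for x
  proof
    assume "?C x = \<pi> ` B1"
    then have "\<pi> (0 + x) \<in> \<pi> ` B1" using subspace_0[OF B1(1)] by blast
    then obtain b where b: "b \<in> B1" "\<pi> x = \<pi> b" by auto
    then have "x - b \<in> B" using presents_eq_iff[OF P0] x B1Z Z1 by blast
    then have "(x - b) + b \<in> B1" using subspace_add[OF B1(1)] B1 b by blast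
    then show "x \<in> B1" by simp
  next
    assume x: "x \<in> B1"
    have "(\<lambda>b. b + x) ` B1 = B1"
    proof (intro equalityI subsetI)
      fix y assume "y \<in> B1"
      then have "y - x \<in> B1" "y = (y - x) + x" using subspace_diff[OF B1(1)] x by auto
      then show "y \<in> (\<lambda>b. b + x) ` B1" by blast
    qed (use x subspace_add[OF B1(1)] in blast)
    then show "?C x = \<pi> ` B1" by simp
  qed
  have "presents (quot_module (M\<lparr>carrier := \<pi> ` Z1\<rparr>) (\<pi> ` B1)) Z1 B1 (\<lambda>z. \<pi> ` B1 +>\<^bsub>M\<^esub> \<pi> z)"
    unfolding presents_def
  proof (intro conjI ballI allI)
    show "(\<lambda>z. \<pi> ` B1 +>\<^bsub>M\<^esub> \<pi> z) ` Z1 = carrier (quot_module (M\<lparr>carrier := \<pi> ` Z1\<rparr>) (\<pi> ` B1))"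
      by (auto simp: quot_module_def A_RCOSETS_def' co)
  next
    fix c z assume "z \<in> Z1"
    then show "\<pi> ` B1 +>\<^bsub>M\<^esub> \<pi> (scale c z)
        = c \<odot>\<^bsub>quot_module (M\<lparr>carrier := \<pi> ` Z1\<rparr>) (\<pi> ` B1)\<^esub> (\<pi> ` B1 +>\<^bsub>M\<^esub> \<pi> z)"
      using scal[of z _ c] subspace_scale[OF Z1(1)] unfolding quot_module_def by (simp add: co(1))
  qed (use Z1 B1 in \<open>auto simp: quot_module_def co add zero subspace_add\<close>)
  then show ?thesis .
qed

text \<open>The choice of a representative is harmless as soon as \<open>f\<close> maps the relations of the source into
those of the target.\<close>

definition induced_map :: "'v set \<Rightarrow> ('v \<Rightarrow> 'm) \<Rightarrow> ('v \<Rightarrow> 'n) \<Rightarrow> ('v \<Rightarrow> 'v) \<Rightarrow> 'm \<Rightarrow> 'n"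
  where "induced_map Z \<pi> \<pi>' f u = \<pi>' (f (SOME z. z \<in> Z \<and> \<pi> z = u))"

lemma induced_map_apply:
  assumes "presents M Z B \<pi>" "presents M' Z' B' \<pi>'" "endo f"
    and "f ` Z \<subseteq> Z'" "f ` B \<subseteq> B'" "z \<in> Z"
  shows "induced_map Z \<pi> \<pi>' f (\<pi> z) = \<pi>' (f z)"
proof -
  define y where "y = (SOME y. y \<in> Z \<and> \<pi> y = \<pi> z)"
  have y: "y \<in> Z" "\<pi> y = \<pi> z"
    using someI[of "\<lambda>y. y \<in> Z \<and> \<pi> y = \<pi> z" z] assms(6) unfolding y_def by blast+
  then have "y - z \<in> B" using presents_eq_iff[OF assms(1)] assms(6) by blast
  then have "f y - f z \<in> B'"
    using assms(5) endo_diff[OF assms(3)] by force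
  then have "\<pi>' (f y) = \<pi>' (f z)"
    using presents_eq_iff[OF assms(2)] y assms(4,6) by blast
  then show ?thesis by (simp add: induced_map_def y_def)
qed

lemma induced_map_hom:
  assumes "presents M Z B \<pi>" "presents M' Z' B' \<pi>'" "endo f"
    and "f ` Z \<subseteq> Z'" "f ` B \<subseteq> B'"
  shows "induced_map Z \<pi> \<pi>' f \<in> mod_hom (ring_of_type_algebra :: 'k ring) M M'"
proof -
  note P = presentsD[OF assms(1)]
  note P' = presentsD[OF assms(2)]
  note ap = induced_map_apply[OF assms]
  have rep: "\<exists>x\<in>Z. u = \<pi> x" if "u \<in> carrier M" for u
    using that P(4) by blast
  have fZ: "f z \<in> Z'" if "z \<in> Z" for z using that assms(4) by blast
  show ?thesis
    unfolding mod_hom_def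
  proof (intro CollectI conjI ballI funcsetI)
    fix u assume "u \<in> carrier M"
    then obtain x where x: "x \<in> Z" "u = \<pi> x" using rep by blast
    show "induced_map Z \<pi> \<pi>' f u \<in> carrier M'"
      using x ap P'(8) fZ by simp
    fix c :: 'k
    show "induced_map Z \<pi> \<pi>' f (c \<odot>\<^bsub>M\<^esub> u) = c \<odot>\<^bsub>M'\<^esub> induced_map Z \<pi> \<pi>' f u"
      using x P'(6) ap fZ subspace_scale[OF P(1)] endo_scale[OF assms(3)]
      by (simp flip: P(6))
  next
    fix u v assume "u \<in> carrier M" "v \<in> carrier M"
    then obtain x y where x: "x \<in> Z" "u = \<pi> x" "y \<in> Z" "v = \<pi> y" using rep by metis
    show "induced_map Z \<pi> \<pi>' f (u \<oplus>\<^bsub>M\<^esub> v)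
        = induced_map Z \<pi> \<pi>' f u \<oplus>\<^bsub>M'\<^esub> induced_map Z \<pi> \<pi>' f v"
      using x P'(5) ap fZ subspace_add[OF P(1)] endo_add[OF assms(3)]
      by (simp flip: P(5))
  qed
qed

text \<open>Injectivity of the induced map is the condition on kernels; surjectivity is asked for only up to the
relations \<open>B'\<close>.\<close>

lemma presents_isomorphic:
  assumes "presents M Z B \<pi>" "presents M' Z' B' \<pi>'" "endo f"
    and "f ` Z \<subseteq> Z'" and ker: "\<And>z. z \<in> Z \<Longrightarrow> f z \<in> B' \<longleftrightarrow> z \<in> B"
    and surj: "\<And>z'. z' \<in> Z' \<Longrightarrow> \<exists>z\<in>Z. z' - f z \<in> B'"
  shows "mod_isomorphic (ring_of_type_algebra :: 'k ring) M M'"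
proof -
  note P = presentsD[OF assms(1)]
  note P' = presentsD[OF assms(2)]
  have fB: "f ` B \<subseteq> B'" using ker P(3) by blast
  note ap = induced_map_apply[OF assms(1-4) fB]
  let ?h = "induced_map Z \<pi> \<pi>' f"
  have fZ: "f z \<in> Z'" if "z \<in> Z" for z using that assms(4) by blast
  have "bij_betw ?h (carrier M) (carrier M')"
  proof (rule bij_betw_imageI)
    show "inj_on ?h (carrier M)"
    proof (rule inj_onI)
      fix u v assume uv: "u \<in> carrier M" "v \<in> carrier M" "?h u = ?h v"
      then obtain x y where x: "x \<in> Z" "u = \<pi> x" "y \<in> Z" "v = \<pi> y" using P(4) by (metis imageE)
      have "\<pi>' (f x) = \<pi>' (f y)" using uv ap x by simp
      then have "f (x - y) \<in> B'"
        using presents_eq_iff[OF assms(2)] fZ x endo_diff[OF assms(3)] by simp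
      then have "x - y \<in> B" using ker x subspace_diff[OF P(1)] by blast
      then show "u = v" using presents_eq_iff[OF assms(1)] x by simp
    qed
    have "\<pi>' z' \<in> ?h ` carrier M" if z': "z' \<in> Z'" for z'
    proof -
      obtain z where z: "z \<in> Z" "z' - f z \<in> B'" using surj[OF z'] by blast
      have "\<pi>' z' = ?h (\<pi> z)"
        using z presents_eq_iff[OF assms(2) z' fZ[OF z(1)]] ap[OF z(1)] by simp
      then show ?thesis by (rule image_eqI[OF _ P(8)[OF z(1)]])
    qed
    moreover have "?h ` carrier M \<subseteq> carrier M'"
    proof
      fix u assume "u \<in> ?h ` carrier M"
      then have "u \<in> ?h ` \<pi> ` Z" by (simp only: P(4))
      then obtain z where z: "z \<in> Z" "u = ?h (\<pi> z)" by auto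
      show "u \<in> carrier M'" unfolding z(2) ap[OF z(1)] by (rule P'(8)[OF fZ[OF z(1)]])
    qed
    ultimately show "?h ` carrier M = carrier M'"
      unfolding P'(4)[symmetric] by (auto simp del: image_subset_iff)
  qed
  then show ?thesis
    unfolding mod_isomorphic_def using induced_map_hom[OF assms(1-4) fB] by blast
qed

text \<open>The terms of the complex may themselves be subquotients, with relations \<open>B n\<close>. The lemma then covers
cohomology of cohomology, where \<open>f\<close> squares to zero only modulo \<open>B\<close>.\<close>

lemma presents_cohomology:
  assumes P: "\<And>n. presents (C n) (Z n) (B n) (\<pi> n)"
    and f: "\<And>n. endo (f n)"
    and fZ: "\<And>n. f n ` Z n \<subseteq> Z (n + 1)" and fB: "\<And>n. f n ` B n \<subseteq> B (n + 1)"
    and ff: "\<And>n x. x \<in> Z n \<Longrightarrow> f (n + 1) (f n x) \<in> B (n + 2)"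
    and d: "\<And>n x. x \<in> Z n \<Longrightarrow> d n (\<pi> n x) = \<pi> (n + 1) (f n x)"
  defines "K \<equiv> \<lambda>n. {x \<in> Z n. f n x \<in> B (n + 1)}"
    and "I \<equiv> \<lambda>n. {f (n - 1) x + b | x b. x \<in> Z (n - 1) \<and> b \<in> B n}"
  shows "cocycles C d n = \<pi> n ` K n" "coboundaries C d n = \<pi> n ` I n"
    "presents (cohomology C d n) (K n) (I n) (\<lambda>z. coboundaries C d n +>\<^bsub>C n\<^esub> \<pi> n z)"
proof -
  note Pn = presentsD[OF P]
  have fZ': "f n x \<in> Z (n + 1)" if "x \<in> Z n" for n x using fZ that by blast
  have fZm: "f (n - 1) x \<in> Z n" if "x \<in> Z (n - 1)" for n x using fZ'[of x "n - 1"] that by simp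
  show K: "cocycles C d n = \<pi> n ` K n"
    unfolding cocycles_def K_def Pn(4)[symmetric]
    using d Pn(7) fZ' by fastforce
  have absorb: "\<pi> n (y + b) = \<pi> n y" if "y \<in> Z n" "b \<in> B n" for y b
    using presents_eq_iff[OF P, of "y + b" n y] that Pn(3)[of n] subspace_add[OF Pn(1)[of n]]
    by (simp add: subset_iff)
  have eq: "d (n - 1) (\<pi> (n - 1) x) = \<pi> n (f (n - 1) x)" if "x \<in> Z (n - 1)" for x
    using d[OF that] by simp
  show I: "coboundaries C d n = \<pi> n ` I n"
  proof (intro equalityI subsetI)
    fix u assume "u \<in> coboundaries C d n"
    then obtain x where "x \<in> Z (n - 1)" "u = \<pi> n (f (n - 1) x)"
      unfolding coboundaries_def Pn(4)[symmetric] using eq by auto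
    moreover have "f (n - 1) x = f (n - 1) x + 0" by simp
    ultimately show "u \<in> \<pi> n ` I n" unfolding I_def using subspace_0[OF Pn(2)[of n]] by blast
  next
    fix u assume "u \<in> \<pi> n ` I n"
    then obtain x b where "x \<in> Z (n - 1)" "b \<in> B n" "u = \<pi> n (f (n - 1) x + b)"
      unfolding I_def by blast
    then have "x \<in> Z (n - 1)" "u = d (n - 1) (\<pi> (n - 1) x)"
      using absorb fZm eq by auto
    then show "u \<in> coboundaries C d n"
      unfolding coboundaries_def Pn(4)[symmetric] by blast
  qed
  have "subspace (K n)"
    unfolding K_def
    using Pn(1)[of n] Pn(2)[of "n + 1"] endo_0[OF f] endo_add[OF f] endo_scale[OF f]
    by (auto simp: subspace_def)
  moreover have "subspace (I n)"
  proof -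
    have "I n = {x + y |x y. x \<in> f (n - 1) ` Z (n - 1) \<and> y \<in> B n}"
      unfolding I_def by blast
    moreover have "subspace (f (n - 1) ` Z (n - 1))"
      using endo_subspace_image[OF f Pn(1)] by blast
    ultimately show ?thesis using subspace_sums Pn(2) by simp
  qed
  moreover have "B n \<subseteq> I n"
  proof
    fix b assume "b \<in> B n"
    moreover have "b = f (n - 1) 0 + b" by (simp add: endo_0[OF f])
    ultimately show "b \<in> I n" unfolding I_def using subspace_0[OF Pn(1)[of "n - 1"]] by blast
  qed
  moreover have "I n \<subseteq> K n"
  proof
    fix u assume "u \<in> I n"
    then obtain x b where u: "x \<in> Z (n - 1)" "b \<in> B n" "u = f (n - 1) x + b"
      unfolding I_def by blast
    have "f n (f (n - 1) x) \<in> B (n + 1)" using ff[OF u(1)] by (simp add: add.commute)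
    moreover have "f n b \<in> B (n + 1)" using fB u(2) by blast
    ultimately show "u \<in> K n"
      unfolding K_def u(3) using u fZm Pn(3)[of n] endo_add[OF f]
        subspace_add[OF Pn(1)[of n]] subspace_add[OF Pn(2)[of "n + 1"]] by auto
  qed
  ultimately show "presents (cohomology C d n) (K n) (I n) (\<lambda>z. coboundaries C d n +>\<^bsub>C n\<^esub> \<pi> n z)"
    unfolding cohomology_def K I
    by (intro presents_quot_module[OF P]) (auto simp: K_def)
qed

end

section \<open>The spectral sequence of a bounded double complex\<close>

text \<open>The map that \<open>quot_map\<close> assigns to a coset is a union over its elements; all of them give the same
coset of the target, because \<open>g\<close> maps relations to relations.\<close>

lemma (in linear_quotients) quot_map_coset:
  assumes P: "presents M Z B \<pi>" and P': "presents N Z' B' \<pi>'"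
    and B1: "B1 \<subseteq> Z" "subspace B1'" "B' \<subseteq> B1'" "B1' \<subseteq> Z'" "B1 \<noteq> {}"
    and g: "endo g" "g ` Z \<subseteq> Z'" "g ` B1 \<subseteq> B1'"
    and f: "\<And>z. z \<in> Z \<Longrightarrow> f (\<pi> z) = \<pi>' (g z)" and z: "z \<in> Z"
  shows "quot_map N (\<pi>' ` B1') f (\<pi> ` B1 +>\<^bsub>M\<^esub> \<pi> z) = \<pi>' ` B1' +>\<^bsub>N\<^esub> \<pi>' (g z)"
proof -
  note PD = presentsD[OF P] and PD' = presentsD[OF P']
  have Q: "presents (quot_module (N\<lparr>carrier := \<pi>' ` Z'\<rparr>) (\<pi>' ` B1')) Z' B1'
      (\<lambda>z. \<pi>' ` B1' +>\<^bsub>N\<^esub> \<pi>' z)"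
    by (rule presents_quot_module[OF P' PD'(1) order_refl B1(2,3,4)])
  have "\<pi>' ` B1' +>\<^bsub>N\<^esub> f u = \<pi>' ` B1' +>\<^bsub>N\<^esub> \<pi>' (g z)" if u: "u \<in> \<pi> ` ((\<lambda>b. b + z) ` B1)" for u
  proof -
    obtain b where b: "b \<in> B1" "u = \<pi> (b + z)" using u by blast
    have bz: "b + z \<in> Z" using b B1(1) z subspace_add[OF PD(1)] by blast
    have "g (b + z) - g z \<in> B1'" using b g(3) by (auto simp: endo_add[OF g(1)])
    moreover have "g (b + z) \<in> Z'" "g z \<in> Z'" using g(2) bz z by blast+
    ultimately show ?thesis
      unfolding b(2) f[OF bz] using presents_eq_iff[OF Q] by blast
  qed
  then show ?thesis
    unfolding quot_map_def presents_coset(2)[OF P B1(1) z]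
    using B1(5) by (intro SUP_eq_const) auto
qed

text \<open>\<open>Gr p t\<close> is the term in column \<open>p\<close> and row \<open>t\<close>, with horizontal differential \<open>h\<close> and vertical
differential \<open>v\<close>; \<open>Fil n p\<close> is the part of total degree \<open>n\<close> in the columns from \<open>p\<close> on, and \<open>pr p\<close>
is the projection to column \<open>p\<close>. The two assumptions on \<open>Fil\<close> below column \<open>0\<close> and above column \<open>n\<close>
say that the double complex lives in the first quadrant. Only the total differential is assumed to
square to zero; the relations between \<open>h\<close> and \<open>v\<close> follow by projecting to columns.\<close>

locale bounded_double_complex = linear_quotients scale
  for scale :: "'k::field \<Rightarrow> 'v::ab_group_add \<Rightarrow> 'v" +
  fixes Gr :: "int \<Rightarrow> int \<Rightarrow> 'v set"
    and Fil :: "int \<Rightarrow> int \<Rightarrow> 'v set"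
    and pr :: "int \<Rightarrow> 'v \<Rightarrow> 'v"
    and h v :: "'v \<Rightarrow> 'v"
  assumes endo_h: "endo h" and endo_v: "endo v" and endo_pr: "endo (pr p)"
    and Gr_subspace: "subspace (Gr p t)" and Fil_subspace: "subspace (Fil n p)"
    and Fil_Suc: "Fil n (p + 1) \<subseteq> Fil n p"
    and Fil_low: "p \<le> 0 \<Longrightarrow> Fil n p = Fil n 0"
    and Fil_high: "n < p \<Longrightarrow> Fil n p = {0}"
    and Gr_Fil: "Gr p t \<subseteq> Fil (p + t) p"
    and pr_Fil: "x \<in> Fil n p \<Longrightarrow> pr p x \<in> Gr p (n - p)"
    and pr_0_iff: "x \<in> Fil n p \<Longrightarrow> pr p x = 0 \<longleftrightarrow> x \<in> Fil n (p + 1)"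
    and pr_Gr: "x \<in> Gr p t \<Longrightarrow> pr p' x = (if p' = p then x else 0)"
    and h_Gr: "x \<in> Gr p t \<Longrightarrow> h x \<in> Gr (p + 1) t"
    and v_Gr: "x \<in> Gr p t \<Longrightarrow> v x \<in> Gr p (t + 1)"
    and D_Fil: "x \<in> Fil n p \<Longrightarrow> h x + v x \<in> Fil (n + 1) p"
    and D_D: "x \<in> Fil n p \<Longrightarrow> h (h x + v x) + v (h x + v x) = 0"
    and pr_D: "x \<in> Fil n q \<Longrightarrow> pr p (h x + v x) = h (pr (p - 1) x) + v (pr p x)"
begin

definition D :: "'v \<Rightarrow> 'v" where "D x = h x + v x"

lemma endo_D: "endo D"
  using endo_h endo_v unfolding endo_def D_def by (simp add: scale_right_distrib algebra_simps)

lemma D_simps: "D (x + y) = D x + D y" "D (x - y) = D x - D y" "D (scale c x) = scale c (D x)"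
    "D 0 = 0"
  using endo_add[OF endo_D] endo_diff[OF endo_D] endo_scale[OF endo_D] endo_0[OF endo_D] by auto

lemma D_in_Fil: "x \<in> Fil n p \<Longrightarrow> D x \<in> Fil (n + 1) p"
  and D_square: "x \<in> Fil n p \<Longrightarrow> D (D x) = 0"
  and pr_of_D: "x \<in> Fil n q \<Longrightarrow> pr p (D x) = h (pr (p - 1) x) + v (pr p x)"
  using D_Fil D_D pr_D unfolding D_def by auto

lemma D_in_Fil_pred: "x \<in> Fil (n - 1) p \<Longrightarrow> D x \<in> Fil n p"
  using D_in_Fil[of x "n - 1" p] by simp

lemma Fil_mono: "p \<le> q \<Longrightarrow> Fil n q \<subseteq> Fil n p"
proof (induction q rule: int_ge_induct)
  case (step i)
  then show ?case using Fil_Suc[of n i] by blast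
qed simp

lemma pr_Fil_0: "x \<in> Fil n q \<Longrightarrow> p < q \<Longrightarrow> pr p x = 0"
  using pr_0_iff[of x n p] Fil_mono[of p q n] Fil_mono[of "p + 1" q n] by fastforce

lemma Fil_add: "x \<in> Fil n p \<Longrightarrow> y \<in> Fil n p \<Longrightarrow> x + y \<in> Fil n p"
  and Fil_diff: "x \<in> Fil n p \<Longrightarrow> y \<in> Fil n p \<Longrightarrow> x - y \<in> Fil n p"
  and Fil_0: "0 \<in> Fil n p"
  and Fil_scale: "x \<in> Fil n p \<Longrightarrow> scale c x \<in> Fil n p"
  using Fil_subspace[of n p] by (auto simp: subspace_add subspace_diff subspace_0 subspace_scale)

text \<open>The page \<open>r\<close> in column \<open>p\<close> and total degree \<open>n\<close> is \<open>Zr r n p / Br r n p\<close>: elements of \<open>Fil n p\<close> whose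
differential lies \<open>r\<close> steps further in the filtration, modulo those of the next step and modulo
differentials of elements at most \<open>r - 1\<close> steps earlier.\<close>

definition Zr :: "int \<Rightarrow> int \<Rightarrow> int \<Rightarrow> 'v set"
  where "Zr r n p = {x \<in> Fil n p. D x \<in> Fil (n + 1) (p + r)}"

definition Br :: "int \<Rightarrow> int \<Rightarrow> int \<Rightarrow> 'v set"
  where "Br r n p = {y + D w | y w. y \<in> Zr (r - 1) n (p + 1) \<and> w \<in> Zr (r - 1) (n - 1) (p - r + 1)}"

lemma subspace_Zr: "subspace (Zr r n p)"
  unfolding subspace_def Zr_def by (auto simp: D_simps Fil_0 Fil_add Fil_scale)

lemma subspace_plus_image:
  assumes "subspace A" "subspace C"
  shows "subspace {y + D w | y w. y \<in> A \<and> w \<in> C}"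
proof -
  have "{y + D w | y w. y \<in> A \<and> w \<in> C} = {y + z | y z. y \<in> A \<and> z \<in> D ` C}" by blast
  then show ?thesis using subspace_sums[OF assms(1) endo_subspace_image[OF endo_D assms(2)]] by simp
qed

lemma subspace_Br: "subspace (Br r n p)"
  unfolding Br_def by (rule subspace_plus_image[OF subspace_Zr subspace_Zr])

lemma BrI: "y \<in> Zr (r - 1) n (p + 1) \<Longrightarrow> w \<in> Zr (r - 1) (n - 1) (p - r + 1) \<Longrightarrow> z = y + D w
    \<Longrightarrow> z \<in> Br r n p"
  unfolding Br_def by blast

lemma ZrD: "x \<in> Zr r n p \<Longrightarrow> x \<in> Fil n p" "x \<in> Zr r n p \<Longrightarrow> D x \<in> Fil (n + 1) (p + r)"
  unfolding Zr_def by auto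

lemma Zr_D_pred: "x \<in> Zr r (n - 1) p \<Longrightarrow> p' = p + r \<Longrightarrow> D x \<in> Fil n p'"
  unfolding Zr_def by auto

lemma Br_Zr:
  assumes "1 \<le> r"
  shows "Br r n p \<subseteq> Zr r n p"
proof
  fix z assume "z \<in> Br r n p"
  then obtain y w where yw: "y \<in> Zr (r - 1) n (p + 1)" "w \<in> Zr (r - 1) (n - 1) (p - r + 1)" "z = y + D w"
    unfolding Br_def by blast
  have Dw: "D w \<in> Fil n p" using yw(2) Zr_D_pred by force
  have "y \<in> Fil n p" using ZrD(1)[OF yw(1)] Fil_Suc by blast
  moreover have "D y \<in> Fil (n + 1) (p + r)" using ZrD(2)[OF yw(1)] by simp
  moreover have "D (D w) = 0" using D_square[OF ZrD(1)[OF yw(2)]] .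
  ultimately show "z \<in> Zr r n p" unfolding Zr_def yw(3) using Dw by (simp add: D_simps Fil_add)
qed

lemma D_Zr: "x \<in> Zr r n p \<Longrightarrow> D x \<in> Zr r' (n + 1) (p + r)"
  unfolding Zr_def using D_square Fil_0 by auto

text \<open>If \<open>D z = y + D w\<close> is a relation in the target, then \<open>z - w\<close> survives to the next page and \<open>w\<close> is a
relation for the class of \<open>z\<close> modulo the image.\<close>

lemma kernel_page:
  assumes "1 \<le> r"
  shows "{z \<in> Zr r n p. D z \<in> Br r (n + 1) (p + r)}
    = {z + y | z y. z \<in> Zr (r + 1) n p \<and> y \<in> Zr (r - 1) n (p + 1)}"
proof (intro equalityI subsetI)
  fix z assume "z \<in> {z \<in> Zr r n p. D z \<in> Br r (n + 1) (p + r)}"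
  then have z: "z \<in> Zr r n p" "D z \<in> Br r (n + 1) (p + r)" by auto
  then obtain y w where yw: "y \<in> Zr (r - 1) (n + 1) (p + r + 1)" "w \<in> Zr (r - 1) n (p + 1)"
      "D z = y + D w"
    unfolding Br_def by auto
  have "z - w \<in> Fil n p" using ZrD(1)[OF z(1)] ZrD(1)[OF yw(2)] Fil_Suc[of n p] Fil_diff by blast
  moreover have "D (z - w) = y" using yw(3) by (simp add: D_simps)
  ultimately have "z - w \<in> Zr (r + 1) n p" using ZrD(1)[OF yw(1)] by (simp add: Zr_def add.assoc)
  moreover have "z = (z - w) + w" by simp
  ultimately show "z \<in> {z + y | z y. z \<in> Zr (r + 1) n p \<and> y \<in> Zr (r - 1) n (p + 1)}"
    using yw(2) by blast
next
  fix u assume "u \<in> {z + y | z y. z \<in> Zr (r + 1) n p \<and> y \<in> Zr (r - 1) n (p + 1)}"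
  then obtain z y where zy: "z \<in> Zr (r + 1) n p" "y \<in> Zr (r - 1) n (p + 1)" "u = z + y" by blast
  have "D z \<in> Fil (n + 1) (p + r + 1)" using ZrD(2)[OF zy(1)] by (simp add: add.assoc)
  then have 1: "D z \<in> Fil (n + 1) (p + r)" and 2: "D z \<in> Zr (r - 1) (n + 1) (p + r + 1)"
    using Fil_Suc D_square[OF ZrD(1)[OF zy(1)]] Fil_0 by (auto simp: Zr_def)
  have "D y \<in> Fil (n + 1) (p + r)" using ZrD(2)[OF zy(2)] by simp
  moreover have "y \<in> Fil n p" using ZrD(1)[OF zy(2)] Fil_Suc by blast
  ultimately have "u \<in> Zr r n p"
    using 1 ZrD(1)[OF zy(1)] zy(3) by (simp add: Zr_def D_simps Fil_add)
  moreover have "D u \<in> Br r (n + 1) (p + r)"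
    using 2 zy(2) by (intro BrI[of "D z" _ _ _ y]) (simp_all add: zy(3) D_simps)
  ultimately show "u \<in> {z \<in> Zr r n p. D z \<in> Br r (n + 1) (p + r)}" by blast
qed

text \<open>The part of \<open>Br r\<close> that consists of differentials is contained in the image of the \<open>r\<close>-th differential,
since \<open>Zr (r - 1)\<close> in column \<open>p - r + 1\<close> is contained in \<open>Zr r\<close> in column \<open>p - r\<close>.\<close>

lemma image_page:
  assumes "1 \<le> r"
  shows "{D x + b | x b. x \<in> Zr r (n - 1) (p - r) \<and> b \<in> Br r n p}
    = {y + D x | y x. y \<in> Zr (r - 1) n (p + 1) \<and> x \<in> Zr r (n - 1) (p - r)}"
proof (intro equalityI subsetI)
  fix u assume "u \<in> {D x + b | x b. x \<in> Zr r (n - 1) (p - r) \<and> b \<in> Br r n p}"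
  then obtain x y w where u: "x \<in> Zr r (n - 1) (p - r)" "y \<in> Zr (r - 1) n (p + 1)"
      "w \<in> Zr (r - 1) (n - 1) (p - r + 1)" "u = D x + (y + D w)"
    unfolding Br_def by blast
  have "w \<in> Zr r (n - 1) (p - r)"
    using ZrD(1)[OF u(3)] Fil_Suc[of "n - 1" "p - r"] ZrD(2)[OF u(3)] by (auto simp: Zr_def)
  then have "x + w \<in> Zr r (n - 1) (p - r)" using u(1) subspace_add[OF subspace_Zr] by blast
  moreover have "u = y + D (x + w)" using u(4) by (simp add: D_simps algebra_simps)
  ultimately show "u \<in> {y + D x | y x. y \<in> Zr (r - 1) n (p + 1) \<and> x \<in> Zr r (n - 1) (p - r)}"
    using u(2) by blast
next
  fix u assume "u \<in> {y + D x | y x. y \<in> Zr (r - 1) n (p + 1) \<and> x \<in> Zr r (n - 1) (p - r)}"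
  then obtain y x where u: "y \<in> Zr (r - 1) n (p + 1)" "x \<in> Zr r (n - 1) (p - r)" "u = D x + y"
    by (auto simp: add.commute)
  moreover have "y \<in> Br r n p"
    by (rule BrI[OF u(1), of 0]) (auto simp: D_simps subspace_0[OF subspace_Zr])
  ultimately show "u \<in> {D x + b | x b. x \<in> Zr r (n - 1) (p - r) \<and> b \<in> Br r n p}" by blast
qed

end

text \<open>Complexes of modules with carriers enter through presentations: \<open>Tm\<close> is isomorphic to the total complex,
and \<open>Cm p\<close> to column \<open>p\<close>, with \<open>cd\<close> and \<open>cb\<close> the transported vertical and horizontal differentials. The
pages are formed inside \<open>Tm\<close>, so that their elements are sets of elements of \<open>Tm\<close>.\<close>

locale realised_double_complex = bounded_double_complex scale Gr Fil pr h v
  for scale :: "'k::field \<Rightarrow> 'v::ab_group_add \<Rightarrow> 'v" and Gr Fil pr h v +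
  fixes Tm :: "int \<Rightarrow> ('k, 't) module" and dm :: "int \<Rightarrow> 't \<Rightarrow> 't"
    and \<iota> :: "int \<Rightarrow> 'v \<Rightarrow> 't"
    and Cm :: "int \<Rightarrow> int \<Rightarrow> ('k, 'c) module" and cd cb :: "int \<Rightarrow> int \<Rightarrow> 'c \<Rightarrow> 'c"
    and \<kappa> :: "int \<Rightarrow> int \<Rightarrow> 'v \<Rightarrow> 'c"
  assumes Tm: "presents (Tm n) (Fil n 0) {0} (\<iota> n)"
    and dm: "x \<in> Fil n 0 \<Longrightarrow> dm n (\<iota> n x) = \<iota> (n + 1) (h x + v x)"
    and Cm: "presents (Cm p t) (Gr p t) {0} (\<kappa> p t)"
    and cd: "x \<in> Gr p t \<Longrightarrow> cd p t (\<kappa> p t x) = \<kappa> p (t + 1) (v x)"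
    and cb: "x \<in> Gr p t \<Longrightarrow> cb p t (\<kappa> p t x) = \<kappa> (p + 1) t (h x)"
begin

definition E :: "nat \<Rightarrow> int \<Rightarrow> int \<Rightarrow> ('k, 't set) module"
  where "E r p q = quot_module ((Tm (p + q))\<lparr>carrier := \<iota> (p + q) ` Zr (int r) (p + q) p\<rparr>)
    (\<iota> (p + q) ` Br (int r) (p + q) p)"

definition \<epsilon> :: "nat \<Rightarrow> int \<Rightarrow> int \<Rightarrow> 'v \<Rightarrow> 't set"
  where "\<epsilon> r p q z = \<iota> (p + q) ` Br (int r) (p + q) p +>\<^bsub>Tm (p + q)\<^esub> \<iota> (p + q) z"

definition dE :: "nat \<Rightarrow> int \<Rightarrow> int \<Rightarrow> 't set \<Rightarrow> 't set"
  where "dE r p q = induced_map (Zr (int r) (p + q) p) (\<epsilon> r p q)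
    (\<epsilon> r (p + int r) (q - int r + 1)) D"

lemma Fil_le_0: "Fil n p \<subseteq> Fil n 0"
  using Fil_mono[of 0 p n] Fil_low[of p n] by (cases "p \<le> 0") auto

lemma presents_E:
  assumes "1 \<le> r"
  shows "presents (E r p q) (Zr (int r) (p + q) p) (Br (int r) (p + q) p) (\<epsilon> r p q)"
  unfolding E_def \<epsilon>_def
proof (rule presents_quot_module[OF Tm subspace_Zr _ subspace_Br])
  show "Zr (int r) (p + q) p \<subseteq> Fil (p + q) 0" using ZrD(1) Fil_le_0 by blast
  show "{0} \<subseteq> Br (int r) (p + q) p" using subspace_0[OF subspace_Br] by simp
  show "Br (int r) (p + q) p \<subseteq> Zr (int r) (p + q) p" using Br_Zr assms by simp
qed

lemma D_Br:
  assumes "1 \<le> r" "x \<in> Br r n p"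
  shows "D x \<in> Br r (n + 1) (p + r)"
proof -
  obtain y w where yw: "y \<in> Zr (r - 1) n (p + 1)" "w \<in> Zr (r - 1) (n - 1) (p - r + 1)" "x = y + D w"
    using assms(2) unfolding Br_def by blast
  have "D x = 0 + D y" using yw D_square[OF ZrD(1)[OF yw(2)]] by (simp add: D_simps)
  then show ?thesis
    using yw(1) by (intro BrI[of 0 _ _ _ y]) (simp_all add: subspace_0[OF subspace_Zr])
qed

lemma dE_facts:
  assumes "1 \<le> r"
  shows "dE r p q \<in> mod_hom (ring_of_type_algebra :: 'k ring) (E r p q) (E r (p + int r) (q - int r + 1))"
    and "z \<in> Zr (int r) (p + q) p \<Longrightarrow> dE r p q (\<epsilon> r p q z) = \<epsilon> r (p + int r) (q - int r + 1) (D z)"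
proof -
  have n: "(p + int r) + (q - int r + 1) = p + q + 1" by simp
  have 1: "D ` Zr (int r) (p + q) p \<subseteq> Zr (int r) (p + int r + (q - int r + 1)) (p + int r)"
    unfolding n using D_Zr by blast
  have 2: "D ` Br (int r) (p + q) p \<subseteq> Br (int r) (p + int r + (q - int r + 1)) (p + int r)"
    unfolding n using D_Br assms by auto
  show "dE r p q \<in> mod_hom (ring_of_type_algebra :: 'k ring) (E r p q) (E r (p + int r) (q - int r + 1))"
    unfolding dE_def by (rule induced_map_hom[OF presents_E presents_E endo_D 1 2]) (use assms in auto)
  show "dE r p q (\<epsilon> r p q z) = \<epsilon> r (p + int r) (q - int r + 1) (D z)"
    if "z \<in> Zr (int r) (p + q) p"
    unfolding dE_def
    by (rule induced_map_apply[OF presents_E presents_E endo_D 1 2 that]) (use assms in auto)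
qed

text \<open>By \<open>kernel_page\<close> and \<open>image_page\<close>, kernel and image of the \<open>r\<close>-th differential are
\<open>Zr (r + 1) n p + W\<close> and \<open>D (Zr r (n - 1) (p - r)) + W\<close> with the same
\<open>W = Zr (r - 1) n (p + 1)\<close>. The inclusion of \<open>Zr (r + 1)\<close> therefore induces a surjection onto
cohomology, and an element \<open>y + D x\<close> of its kernel has \<open>y\<close> in \<open>Zr r n (p + 1)\<close>, hence lies in
\<open>Br (r + 1)\<close>.\<close>

lemma spectral_sequence_E: "spectral_sequence (ring_of_type_algebra :: 'k ring) E dE"
  unfolding spectral_sequence_def
proof (intro allI impI conjI ballI)
  fix r :: nat and p q :: int assume r: "1 \<le> r"
  note PE = presents_E[OF r]
  let ?n = "p + q"
  show "Module.module (ring_of_type_algebra :: 'k ring) (E r p q)" by (rule presents_module[OF PE])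
  show "dE r p q \<in> mod_hom (ring_of_type_algebra :: 'k ring) (E r p q) (E r (p + int r) (q - int r + 1))"
    by (rule dE_facts[OF r])
  have i1: "p + int r + int r = p + 2 * int r" "q - int r + 1 - int r + 1 = q - 2 * int r + 2"
    "(p + int r) + (q - int r + 1) = p + q + 1" by auto
  show "dE r (p + int r) (q - int r + 1) (dE r p q x) = \<zero>\<^bsub>E r (p + 2 * int r) (q - 2 * int r + 2)\<^esub>"
    if x: "x \<in> carrier (E r p q)" for x
  proof -
    obtain z where z: "z \<in> Zr (int r) ?n p" "x = \<epsilon> r p q z"
      using x presentsD(4)[OF PE[of p q]] by blast
    have "D z \<in> Zr (int r) (p + int r + (q - int r + 1)) (p + int r)"
      unfolding i1 by (rule D_Zr[OF z(1)])
    then have "dE r (p + int r) (q - int r + 1) (dE r p q x)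
        = \<epsilon> r (p + 2 * int r) (q - 2 * int r + 2) (D (D z))"
      using dE_facts(2)[OF r] z by (metis i1(1) i1(2))
    also have "D (D z) = 0" using D_square[OF ZrD(1)[OF z(1)]] .
    also have "\<epsilon> r (p + 2 * int r) (q - 2 * int r + 2) 0 = \<zero>\<^bsub>E r (p + 2 * int r) (q - 2 * int r + 2)\<^esub>"
      by (rule presents_zero[OF PE])
    finally show ?thesis .
  qed
  let ?K = "{z \<in> Zr (int r) ?n p. D z \<in> Br (int r) (?n + 1) (p + int r)}"
  let ?I = "{D x + b | x b. x \<in> Zr (int r) (?n - 1) (p - int r) \<and> b \<in> Br (int r) ?n p}"
  have K: "{x \<in> carrier (E r p q). dE r p q x = \<zero>\<^bsub>E r (p + int r) (q - int r + 1)\<^esub>} = \<epsilon> r p q ` ?K"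
  proof -
    have *: "dE r p q (\<epsilon> r p q z) = \<zero>\<^bsub>E r (p + int r) (q - int r + 1)\<^esub>
        \<longleftrightarrow> D z \<in> Br (int r) (?n + 1) (p + int r)" if z: "z \<in> Zr (int r) ?n p" for z
      using presentsD(7)[OF PE[of "p + int r" "q - int r + 1"], of "D z"]
        D_Zr[OF z, of "int r"] dE_facts(2)[OF r z] unfolding i1 by simp
    show ?thesis
      unfolding presentsD(4)[OF PE[of p q], symmetric] using * by auto
  qed
  have i2: "p - int r + (q + int r - 1) = ?n - 1" "p - int r + int r = p" "q + int r - 1 - int r + 1 = q"
    by auto
  have deq: "dE r (p - int r) (q + int r - 1) (\<epsilon> r (p - int r) (q + int r - 1) x) = \<epsilon> r p q (D x)"
    if "x \<in> Zr (int r) (?n - 1) (p - int r)" for x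
    using dE_facts(2)[OF r, of x "p - int r" "q + int r - 1"] that unfolding i2 by simp
  have absorb: "\<epsilon> r p q (D x + b) = \<epsilon> r p q (D x)"
    if "x \<in> Zr (int r) (?n - 1) (p - int r)" "b \<in> Br (int r) ?n p" for x b
  proof -
    have 1: "D x \<in> Zr (int r) ?n p" using D_Zr[OF that(1)] by simp
    have 2: "b \<in> Zr (int r) ?n p" using that(2) Br_Zr[of "int r"] r by auto
    show ?thesis
      using presents_eq_iff[OF PE[of p q], of "D x + b" "D x"] 1 2 that(2) subspace_add[OF subspace_Zr]
      by simp
  qed
  have I: "dE r (p - int r) (q + int r - 1) ` carrier (E r (p - int r) (q + int r - 1)) = \<epsilon> r p q ` ?I"
  proof -
    have "dE r (p - int r) (q + int r - 1) ` carrier (E r (p - int r) (q + int r - 1))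
        = (\<lambda>x. \<epsilon> r p q (D x)) ` Zr (int r) (?n - 1) (p - int r)"
      unfolding presentsD(4)[OF PE, symmetric] i2 image_image using deq by (intro image_cong) auto
    also have "\<dots> = \<epsilon> r p q ` ?I"
    proof (intro equalityI subsetI)
      fix u assume "u \<in> (\<lambda>x. \<epsilon> r p q (D x)) ` Zr (int r) (?n - 1) (p - int r)"
      then obtain x where x: "x \<in> Zr (int r) (?n - 1) (p - int r)" "u = \<epsilon> r p q (D x + 0)" by auto
      then show "u \<in> \<epsilon> r p q ` ?I" using subspace_0[OF subspace_Br] by blast
    next
      fix u assume "u \<in> \<epsilon> r p q ` ?I"
      then show "u \<in> (\<lambda>x. \<epsilon> r p q (D x)) ` Zr (int r) (?n - 1) (p - int r)"
        using absorb by auto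
    qed
    finally show ?thesis .
  qed
  have r': "1 \<le> int r" using r by simp
  note kp = kernel_page[OF r', of ?n p] and ip = image_page[OF r', of ?n p]
  have subK: "subspace ?K"
    unfolding kp using subspace_sums[OF subspace_Zr subspace_Zr] by simp
  have subI: "subspace ?I" unfolding ip by (rule subspace_plus_image[OF subspace_Zr subspace_Zr])
  have BI: "Br (int r) ?n p \<subseteq> ?I"
  proof
    fix b assume "b \<in> Br (int r) ?n p"
    moreover have "b = D 0 + b" by (simp add: D_simps)
    ultimately show "b \<in> ?I" using subspace_0[OF subspace_Zr] by blast
  qed
  have IK: "?I \<subseteq> ?K"
  proof
    fix u assume "u \<in> ?I"
    then obtain x b where u: "x \<in> Zr (int r) (?n - 1) (p - int r)" "b \<in> Br (int r) ?n p" "u = D x + b"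
      by blast
    have 1: "D x \<in> Zr (int r) ?n p" using D_Zr[OF u(1)] by simp
    have 2: "b \<in> Zr (int r) ?n p" using u(2) Br_Zr[of "int r"] r by auto
    have "D u = D b" using u(3) D_square[OF ZrD(1)[OF u(1)]] by (simp add: D_simps)
    then show "u \<in> ?K" using 1 2 D_Br[OF r' u(2)] u(3) subspace_add[OF subspace_Zr] by auto
  qed
  have Q: "presents (quot_module ((E r p q)\<lparr>carrier := \<epsilon> r p q ` ?K\<rparr>) (\<epsilon> r p q ` ?I)) ?K ?I
      (\<lambda>z. \<epsilon> r p q ` ?I +>\<^bsub>E r p q\<^esub> \<epsilon> r p q z)"
    by (rule presents_quot_module[OF PE subK _ subI BI IK]) blast
  have E1: "presents (E (r + 1) p q) (Zr (int r + 1) ?n p) (Br (int r + 1) ?n p) (\<epsilon> (r + 1) p q)"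
    using presents_E[of "r + 1" p q] by (simp add: add.commute)
  show "mod_isomorphic (ring_of_type_algebra :: 'k ring) (E (r + 1) p q)
      (quot_module ((E r p q)\<lparr>carrier := {x \<in> carrier (E r p q).
          dE r p q x = \<zero>\<^bsub>E r (p + int r) (q - int r + 1)\<^esub>}\<rparr>)
        (dE r (p - int r) (q + int r - 1) ` carrier (E r (p - int r) (q + int r - 1))))"
    unfolding K I
  proof (rule presents_isomorphic[OF E1 Q, of "\<lambda>x. x"])
    show "endo (\<lambda>x. x)" by (simp add: endo_def)
    show "(\<lambda>x. x) ` Zr (int r + 1) ?n p \<subseteq> ?K"
    proof
      fix u assume "u \<in> (\<lambda>x. x) ` Zr (int r + 1) ?n p"
      then have "u \<in> Zr (int r + 1) ?n p" "u = u + 0" by auto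
      then show "u \<in> ?K" unfolding kp using subspace_0[OF subspace_Zr] by blast
    qed
  next
    fix z assume z: "z \<in> Zr (int r + 1) ?n p"
    show "z \<in> ?I \<longleftrightarrow> z \<in> Br (int r + 1) ?n p"
    proof
      assume "z \<in> ?I"
      then obtain y x where yx: "y \<in> Zr (int r - 1) ?n (p + 1)" "x \<in> Zr (int r) (?n - 1) (p - int r)"
          "z = y + D x"
        unfolding ip by blast
      have "D y = D z" using yx(3) D_square[OF ZrD(1)[OF yx(2)]] by (simp add: D_simps)
      then have "y \<in> Zr (int r) ?n (p + 1)"
        using ZrD(1)[OF yx(1)] ZrD(2)[OF z] by (simp add: Zr_def add.commute add.left_commute)
      then show "z \<in> Br (int r + 1) ?n p" using yx by (intro BrI[of y _ _ _ x]) simp_all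
    next
      assume "z \<in> Br (int r + 1) ?n p"
      then obtain y x where yx: "y \<in> Zr (int r) ?n (p + 1)" "x \<in> Zr (int r) (?n - 1) (p - int r)"
          "z = y + D x"
        unfolding Br_def by auto
      have "y \<in> Zr (int r - 1) ?n (p + 1)"
        using ZrD[OF yx(1)] Fil_Suc[of "?n + 1" "p + int r"] by (auto simp: Zr_def add.commute add.left_commute)
      then show "z \<in> ?I" unfolding ip using yx by blast
    qed
  next
    fix z' assume "z' \<in> ?K"
    then obtain z y where zy: "z \<in> Zr (int r + 1) ?n p" "y \<in> Zr (int r - 1) ?n (p + 1)" "z' = z + y"
      unfolding kp by blast
    have "z' - z = y + D 0" using zy(3) by (simp add: D_simps)
    then have "z' - z \<in> ?I" unfolding ip using zy(2) subspace_0[OF subspace_Zr] by blast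
    then show "\<exists>z\<in>Zr (int r + 1) ?n p. z' - z \<in> ?I" using zy(1) by blast
  qed
qed

lemma pr_D_leading:
  assumes "x \<in> Fil n p"
  shows "pr p (D x) = v (pr p x)" "pr (p + 1) (D x) = h (pr p x) + v (pr (p + 1) x)"
  using pr_of_D[OF assms, of p] pr_of_D[OF assms, of "p + 1"] pr_Fil_0[OF assms, of "p - 1"]
  by (simp_all add: endo_0[OF endo_h])

lemma Fil_2_iff: "x \<in> Fil n p \<Longrightarrow> x \<in> Fil n (p + 2) \<longleftrightarrow> pr p x = 0 \<and> pr (p + 1) x = 0"
  using pr_0_iff[of x n p] pr_0_iff[of x n "p + 1"] Fil_Suc[of n "p + 1"]
  by (auto simp: add.commute add.left_commute)

text \<open>The three components of the equation \<open>D (D x) = 0\<close>.\<close>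

lemma vv_Gr: "x \<in> Gr p t \<Longrightarrow> v (v x) = 0"
  and vh_Gr: "x \<in> Gr p t \<Longrightarrow> v (h x) = - h (v x)"
  and hh_Gr: "x \<in> Gr p t \<Longrightarrow> h (h x) = 0"
proof -
  assume x: "x \<in> Gr p t"
  have "x \<in> Fil (p + t) p" using x Gr_Fil by blast
  then have expanded: "h (h x) + h (v x) + v (h x) + v (v x) = 0"
    using D_D by (simp add: endo_add[OF endo_h] endo_add[OF endo_v] add.assoc)
  note G = h_Gr[OF h_Gr[OF x]] h_Gr[OF v_Gr[OF x]] v_Gr[OF h_Gr[OF x]] v_Gr[OF v_Gr[OF x]]
  have "pr j (h (h x)) + pr j (h (v x)) + pr j (v (h x)) + pr j (v (v x)) = 0" for j
    using arg_cong[OF expanded, of "pr j"] by (simp add: endo_add[OF endo_pr] endo_0[OF endo_pr])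
  from this[of p] this[of "p + 1"] this[of "p + 2"]
  show "v (v x) = 0" "v (h x) = - h (v x)" "h (h x) = 0"
    using pr_Gr[OF G(1)] pr_Gr[OF G(2)] pr_Gr[OF G(3)] pr_Gr[OF G(4)]
    by (simp_all add: add_eq_0_iff)
qed

text \<open>The isomorphism is the projection to the lowest column \<open>p\<close>. For \<open>x\<close> in \<open>Zr 2\<close> the first two
components of \<open>D x\<close> vanish: \<open>v x\<^sub>p = 0\<close> and \<open>h x\<^sub>p + v x\<^sub>p\<^sub>+\<^sub>1 = 0\<close>. So \<open>x\<^sub>p\<close> is a vertical cocycle whose
horizontal differential is a vertical coboundary, and conversely such an \<open>x\<^sub>p\<close> is completed by a choice
of \<open>x\<^sub>p\<^sub>+\<^sub>1\<close>.\<close>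

lemma E2_isomorphic:
  "mod_isomorphic (ring_of_type_algebra :: 'k ring) (E 2 p q)
     (cohomology (\<lambda>p. cohomology (Cm p) (cd p) q)
       (\<lambda>p. quot_map (Cm (p + 1) q) (coboundaries (Cm (p + 1)) (cd (p + 1)) q) (cb p q)) p)"
proof -
  let ?K1 = "\<lambda>p. {x \<in> Gr p q. v x \<in> {0}}"
  let ?I1 = "\<lambda>p. {v x + b | x b. x \<in> Gr p (q - 1) \<and> b \<in> {0}}"
  let ?\<pi>1 = "\<lambda>p z. coboundaries (Cm p) (cd p) q +>\<^bsub>Cm p q\<^esub> \<kappa> p q z"
  let ?b = "\<lambda>p. quot_map (Cm (p + 1) q) (coboundaries (Cm (p + 1)) (cd (p + 1)) q) (cb p q)"
  have vG0: "v (v x) \<in> {0}" if "x \<in> Gr p t" for p t x using vv_Gr[OF that] by simp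
  have vG: "v ` Gr p t \<subseteq> Gr p (t + 1)" "v ` {0} \<subseteq> {0}" for p t
    using v_Gr endo_0[OF endo_v] by auto
  have col: "coboundaries (Cm p) (cd p) q = \<kappa> p q ` ?I1 p"
    and P1: "presents (cohomology (Cm p) (cd p) q) (?K1 p) (?I1 p) (?\<pi>1 p)" for p
    by (rule presents_cohomology(2,3)[of "Cm p" "Gr p" "\<lambda>_. {0}" "\<kappa> p" "\<lambda>_. v" "cd p" q];
      (rule Cm endo_v vG vG0 cd; assumption?))+
  have hK: "h x \<in> ?K1 (p + 1)" if "x \<in> ?K1 p" for p x
    using that h_Gr vh_Gr by (auto simp: endo_0[OF endo_h])
  have hI: "h x \<in> ?I1 (p + 1)" if "x \<in> ?I1 p" for p x
  proof -
    obtain y where y: "y \<in> Gr p (q - 1)" "x = v y" using \<open>x \<in> ?I1 p\<close> by auto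
    then have "h x = v (- h y) + 0" using vh_Gr[OF y(1)] by (simp add: endo_neg[OF endo_v])
    then show ?thesis using h_Gr[OF y(1)] subspace_neg[OF Gr_subspace] by blast
  qed
  have hh: "h (h x) \<in> ?I1 (p + 2)" if "x \<in> ?K1 p" for p x
  proof -
    have "h (h x) = v 0 + 0" using hh_Gr that endo_0[OF endo_v] by auto
    then show ?thesis using subspace_0[OF Gr_subspace] by blast
  qed
  have IG: "?I1 p \<subseteq> Gr p q" for p using v_Gr[of _ p "q - 1"] by auto
  have I1: "subspace (?I1 p)" "0 \<in> ?I1 p" for p
    using presentsD(2)[OF P1[of p]] subspace_0 by blast+
  have bd: "?b p (?\<pi>1 p z) = ?\<pi>1 (p + 1) (h z)" if z: "z \<in> ?K1 p" for p z
    unfolding col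
  proof (rule quot_map_coset[OF Cm Cm IG I1(1) _ IG _ endo_h])
    show "{0} \<subseteq> ?I1 (p + 1)" using I1(2) by blast
    show "?I1 p \<noteq> {}" using I1(2)[of p] by blast
    show "h ` ?I1 p \<subseteq> ?I1 (p + 1)" using hI by blast
  qed (use h_Gr z cb in auto)
  let ?K2 = "{x \<in> ?K1 p. h x \<in> ?I1 (p + 1)}"
  let ?I2 = "{h x + b | x b. x \<in> ?K1 (p - 1) \<and> b \<in> ?I1 p}"
  have P2: "presents (cohomology (\<lambda>p. cohomology (Cm p) (cd p) q) ?b p) ?K2 ?I2
      (\<lambda>z. coboundaries (\<lambda>p. cohomology (Cm p) (cd p) q) ?b p +>\<^bsub>cohomology (Cm p) (cd p) q\<^esub> ?\<pi>1 p z)"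
    by (rule presents_cohomology(3)[of "\<lambda>p. cohomology (Cm p) (cd p) q" ?K1 ?I1 ?\<pi>1 "\<lambda>_. h" ?b p,
          OF P1 endo_h _ _ hh bd]) (use hK hI in \<open>blast+\<close>)
  let ?n = "p + q"
  have PE: "presents (E 2 p q) (Zr 2 ?n p) (Br 2 ?n p) (\<epsilon> 2 p q)" using presents_E[of 2 p q] by simp
  have lead: "pr p (D x) = 0 \<and> pr (p + 1) (D x) = 0 \<longleftrightarrow> D x \<in> Fil (?n + 1) (p + 2)"
    if "x \<in> Fil ?n p" for x
    using Fil_2_iff[OF D_in_Fil[OF that]] by blast
  have G0: "pr p x \<in> Gr p q" if "x \<in> Fil ?n p" for x using pr_Fil[OF that] by simp
  have G1: "pr (p + 1) x \<in> Gr (p + 1) (q - 1)" if "x \<in> Fil ?n (p + 1)" for x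
    using pr_Fil[OF that] by simp
  have split: "x - pr p x \<in> Fil ?n (p + 1)" if "x \<in> Fil ?n p" for x
    using pr_0_iff[of "x - pr p x" ?n p] that G0[OF that] Gr_Fil[of p q] Fil_diff[of x ?n p "pr p x"]
    by (auto simp: endo_diff[OF endo_pr] pr_Gr)
  have D2: "x \<in> Zr 2 ?n p \<longleftrightarrow> x \<in> Fil ?n p \<and> v (pr p x) = 0 \<and> h (pr p x) + v (pr (p + 1) x) = 0" for x
    using lead[of x] pr_D_leading[of x ?n p] unfolding Zr_def by auto
  show ?thesis
  proof (rule presents_isomorphic[OF PE P2, of "pr p"])
    show "endo (pr p)" by (rule endo_pr)
    show "pr p ` Zr 2 ?n p \<subseteq> ?K2"
    proof
      fix u assume "u \<in> pr p ` Zr 2 ?n p"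
      then obtain x where x: "x \<in> Zr 2 ?n p" "u = pr p x" by blast
      then have F: "x \<in> Fil ?n p" and vx: "v (pr p x) = 0"
        and hx: "h (pr p x) + v (pr (p + 1) x) = 0" using D2 by blast+
      let ?y = "pr (p + 1) (x - pr p x)"
      have y: "?y = pr (p + 1) x" using G0[OF F] by (simp add: endo_diff[OF endo_pr] pr_Gr)
      have yG: "pr (p + 1) x \<in> Gr (p + 1) (q - 1)" using G1[OF split[OF F]] y by simp
      have "h (pr p x) = v (- pr (p + 1) x) + 0"
        using hx by (simp add: endo_neg[OF endo_v] eq_neg_iff_add_eq_0)
      then have "h u \<in> ?I1 (p + 1)" unfolding x(2) using yG subspace_neg[OF Gr_subspace] by blast
      then show "u \<in> ?K2" using G0[OF F] vx x(2) by auto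
    qed
  next
    fix z assume z: "z \<in> Zr 2 ?n p"
    show "pr p z \<in> ?I2 \<longleftrightarrow> z \<in> Br 2 ?n p"
    proof
      assume "pr p z \<in> ?I2"
      then obtain u w where uw: "u \<in> Gr (p - 1) q" "v u = 0" "w \<in> Gr p (q - 1)" "pr p z = h u + v w"
        by auto
      \<comment> \<open>the coboundary of \<open>u + w\<close> has the same component in column \<open>p\<close> as \<open>z\<close>\<close>
      let ?y = "u + w"
      have F: "u \<in> Fil (?n - 1) (p - 1)" "w \<in> Fil (?n - 1) p" "w \<in> Fil (?n - 1) (p - 1)"
        using uw Gr_Fil[of "p - 1" q] Gr_Fil[of p "q - 1"] Fil_Suc[of "?n - 1" "p - 1"]
        by (auto simp: algebra_simps)
      have yF: "?y \<in> Fil (?n - 1) (p - 1)" using F Fil_add by blast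
      have "D u \<in> Fil ?n p"
        using h_Gr[OF uw(1)] Gr_Fil[of p q] uw(2) by (auto simp: D_def)
      moreover have "D w \<in> Fil ?n p" using D_in_Fil_pred[OF F(2)] .
      ultimately have Dy: "D ?y \<in> Fil ?n p" by (simp add: D_simps Fil_add)
      have py: "pr (p - 1) ?y = u" "pr p ?y = w"
        using uw by (auto simp: endo_add[OF endo_pr] pr_Gr)
      have "pr p (D ?y) = pr p z"
        using pr_of_D[OF yF, of p] uw(4) by (simp add: py)
      then have "z - D ?y \<in> Fil ?n (p + 1)"
        using pr_0_iff[OF Fil_diff[OF ZrD(1)[OF z] Dy]] by (simp add: endo_diff[OF endo_pr])
      moreover have "D (z - D ?y) \<in> Fil (?n + 1) (p + 2)"
        using ZrD(2)[OF z] D_square[OF yF] by (simp add: D_simps)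
      ultimately have "z - D ?y \<in> Zr 1 ?n (p + 1)" by (auto simp: Zr_def add.assoc)
      moreover have "?y \<in> Zr 1 (?n - 1) (p - 1)" using yF Dy by (simp add: Zr_def)
      ultimately show "z \<in> Br 2 ?n p" by (intro BrI[of "z - D ?y" _ _ _ ?y]) simp_all
    next
      assume "z \<in> Br 2 ?n p"
      then obtain y w where yw: "y \<in> Zr 1 ?n (p + 1)" "w \<in> Zr 1 (?n - 1) (p - 1)" "z = y + D w"
        unfolding Br_def by auto
      have F: "w \<in> Fil (?n - 1) (p - 1)" using ZrD(1)[OF yw(2)] .
      have Dw: "D w \<in> Fil ?n p" using ZrD(2)[OF yw(2)] by simp
      have u: "pr (p - 1) w \<in> Gr (p - 1) q" using pr_Fil[OF F] by simp
      have vu: "v (pr (p - 1) w) = 0"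
        using pr_D_leading(1)[OF F] pr_Fil_0[OF Dw, of "p - 1"] by simp
      have s: "w - pr (p - 1) w \<in> Fil (?n - 1) p"
      proof -
        have "pr (p - 1) w \<in> Fil (?n - 1) (p - 1)"
          using u Gr_Fil[of "p - 1" q] by (auto simp: algebra_simps)
        then show ?thesis
          using pr_0_iff[of "w - pr (p - 1) w" "?n - 1" "p - 1"] F u
          by (simp add: Fil_diff endo_diff[OF endo_pr] pr_Gr)
      qed
      have "pr p (w - pr (p - 1) w) \<in> Gr p (q - 1)" using pr_Fil[OF s] by simp
      then have w: "pr p w \<in> Gr p (q - 1)" using u by (simp add: endo_diff[OF endo_pr] pr_Gr)
      have "pr p z = h (pr (p - 1) w) + (v (pr p w) + 0)"
        using pr_Fil_0[OF ZrD(1)[OF yw(1)], of p] pr_of_D[OF F, of p] yw(3)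
        by (simp add: endo_add[OF endo_pr])
      then show "pr p z \<in> ?I2" using u vu w by blast
    qed
  next
    fix z' assume "z' \<in> ?K2"
    then obtain y where z': "z' \<in> Gr p q" "v z' = 0" and y: "y \<in> Gr (p + 1) (q - 1)" "h z' = v y"
      by auto
    have F: "z' \<in> Fil ?n p" "y \<in> Fil ?n p"
      using z' y Gr_Fil[of p q] Gr_Fil[of "p + 1" "q - 1"] Fil_Suc[of ?n p] by auto
    have px: "pr p (z' - y) = z'" "pr (p + 1) (z' - y) = - y"
      using z' y by (auto simp: endo_diff[OF endo_pr] pr_Gr)
    have "z' - y \<in> Zr 2 ?n p"
      unfolding D2 px using F z' y Fil_diff by (simp add: endo_neg[OF endo_v])
    moreover have "z' - pr p (z' - y) = h 0 + (v 0 + 0)"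
      using px endo_0[OF endo_h] endo_0[OF endo_v] by simp
    then have "z' - pr p (z' - y) \<in> ?I2"
      using subspace_0[OF Gr_subspace] endo_0[OF endo_v] by blast
    ultimately show "\<exists>z\<in>Zr 2 ?n p. z' - pr p z \<in> ?I2" by blast
  qed
qed

definition cocycle_Fil :: "int \<Rightarrow> int \<Rightarrow> 'v set"
  where "cocycle_Fil n p = {x \<in> Fil n p. D x = 0}"

lemma subspace_cocycle_Fil: "subspace (cocycle_Fil n p)"
  unfolding subspace_def cocycle_Fil_def by (auto simp: D_simps Fil_0 Fil_add Fil_scale)

text \<open>The filtration of the cohomology consists of the classes of cocycles in \<open>Fil n p\<close>. For \<open>r\<close> large
compared with \<open>p\<close> and \<open>n\<close>, the target column \<open>p + r\<close> lies beyond \<open>n + 1\<close> and the source column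
\<open>p - r\<close> below \<open>0\<close>. Then \<open>Zr r n p\<close> is the space of cocycles in \<open>Fil n p\<close>, and \<open>Br r n p\<close> is generated
by the cocycles in \<open>Fil n (p + 1)\<close> and all coboundaries in \<open>Fil n p\<close>.\<close>

lemma converges_E: "ss_converges (ring_of_type_algebra :: 'k ring) E dE (cohomology Tm dm)"
proof -
  let ?Z = "\<lambda>n. cocycle_Fil n 0" and ?B = "\<lambda>n. D ` Fil (n - 1) 0"
  let ?\<pi> = "\<lambda>n z. coboundaries Tm dm n +>\<^bsub>Tm n\<^esub> \<iota> n z"
  have PH: "presents (cohomology Tm dm n) (?Z n) (?B n) (?\<pi> n)" for n
  proof -
    have 1: "{x \<in> Fil n 0. D x \<in> {0}} = ?Z n" by (simp add: cocycle_Fil_def)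
    have 2: "{D x + b | x b. x \<in> Fil (n - 1) 0 \<and> b \<in> {0}} = ?B n" by auto
    show ?thesis
      using presents_cohomology(3)[of Tm "\<lambda>n. Fil n 0" "\<lambda>_. {0}" \<iota> "\<lambda>_. D" dm n, OF Tm endo_D]
        D_in_Fil D_square dm D_simps(4) unfolding 1 2 by (fastforce simp: D_def)
  qed
  define S where "S n p = {y + D w | y w. y \<in> cocycle_Fil n p \<and> w \<in> Fil (n - 1) 0}" for n p
  have subS: "subspace (S n p)" for n p
    unfolding S_def by (rule subspace_plus_image[OF subspace_cocycle_Fil Fil_subspace])
  have SZ: "S n p \<subseteq> ?Z n" for n p
  proof
    fix u assume "u \<in> S n p"
    then obtain y w where "y \<in> cocycle_Fil n p" "w \<in> Fil (n - 1) 0" "u = y + D w"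
      unfolding S_def by blast
    then show "u \<in> ?Z n"
      using Fil_le_0[of n p] D_in_Fil_pred D_square by (auto simp: cocycle_Fil_def D_simps intro!: Fil_add)
  qed
  have BS: "?B n \<subseteq> S n p" for n p
  proof
    fix u assume "u \<in> ?B n"
    then obtain w where "w \<in> Fil (n - 1) 0" "u = 0 + D w" by auto
    then show "u \<in> S n p" unfolding S_def using subspace_0[OF subspace_cocycle_Fil] by blast
  qed
  have Smono: "S n (p + 1) \<subseteq> S n p" for n p
    unfolding S_def cocycle_Fil_def using Fil_Suc[of n p] by blast
  show ?thesis
    unfolding ss_converges_def
  proof (intro exI[of _ "\<lambda>n p. ?\<pi> n ` S n p"] conjI allI)
    fix n p :: int
    show "submodule (?\<pi> n ` S n p) (ring_of_type_algebra :: 'k ring) (cohomology Tm dm n)"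
      by (rule presents_submodule[OF PH subS SZ])
    show "?\<pi> n ` S n (p + 1) \<subseteq> ?\<pi> n ` S n p" using Smono by blast
  next
    fix n :: int
    have "S n 0 = ?Z n"
    proof (intro equalityI SZ subsetI)
      fix u assume "u \<in> ?Z n"
      moreover have "u = u + D 0" by (simp add: D_simps)
      ultimately show "u \<in> S n 0" unfolding S_def using Fil_0 by blast
    qed
    then have s: "?\<pi> n ` S n 0 = carrier (cohomology Tm dm n)" using presentsD(4)[OF PH] by simp
    have "S n (n + 1) = ?B n"
      unfolding S_def cocycle_Fil_def using Fil_high[of n "n + 1"] by (auto simp: D_simps)
    moreover have "?\<pi> n ` ?B n = {\<zero>\<^bsub>cohomology Tm dm n\<^esub>}"
      using presentsD(2,3,7)[OF PH[of n]] subspace_0[OF presentsD(2)[OF PH[of n]]] by blast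
    ultimately have "?\<pi> n ` S n (n + 1) = {\<zero>\<^bsub>cohomology Tm dm n\<^esub>}" by simp
    then show "\<exists>s t. ?\<pi> n ` S n s = carrier (cohomology Tm dm n)
        \<and> ?\<pi> n ` S n t = {\<zero>\<^bsub>cohomology Tm dm n\<^esub>}"
      using s by blast
  next
    fix p q :: int
    let ?n = "p + q"
    let ?M = "quot_module ((cohomology Tm dm ?n)\<lparr>carrier := ?\<pi> ?n ` S ?n p\<rparr>) (?\<pi> ?n ` S ?n (p + 1))"
    have PM: "presents ?M (S ?n p) (S ?n (p + 1))
        (\<lambda>z. ?\<pi> ?n ` S ?n (p + 1) +>\<^bsub>cohomology Tm dm ?n\<^esub> ?\<pi> ?n z)"
      by (rule presents_quot_module[OF PH subS SZ subS BS Smono])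
    \<comment> \<open>from this page on, the columns reached from column \<open>p\<close> lie outside the first quadrant\<close>
    show "is_E_infinity (ring_of_type_algebra :: 'k ring) E dE p q ?M"
      unfolding is_E_infinity_def
    proof (intro exI[of _ "nat (\<bar>p\<bar> + \<bar>?n\<bar> + 3)"] conjI allI impI ballI)
      show "1 \<le> nat (\<bar>p\<bar> + \<bar>?n\<bar> + 3)" by simp
      fix r assume "nat (\<bar>p\<bar> + \<bar>?n\<bar> + 3) \<le> r"
      then have r: "\<bar>p\<bar> + \<bar>?n\<bar> + 3 \<le> int r" and r1: "1 \<le> r" by simp_all
      note PE = presents_E[OF r1]
      have high: "Fil (?n + 1) (p + int r) = {0}" "Fil (?n + 1) (p + 1 + (int r - 1)) = {0}"
        using r by (auto intro!: Fil_high)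
      have low: "Fil (?n - 1) (p - int r + 1) = Fil (?n - 1) 0" using r by (intro Fil_low) simp
      have Zi: "Zr (int r) ?n p = cocycle_Fil ?n p"
        "Zr (int r - 1) ?n (p + 1) = cocycle_Fil ?n (p + 1)"
        unfolding Zr_def cocycle_Fil_def high by auto
      have Bi: "z \<in> Br (int r) ?n p \<longleftrightarrow> z \<in> S ?n (p + 1)" if z: "z \<in> cocycle_Fil ?n p" for z
      proof
        assume "z \<in> Br (int r) ?n p"
        then obtain y w where yw: "y \<in> Zr (int r - 1) ?n (p + 1)"
            "w \<in> Zr (int r - 1) (?n - 1) (p - int r + 1)" "z = y + D w"
          unfolding Br_def by blast
        then have "y \<in> cocycle_Fil ?n (p + 1)" "w \<in> Fil (?n - 1) 0"
          using Zi(2) ZrD(1)[OF yw(2)] low by auto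
        then show "z \<in> S ?n (p + 1)" unfolding S_def using yw(3) by blast
      next
        assume "z \<in> S ?n (p + 1)"
        then obtain y w where yw: "y \<in> cocycle_Fil ?n (p + 1)" "w \<in> Fil (?n - 1) 0" "z = y + D w"
          unfolding S_def by blast
        have "D w = z - y" using yw(3) by simp
        moreover have "z - y \<in> Fil ?n p"
          using z yw(1) Fil_Suc[of ?n p] Fil_diff unfolding cocycle_Fil_def by blast
        ultimately have "w \<in> Zr (int r - 1) (?n - 1) (p - int r + 1)"
          using yw(2) unfolding Zr_def low by simp
        then show "z \<in> Br (int r) ?n p" using yw Zi(2) by (intro BrI[of y _ _ _ w]) auto
      qed
      show "dE r p q x = \<zero>\<^bsub>E r (p + int r) (q - int r + 1)\<^esub>" if "x \<in> carrier (E r p q)" for x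
      proof -
        obtain z where z: "z \<in> Zr (int r) ?n p" "x = \<epsilon> r p q z"
          using \<open>x \<in> carrier (E r p q)\<close> presentsD(4)[OF PE[of p q]] by blast
        then have "D z = 0" unfolding Zi cocycle_Fil_def by blast
        then show ?thesis using dE_facts(2)[OF r1 z(1)] z(2) presents_zero[OF PE] by simp
      qed
      show "dE r (p - int r) (q + int r - 1) x = \<zero>\<^bsub>E r p q\<^esub>"
        if "x \<in> carrier (E r (p - int r) (q + int r - 1))" for x
      proof -
        have i: "p - int r + (q + int r - 1) = ?n - 1" "p - int r + int r = p"
          "q + int r - 1 - int r + 1 = q" by auto
        obtain z where z: "z \<in> Zr (int r) (?n - 1) (p - int r)" "x = \<epsilon> r (p - int r) (q + int r - 1) z"
          using \<open>x \<in> carrier (E r (p - int r) (q + int r - 1))\<close>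
            presentsD(4)[OF PE[of "p - int r" "q + int r - 1"]] unfolding i by blast
        have d: "dE r (p - int r) (q + int r - 1) x = \<epsilon> r p q (D z)"
          using dE_facts(2)[OF r1, of z "p - int r" "q + int r - 1"] z unfolding i by simp
        have DZ: "D z \<in> Zr (int r) ?n p" using D_Zr[OF z(1)] by simp
        have "D z = 0 + D z" "z \<in> Fil (?n - 1) 0" using ZrD(1)[OF z(1)] Fil_le_0 by auto
        then have "D z \<in> S ?n (p + 1)"
          unfolding S_def using subspace_0[OF subspace_cocycle_Fil] by blast
        then have "D z \<in> Br (int r) ?n p" using Bi DZ Zi by blast
        then show ?thesis using presentsD(7)[OF PE[of p q]] DZ d by simp
      qed
      show "mod_isomorphic (ring_of_type_algebra :: 'k ring) (E r p q) ?M"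
      proof (rule presents_isomorphic[OF PE PM, of "\<lambda>x. x"])
        show "endo (\<lambda>x. x)" by (simp add: endo_def)
        show "(\<lambda>x. x) ` Zr (int r) ?n p \<subseteq> S ?n p"
        proof
          fix u assume "u \<in> (\<lambda>x. x) ` Zr (int r) ?n p"
          then have "u \<in> cocycle_Fil ?n p" "u = u + D 0" by (auto simp: Zi D_simps)
          then show "u \<in> S ?n p" unfolding S_def using Fil_0 by blast
        qed
      next
        fix z assume "z \<in> Zr (int r) ?n p"
        then show "z \<in> S ?n (p + 1) \<longleftrightarrow> z \<in> Br (int r) ?n p" using Bi Zi by blast
      next
        fix z' assume "z' \<in> S ?n p"
        then obtain y w where yw: "y \<in> cocycle_Fil ?n p" "w \<in> Fil (?n - 1) 0" "z' = y + D w"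
          unfolding S_def by blast
        then have "z' - y = 0 + D w" by simp
        then have "z' - y \<in> S ?n (p + 1)"
          unfolding S_def using yw(2) subspace_0[OF subspace_cocycle_Fil] by blast
        then show "\<exists>z\<in>Zr (int r) ?n p. z' - z \<in> S ?n (p + 1)" using yw(1) Zi by blast
      qed
    qed
  qed
qed

end

section \<open>Cyclic operators on functions of words\<close>

lemma sign_cong: "(even a \<longleftrightarrow> even b) \<Longrightarrow> (-1 :: 'k::comm_ring_1) ^ a = (-1) ^ b"
  by (cases "even a") auto

text \<open>Letters of words, with a degree that is additive for the product. Cochains will be functions of words
in the letters \<open>(d, a)\<close> with \<open>a\<close> homogeneous of degree \<open>d\<close>. Carrying the degree in the letter makes
all Koszul signs functions of the word.\<close>

locale graded_monoid =
  fixes mul :: "'l \<Rightarrow> 'l \<Rightarrow> 'l" (infixl "\<star>" 70) and u :: 'l and deg :: "'l \<Rightarrow> nat"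
  assumes mul_assoc: "x \<star> y \<star> z = x \<star> (y \<star> z)"
    and mul_unit: "x \<star> u = x"
    and deg_mul: "deg (x \<star> y) = deg x + deg y"
    and deg_unit: "deg u = 0"
begin

definition wdeg :: "'l list \<Rightarrow> nat" where "wdeg w = sum_list (map deg w)"

lemma wdeg_simps [simp]: "wdeg [] = 0" "wdeg (x # w) = deg x + wdeg w"
    "wdeg (v @ w) = wdeg v + wdeg w"
  by (simp_all add: wdeg_def)

text \<open>\<open>face i\<close> multiplies the letters at positions \<open>i\<close> and \<open>i + 1\<close> and includes the sign \<open>(-1)\<^sup>i\<close>, which is what
the recursion on the first letter produces (\<open>face_append\<close>).\<close>

fun face :: "nat \<Rightarrow> ('l list \<Rightarrow> 'k::comm_ring_1) \<Rightarrow> 'l list \<Rightarrow> 'k"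
  where "face 0 g (x # y # w) = g (x \<star> y # w)"
  | "face (Suc i) g (x # w) = - face i (\<lambda>v. g (x # v)) w"
  | "face i g w = 0"

definition tau :: "('l list \<Rightarrow> 'k::comm_ring_1) \<Rightarrow> 'l list \<Rightarrow> 'k"
  where "tau g w = (if w = [] then g [] else
    (-1) ^ (length w - 1 + deg (last w) * wdeg (butlast w)) * g (last w # butlast w))"

text \<open>The Hochschild operator \<open>b\<close> without its last term.\<close>

definition bprime :: "('l list \<Rightarrow> 'k::comm_ring_1) \<Rightarrow> 'l list \<Rightarrow> 'k"
  where "bprime g w = (\<Sum>i<length w - 1. face i g w)"

text \<open>The last term of \<open>b\<close>, in which the last letter is multiplied from the left to the first one, is the
rotation of face \<open>0\<close>; rotation supplies exactly its Koszul sign.\<close>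

definition hoch :: "('l list \<Rightarrow> 'k::comm_ring_1) \<Rightarrow> 'l list \<Rightarrow> 'k"
  where "hoch g w = bprime g w + tau (face 0 g) w"

definition cyclic_norm :: "('l list \<Rightarrow> 'k::comm_ring_1) \<Rightarrow> 'l list \<Rightarrow> 'k"
  where "cyclic_norm g w = (\<Sum>i<length w. (tau ^^ i) g w)"

text \<open>The operator \<open>s\<close>; \<open>length w - 1\<close> is the cochain degree of the result.\<close>

definition unit_op :: "('l list \<Rightarrow> 'k::comm_ring_1) \<Rightarrow> 'l list \<Rightarrow> 'k"
  where "unit_op g w = (-1) ^ (length w - 1) * g (w @ [u])"

definition connes :: "('l list \<Rightarrow> 'k::comm_ring_1) \<Rightarrow> 'l list \<Rightarrow> 'k"
  where "connes g = cyclic_norm (unit_op (\<lambda>w. g w - tau g w))"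

lemma tau_Nil [simp]: "tau g [] = g []"
  and tau_snoc: "tau g (w @ [z]) = (-1) ^ (length w + deg z * wdeg w) * g (z # w)"
  by (simp_all add: tau_def)

lemma face_Nil [simp]: "face i g [] = 0"
  by (cases i) simp_all

lemma face_append:
  "face i g (us @ x # y # vs) = (-1) ^ i * g (us @ x \<star> y # vs)" if "i = length us"
  using that by (induction us arbitrary: i g) auto

lemma face_beyond: "length w - 1 \<le> i \<Longrightarrow> face i g w = 0"
  by (induction i g w rule: face.induct) auto

lemma face_add: "face i (\<lambda>w. g w + h w) = (\<lambda>w. face i g w + face i h w)"
proof
  show "face i (\<lambda>w. g w + h w) w = face i g w + face i h w" for w
    by (induction i g w arbitrary: h rule: face.induct) auto
qed

lemma face_scale: "face i (\<lambda>w. c * g w) = (\<lambda>w. c * face i g w)"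
proof
  show "face i (\<lambda>w. c * g w) w = c * face i g w" for w
    by (induction i g w rule: face.induct) auto
qed

lemma face_uminus: "face i (\<lambda>w. - g w) = (\<lambda>w. - face i g w)"
  using face_scale[of i "-1" g] by simp

lemma face_diff: "face i (\<lambda>w. g w - h w) = (\<lambda>w. face i g w - face i h w)"
  using face_add[of i g "\<lambda>w. - h w"] by (simp add: face_uminus)

lemma face_zero: "face i (\<lambda>w. 0) = (\<lambda>w. 0)"
  using face_scale[of i 0 "\<lambda>w. 0"] by simp

lemma face_sum: "face i (\<lambda>w. \<Sum>j\<in>J. g j w) = (\<lambda>w. \<Sum>j\<in>J. face i (g j) w)"
  by (induction J rule: infinite_finite_induct) (simp_all add: face_add face_zero)

lemmas face_lin = face_add face_diff face_uminus face_scale face_zero face_sum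

lemma tau_add: "tau (\<lambda>w. g w + h w) = (\<lambda>w. tau g w + tau h w)"
  and tau_diff: "tau (\<lambda>w. g w - h w) = (\<lambda>w. tau g w - tau h w)"
  and tau_uminus: "tau (\<lambda>w. - g w) = (\<lambda>w. - tau g w)"
  and tau_scale: "tau (\<lambda>w. c * g w) = (\<lambda>w. c * tau g w)"
  and tau_zero: "tau (\<lambda>w. 0) = (\<lambda>w. 0)"
  by (simp_all add: tau_def fun_eq_iff algebra_simps)

lemma tau_sum: "tau (\<lambda>w. \<Sum>j\<in>J. g j w) = (\<lambda>w. \<Sum>j\<in>J. tau (g j) w)"
  by (induction J rule: infinite_finite_induct) (simp_all add: tau_add tau_zero)

lemmas tau_lin = tau_add tau_diff tau_uminus tau_scale tau_zero tau_sum

lemma tau_pow_add: "(tau ^^ k) (\<lambda>w. g w + h w) = (\<lambda>w. (tau ^^ k) g w + (tau ^^ k) h w)"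
  and tau_pow_diff: "(tau ^^ k) (\<lambda>w. g w - h w) = (\<lambda>w. (tau ^^ k) g w - (tau ^^ k) h w)"
  and tau_pow_scale: "(tau ^^ k) (\<lambda>w. c * g w) = (\<lambda>w. c * (tau ^^ k) g w)"
  and tau_pow_zero: "(tau ^^ k) (\<lambda>w. 0) = (\<lambda>w. 0)"
  by (induction k) (simp_all add: tau_lin)

text \<open>The number of summands of \<open>cyclic_norm\<close> and \<open>bprime\<close> depends on the length of the word. Equations between
them are therefore proved for words of one length at a time, by means of these congruences.\<close>

lemma tau_cong: "(\<And>v. length v = length w \<Longrightarrow> g v = h v) \<Longrightarrow> tau g w = tau h w"
  by (simp add: tau_def)

lemma tau_pow_cong: "(\<And>v. length v = length w \<Longrightarrow> g v = h v) \<Longrightarrow> (tau ^^ k) g w = (tau ^^ k) h w"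
proof (induction k arbitrary: w)
  case (Suc k)
  show ?case
    using Suc by (simp, intro tau_cong) auto
qed simp

lemma cyclic_norm_cong: "(\<And>v. length v = length w \<Longrightarrow> g v = h v) \<Longrightarrow> cyclic_norm g w = cyclic_norm h w"
  unfolding cyclic_norm_def by (intro sum.cong tau_pow_cong) auto

text \<open>Rotating a whole block \<open>vs\<close> to the front: the degrees inside \<open>vs\<close> contribute to the sign in pairs and
cancel, so that only \<open>wdeg us * wdeg vs\<close> remains. For \<open>us = []\<close> the exponent is a product of
two consecutive numbers, and this is the cyclic relation \<open>\<tau>\<^sup>n\<^sup>+\<^sup>1 = 1\<close>.\<close>

lemma tau_pow_append:
  "(tau ^^ length vs) g (us @ vs)
    = (-1) ^ (length vs * (length us + length vs - 1) + wdeg us * wdeg vs) * g (vs @ us)"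
proof (induction vs arbitrary: g us)
  case (Cons x vs)
  have "(tau ^^ length (x # vs)) g (us @ x # vs) = (tau ^^ length vs) (tau g) ((us @ [x]) @ vs)"
    by (simp add: funpow_swap1)
  also have "\<dots> = (-1) ^ (length vs * (length us + length vs) + (wdeg us + deg x) * wdeg vs)
      * tau g ((vs @ us) @ [x])"
    by (subst Cons.IH) simp
  also have "\<dots> = (-1) ^ (length vs * (length us + length vs) + (wdeg us + deg x) * wdeg vs
      + (length vs + length us + deg x * (wdeg vs + wdeg us))) * g (x # vs @ us)"
    by (subst tau_snoc) (simp add: power_add mult.assoc)
  also have "length vs * (length us + length vs) + (wdeg us + deg x) * wdeg vs
      + (length vs + length us + deg x * (wdeg vs + wdeg us))
    = length (x # vs) * (length us + length (x # vs) - 1) + wdeg us * wdeg (x # vs)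
      + 2 * (deg x * wdeg vs)"
    by (simp add: algebra_simps)
  finally show ?case by (simp add: power_add power_mult)
qed simp

lemma tau_pow_length: "(tau ^^ length w) g w = g w"
proof -
  have "even (length w * (length w - 1))" by (cases "length w") auto
  then show ?thesis using tau_pow_append[of w g "[]"] by (simp add: power_add)
qed

lemma tau_cyclic_norm: "tau (cyclic_norm g) = cyclic_norm g"
proof
  fix w :: "'l list"
  have "tau (cyclic_norm g) w = tau (\<lambda>v. \<Sum>i<length w. (tau ^^ i) g v) w"
    by (rule tau_cong) (simp add: cyclic_norm_def)
  also have "\<dots> = (\<Sum>i<length w. (tau ^^ Suc i) g w)" by (simp add: tau_lin)
  also have "\<dots> = (\<Sum>i<length w. (tau ^^ i) g w)"
    using sum.lessThan_Suc[of "\<lambda>i. (tau ^^ i) g w" "length w"]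
      sum.lessThan_Suc_shift[of "\<lambda>i. (tau ^^ i) g w" "length w"] tau_pow_length[of w g]
    by (simp add: o_def)
  finally show "tau (cyclic_norm g) w = cyclic_norm g w" by (simp add: cyclic_norm_def)
qed

lemma cyclic_norm_tau: "cyclic_norm (tau g) = cyclic_norm g"
proof
  fix w :: "'l list"
  have "cyclic_norm (tau g) w = (\<Sum>i<length w. (tau ^^ Suc i) g w)" by (simp add: cyclic_norm_def funpow_swap1)
  also have "\<dots> = tau (cyclic_norm g) w"
  proof -
    have "tau (cyclic_norm g) w = tau (\<lambda>v. \<Sum>i<length w. (tau ^^ i) g v) w"
      by (rule tau_cong) (simp add: cyclic_norm_def)
    then show ?thesis by (simp add: tau_lin)
  qed
  finally show "cyclic_norm (tau g) w = cyclic_norm g w" by (simp add: tau_cyclic_norm)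
qed

lemma cyclic_norm_add: "cyclic_norm (\<lambda>w. g w + h w) = (\<lambda>w. cyclic_norm g w + cyclic_norm h w)"
  and cyclic_norm_diff: "cyclic_norm (\<lambda>w. g w - h w) = (\<lambda>w. cyclic_norm g w - cyclic_norm h w)"
  and cyclic_norm_scale: "cyclic_norm (\<lambda>w. c * g w) = (\<lambda>w. c * cyclic_norm g w)"
  and cyclic_norm_zero: "cyclic_norm (\<lambda>w. 0) = (\<lambda>w. 0)"
  unfolding cyclic_norm_def
  by (simp_all add: tau_pow_add tau_pow_diff tau_pow_scale tau_pow_zero sum.distrib sum_subtractf
      sum_distrib_left)

lemma cyclic_norm_sum: "cyclic_norm (\<lambda>w. \<Sum>j\<in>J. g j w) = (\<lambda>w. \<Sum>j\<in>J. cyclic_norm (g j) w)"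
  by (induction J rule: infinite_finite_induct) (simp_all add: cyclic_norm_add cyclic_norm_zero)

lemma cyclic_norm_tau_pow: "cyclic_norm ((tau ^^ k) g) = cyclic_norm g"
  by (induction k arbitrary: g) (simp_all add: cyclic_norm_tau)

lemma bprime_add: "bprime (\<lambda>w. g w + h w) = (\<lambda>w. bprime g w + bprime h w)"
  and bprime_diff: "bprime (\<lambda>w. g w - h w) = (\<lambda>w. bprime g w - bprime h w)"
  and bprime_scale: "bprime (\<lambda>w. c * g w) = (\<lambda>w. c * bprime g w)"
  and bprime_zero: "bprime (\<lambda>w. 0) = (\<lambda>w. 0)"
  unfolding bprime_def by (simp_all add: face_lin sum.distrib sum_subtractf sum_distrib_left)

text \<open>The summands of \<open>b\<close>, including the last one. Rotation moves each of them to the preceding one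
(\<open>tau_cface\<close>), so that all are conjugates of \<open>cface 0\<close> by powers of \<open>\<tau>\<close>.\<close>

definition cface :: "nat \<Rightarrow> ('l list \<Rightarrow> 'k::comm_ring_1) \<Rightarrow> 'l list \<Rightarrow> 'k"
  where "cface i g w = (if i < length w - 1 then face i g w else tau (face 0 g) w)"

lemma hoch_cface: "hoch g w = (\<Sum>i<length w. cface i g w)"
proof (cases "length w")
  case 0
  then show ?thesis by (simp add: hoch_def bprime_def)
next
  case (Suc n)
  have "(\<Sum>i<length w. cface i g w) = (\<Sum>i<n. cface i g w) + cface n g w" using Suc by simp
  also have "(\<Sum>i<n. cface i g w) = bprime g w" unfolding bprime_def using Suc by (intro sum.cong) (auto simp: cface_def)
  also have "cface n g w = tau (face 0 g) w" using Suc by (simp add: cface_def)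
  finally show ?thesis by (simp add: hoch_def)
qed

lemma split_at:
  assumes "Suc i < length w"
  obtains us x y vs where "w = us @ x # y # vs" "length us = i"
proof
  show "w = take i w @ w ! i # w ! Suc i # drop (Suc (Suc i)) w"
    using assms by (metis Cons_nth_drop_Suc Suc_lessD append_take_drop_id)
  show "length (take i w) = i" using assms by simp
qed

lemma tau_face_Suc:
  assumes "Suc i < length w - 1"
  shows "tau (face (Suc i) g) w = face i (tau g) w"
proof -
  obtain us x y vs where w: "w = us @ x # y # vs" "length us = i"
    using assms by (elim split_at[rotated]) simp
  then have "vs \<noteq> []" using assms by auto
  then obtain vs' z where vs: "vs = vs' @ [z]" by (metis rev_exhaust)
  have "tau (face (Suc i) g) w
      = (-1) ^ (length us + length vs' + 2 + deg z * wdeg (us @ x # y # vs'))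
        * face (Suc i) g ((z # us) @ x # y # vs')"
    using tau_snoc[of "face (Suc i) g" "us @ x # y # vs'" z] by (simp add: w vs)
  also have "face (Suc i) g ((z # us) @ x # y # vs') = (-1) ^ Suc i * g (z # us @ x \<star> y # vs')"
    using face_append[of "Suc i" "z # us" g x y vs'] w(2) by simp
  finally have L: "tau (face (Suc i) g) w = (-1) ^ (length us + length vs' + 2
      + deg z * wdeg (us @ x # y # vs') + Suc i) * g (z # us @ x \<star> y # vs')"
    by (simp add: power_add)
  have "face i (tau g) w = (-1) ^ i * tau g (us @ x \<star> y # vs)"
    unfolding w(1) using face_append[of i us "tau g" x y vs] w(2) by simp
  also have "tau g (us @ x \<star> y # vs) = (-1) ^ (length us + length vs' + 1
      + deg z * wdeg (us @ x # y # vs')) * g (z # us @ x \<star> y # vs')"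
    using tau_snoc[of g "us @ x \<star> y # vs'" z] by (simp add: vs deg_mul add.assoc)
  finally show ?thesis unfolding L by (simp add: power_add)
qed

lemma tau_tau_face_0:
  assumes "length w = Suc (Suc i)"
  shows "tau (tau (face 0 g)) w = face i (tau g) w"
proof -
  obtain us x y vs where w: "w = us @ x # y # vs" "length us = i"
    using assms by (elim split_at[rotated]) simp
  have vs: "vs = []" using w assms by simp
  have "tau (tau (face 0 g)) w
      = (-1) ^ (length us + 1 + deg y * wdeg (us @ [x])) * tau (face 0 g) ((y # us) @ [x])"
    using tau_snoc[of "tau (face 0 g)" "us @ [x]" y] by (simp add: w vs)
  also have "tau (face 0 g) ((y # us) @ [x])
      = (-1) ^ (length us + 1 + deg x * wdeg (y # us)) * g (x \<star> y # us)"
    by (subst tau_snoc) simp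
  also have "(-1) ^ (length us + 1 + deg y * wdeg (us @ [x]))
      * ((-1) ^ (length us + 1 + deg x * wdeg (y # us)) * g (x \<star> y # us))
    = (-1) ^ ((length us + 1 + deg y * wdeg (us @ [x])) + (length us + 1 + deg x * wdeg (y # us)))
      * g (x \<star> y # us)"
    by (simp only: power_add mult.assoc)
  also have "\<dots> = (-1) ^ (i + (length us + (deg x + deg y) * wdeg us)) * g (x \<star> y # us)"
    by (rule arg_cong[where f = "\<lambda>c. c * _"], rule sign_cong) (auto simp: w(2))
  also have "\<dots> = (-1) ^ i * tau g (us @ [x \<star> y])"
    by (subst tau_snoc) (simp add: deg_mul power_add)
  also have "\<dots> = face i (tau g) w"
    unfolding w(1) vs using face_append[of i us "tau g" x y "[]"] w(2) by simp
  finally show ?thesis .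
qed

lemma tau_cface:
  assumes "Suc i < length w"
  shows "tau (cface (Suc i) g) w = cface i (tau g) w"
proof (cases "Suc i < length w - 1")
  case True
  have "tau (cface (Suc i) g) w = tau (face (Suc i) g) w"
    by (rule tau_cong) (use True in \<open>simp add: cface_def\<close>)
  then show ?thesis using True tau_face_Suc[OF True] by (simp add: cface_def)
next
  case False
  then have l: "length w = Suc (Suc i)" using assms by simp
  have "tau (cface (Suc i) g) w = tau (tau (face 0 g)) w"
    by (rule tau_cong) (use l in \<open>simp add: cface_def\<close>)
  then show ?thesis using tau_tau_face_0[OF l] l by (simp add: cface_def)
qed

lemma tau_pow_cface: "i < length w \<Longrightarrow> (tau ^^ i) (cface i g) w = cface 0 ((tau ^^ i) g) w"
proof (induction i arbitrary: g)
  case (Suc i)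
  have "(tau ^^ Suc i) (cface (Suc i) g) w = (tau ^^ i) (tau (cface (Suc i) g)) w"
    by (simp add: funpow_swap1)
  also have "\<dots> = (tau ^^ i) (cface i (tau g)) w"
    by (rule tau_pow_cong) (use Suc.prems in \<open>auto simp: tau_cface\<close>)
  finally show ?case using Suc by (simp add: funpow_swap1)
qed simp

text \<open>Rotation moves \<open>cface (i + 1)\<close> to \<open>cface i\<close>, so that the last summand on the right is what remains
of \<open>cface 0\<close>. Equivalently \<open>(1 - \<tau>) b = b' (1 - \<tau>)\<close>, see \<open>one_minus_tau_hoch\<close>.\<close>

lemma tau_hoch: "tau (hoch g) w = bprime (tau g) w + tau (face 0 g) w"
proof (cases "length w \<le> 1")
  case True
  then have "w = [] \<or> (\<exists>x. w = [x])" by (cases w) auto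
  then show ?thesis by (auto simp: hoch_def bprime_def tau_def)
next
  case False
  then obtain n where n: "length w = Suc n" "n > 0" by (cases "length w") auto
  have "tau (hoch g) w = tau (\<lambda>v. \<Sum>i<Suc n. cface i g v) w"
    by (rule tau_cong) (simp add: hoch_cface n)
  also have "\<dots> = tau (cface 0 g) w + (\<Sum>i<n. tau (cface (Suc i) g) w)"
    by (simp only: tau_lin sum.lessThan_Suc_shift)
  also have "tau (cface 0 g) w = tau (face 0 g) w"
    by (rule tau_cong) (use n in \<open>simp add: cface_def\<close>)
  also have "(\<Sum>i<n. tau (cface (Suc i) g) w) = bprime (tau g) w"
    unfolding bprime_def using n by (intro sum.cong) (auto simp: tau_cface, simp add: cface_def)
  finally show ?thesis by simp
qed

lemma one_minus_tau_hoch: "hoch g w - tau (hoch g) w = bprime (\<lambda>v. g v - tau g v) w"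
  by (simp add: tau_hoch hoch_def bprime_diff)

text \<open>Both sides equal \<open>N (cface 0 (N g))\<close>, because \<open>cface i\<close> is the conjugate of \<open>cface 0\<close> by \<open>\<tau> ^ i\<close>. On the
left the inner factor \<open>N\<close> absorbs a power of \<open>\<tau>\<close>, and the \<open>n + 1\<close> outer powers, one for each summand of
\<open>b\<close>, add up to \<open>N\<close>. On the right the outer factor \<open>N\<close> absorbs a power of \<open>\<tau>\<close>, and the \<open>n\<close> inner powers, one
for each summand of \<open>b'\<close>, add up to \<open>N\<close> on cochains of degree \<open>n - 1\<close>.\<close>

lemma hoch_cyclic_norm: "hoch (cyclic_norm g) w = cyclic_norm (bprime g) w"
proof -
  define n where "n = length w"
  let ?X = "cface 0 (cyclic_norm g)"
  have tpN: "(tau ^^ k) (cyclic_norm g) = cyclic_norm g" for k by (induction k) (simp_all add: tau_cyclic_norm)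
  have rot: "cface i h w = (tau ^^ (n - i)) (cface 0 ((tau ^^ i) h)) w" if "i < n" for i and h :: "'l list \<Rightarrow> 'a"
  proof -
    have "cface i h w = (tau ^^ n) (cface i h) w" using tau_pow_length n_def by metis
    also have "\<dots> = (tau ^^ (n - i)) ((tau ^^ i) (cface i h)) w"
      using that by (metis add_diff_inverse_nat comp_apply funpow_add le_add_diff_inverse2 less_or_eq_imp_le)
    also have "\<dots> = (tau ^^ (n - i)) (cface 0 ((tau ^^ i) h)) w"
      by (rule tau_pow_cong) (use that n_def in \<open>auto simp: tau_pow_cface\<close>)
    finally show ?thesis .
  qed
  have "hoch (cyclic_norm g) w = (\<Sum>i<n. cface i (cyclic_norm g) w)" by (simp add: hoch_cface n_def)
  also have "\<dots> = (\<Sum>i<n. (tau ^^ (n - i)) ?X w)"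
    by (intro sum.cong refl) (use rot[of _ "cyclic_norm g"] tpN in auto)
  also have "\<dots> = (\<Sum>i<n. (tau ^^ Suc i) ?X w)"
    using sum.nat_diff_reindex[of "\<lambda>i. (tau ^^ Suc i) ?X w" n, symmetric]
    by (simp add: Suc_diff_Suc)
  also have "\<dots> = cyclic_norm (tau ?X) w" by (simp add: cyclic_norm_def n_def funpow_swap1)
  also have "\<dots> = cyclic_norm ?X w" by (simp add: cyclic_norm_tau)
  finally have L: "hoch (cyclic_norm g) w = cyclic_norm ?X w" .
  show ?thesis
  proof (cases n)
    case 0
    then show ?thesis by (simp add: cyclic_norm_def n_def hoch_def bprime_def)
  next
    case (Suc m)
    have "cyclic_norm (bprime g) w = cyclic_norm (\<lambda>v. \<Sum>i<m. cface i g v) w"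
      by (rule cyclic_norm_cong) (use Suc n_def in \<open>auto simp: bprime_def cface_def\<close>)
    also have "\<dots> = (\<Sum>i<m. cyclic_norm (cface i g) w)" by (simp add: cyclic_norm_sum)
    also have "\<dots> = (\<Sum>i<m. cyclic_norm (cface 0 ((tau ^^ i) g)) w)"
    proof (intro sum.cong refl)
      fix i assume i: "i \<in> {..<m}"
      have "cyclic_norm (cface i g) w = cyclic_norm ((tau ^^ i) (cface i g)) w" by (simp add: cyclic_norm_tau_pow)
      also have "\<dots> = cyclic_norm (cface 0 ((tau ^^ i) g)) w"
        by (rule cyclic_norm_cong) (use i Suc n_def in \<open>auto simp: tau_pow_cface\<close>)
      finally show "cyclic_norm (cface i g) w = cyclic_norm (cface 0 ((tau ^^ i) g)) w" .
    qed
    also have "\<dots> = cyclic_norm (\<lambda>v. \<Sum>i<m. cface 0 ((tau ^^ i) g) v) w" by (simp add: cyclic_norm_sum)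
    also have "\<dots> = cyclic_norm ?X w"
    proof (rule cyclic_norm_cong)
      fix v :: "'l list" assume v: "length v = length w"
      show "(\<Sum>i<m. cface 0 ((tau ^^ i) g) v) = ?X v"
      proof (cases "m = 0")
        case True
        then obtain x where "v = [x]" using v Suc n_def by (cases v) auto
        then show ?thesis using True by (simp add: cface_def tau_def)
      next
        case False
        then obtain x y v' where v': "v = x # y # v'" "length v' = m - 1"
          using v Suc n_def by (cases v; cases "tl v") auto
        then show ?thesis using False by (simp add: cface_def cyclic_norm_def)
      qed
    qed
    finally show ?thesis using L by simp
  qed
qed

text \<open>The operator \<open>s\<close> is a contracting homotopy for \<open>b'\<close>: all faces of \<open>w @ [u]\<close> except the last one cancel
against those of \<open>w\<close>, and the last one absorbs the unit.\<close>

lemma bprime_unit_op: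
  assumes "w \<noteq> []"
  shows "bprime (unit_op g) w + unit_op (bprime g) w = g w"
proof -
  obtain v z where w: "w = v @ [z]" using assms by (metis rev_exhaust)
  define n where "n = length v"
  have fs: "face i (unit_op g) w = - ((-1) ^ n * face i g (w @ [u]))" if i: "i < n" for i
  proof -
    obtain us x y vs where d: "w = us @ x # y # vs" "length us = i"
      using i by (elim split_at[rotated]) (simp add: w n_def)
    have "n = Suc (length us + length vs)" using arg_cong[OF d(1), of length] by (simp add: w n_def)
    then show ?thesis
      unfolding d(1) using face_append[of i us _ x y] d(2) by (simp add: face_append unit_op_def)
  qed
  have "bprime (unit_op g) w = (\<Sum>i<n. - ((-1) ^ n * face i g (w @ [u])))"
    unfolding bprime_def by (intro sum.cong) (use fs in \<open>auto simp: w n_def\<close>)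
  moreover have "unit_op (bprime g) w = (-1) ^ n * ((\<Sum>i<n. face i g (w @ [u])) + face n g (w @ [u]))"
    by (simp add: unit_op_def bprime_def w n_def)
  moreover have "face n g (w @ [u]) = (-1) ^ n * g w"
    using face_append[of n v g z u "[]"] by (simp add: w n_def mul_unit)
  ultimately show ?thesis
    by (simp add: sum_negf sum_distrib_left algebra_simps flip: power_add power_mult_distrib)
qed

text \<open>This recursion gives \<open>bprime_bprime\<close> by induction on the word. The other input is
\<open>bprime_face_0_Cons\<close>, in which associativity is used.\<close>

lemma bprime_Cons: "bprime g (x # w) = face 0 g (x # w) - bprime (\<lambda>v. g (x # v)) w"
proof (cases w)
  case (Cons y v)
  then show ?thesis
    by (simp add: bprime_def sum.lessThan_Suc_shift sum_negf del: sum.lessThan_Suc)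
qed (simp add: bprime_def)

lemma bprime_face_0_Cons: "bprime (\<lambda>v. face 0 g (x # v)) (y # w) = bprime g (x \<star> y # w)"
  by (cases w) (simp_all add: bprime_Cons mul_assoc)

lemma bprime_bprime: "bprime (bprime g) w = 0"
proof (induction w arbitrary: g)
  case (Cons x w)
  have "bprime (\<lambda>v. bprime g (x # v)) w = bprime (\<lambda>v. face 0 g (x # v)) w - bprime (bprime (\<lambda>v. g (x # v))) w"
    by (simp add: bprime_Cons bprime_diff)
  then have "bprime (bprime g) (x # w) = face 0 (bprime g) (x # w) - bprime (\<lambda>v. face 0 g (x # v)) w"
    by (subst bprime_Cons) (simp add: Cons.IH)
  then show ?case by (cases w) (simp_all add: bprime_face_0_Cons bprime_def[of _ "[]"])
qed (simp add: bprime_def)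

lemma bprime_face_0: "bprime (face 0 g) w + face 0 (bprime g) w = face 0 (face 0 g) w"
proof -
  consider "w = []" | x where "w = [x]" | x y v where "w = x # y # v"
    by (metis list.exhaust)
  then show ?thesis
  proof cases
    case 3
    have "bprime (face 0 g) w = face 0 (face 0 g) w - bprime (\<lambda>v. face 0 g (x # v)) (y # v)"
      unfolding 3 by (subst bprime_Cons) simp
    then show ?thesis by (simp add: bprime_face_0_Cons 3)
  qed (simp_all add: bprime_def)
qed

lemma face_0_tau_face_0: "face 0 (tau (face 0 g)) w = - tau (face 0 (face 0 g)) w"
proof (cases "length w \<le> 2")
  case True
  then consider "w = []" | x where "w = [x]" | x y where "w = [x, y]"
    by (cases w; cases "tl w") auto
  then show ?thesis by cases (simp_all add: tau_def)
next
  case False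
  have "face 0 (tau (face 0 g)) w = tau (face (Suc 0) (face 0 g)) w"
    using tau_face_Suc[of 0 w "face 0 g"] False by simp
  also have "\<dots> = tau (\<lambda>v. - face 0 (face 0 g) v) w"
  proof (rule tau_cong)
    fix v :: "'l list" assume "length v = length w"
    then obtain x y z v' where "v = x # y # z # v'"
      using False by (cases v; cases "tl v"; cases "tl (tl v)") auto
    then show "face (Suc 0) (face 0 g) v = - face 0 (face 0 g) v" by (simp add: mul_assoc)
  qed
  finally show ?thesis by (simp add: tau_lin)
qed

lemma hoch_add: "hoch (\<lambda>w. g w + h w) = (\<lambda>w. hoch g w + hoch h w)"
  and hoch_scale: "hoch (\<lambda>w. c * g w) = (\<lambda>w. c * hoch g w)"
  and hoch_zero: "hoch (\<lambda>w. 0) = (\<lambda>w. 0)"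
  unfolding hoch_def by (simp_all add: bprime_add bprime_scale bprime_zero face_lin tau_lin algebra_simps)

text \<open>Write \<open>b = b' + \<tau> F\<close> with \<open>F\<close> for face \<open>0\<close>. From \<open>b' b' = 0\<close>, \<open>b' \<tau> = \<tau> (b - F)\<close> and
\<open>F \<tau> F = - \<tau> F F\<close> one gets \<open>b b = \<tau> (F b' + b' F - F F)\<close>, which vanishes by \<open>bprime_face_0\<close>.\<close>

lemma hoch_hoch: "hoch (hoch g) w = 0"
proof -
  let ?t = "tau (face 0 g)"
  have 1: "bprime ?t w = tau (\<lambda>v. hoch (face 0 g) v - face 0 (face 0 g) v) w"
    using tau_hoch[of "face 0 g" w] by (simp add: tau_lin)
  have "hoch (hoch g) w = hoch (\<lambda>v. bprime g v + ?t v) w" by (simp add: hoch_def[abs_def])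
  also have "\<dots> = bprime (bprime g) w + tau (face 0 (bprime g)) w + bprime ?t w + tau (face 0 ?t) w"
    by (simp add: hoch_add hoch_def)
  also have "tau (face 0 ?t) w = tau (\<lambda>v. - tau (face 0 (face 0 g)) v) w"
    by (rule tau_cong) (rule face_0_tau_face_0)
  finally have "hoch (hoch g) w = tau (\<lambda>v. face 0 (bprime g) v
      + (hoch (face 0 g) v - face 0 (face 0 g) v) - tau (face 0 (face 0 g)) v) w"
    by (simp add: bprime_bprime 1 tau_lin)
  also have "(\<lambda>v. face 0 (bprime g) v + (hoch (face 0 g) v - face 0 (face 0 g) v)
      - tau (face 0 (face 0 g)) v) = (\<lambda>v. 0)"
    using bprime_face_0[of g] by (intro ext) (simp add: hoch_def algebra_simps)
  finally show ?thesis by (simp add: tau_lin)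
qed

lemma unit_op_add: "unit_op (\<lambda>w. g w + h w) = (\<lambda>w. unit_op g w + unit_op h w)"
  and unit_op_scale: "unit_op (\<lambda>w. c * g w) = (\<lambda>w. c * unit_op g w)"
  and unit_op_zero: "unit_op (\<lambda>w. 0) = (\<lambda>w. 0)"
  by (simp_all add: unit_op_def fun_eq_iff algebra_simps)

lemma connes_add: "connes (\<lambda>w. g w + h w) = (\<lambda>w. connes g w + connes h w)"
  and connes_scale: "connes (\<lambda>w. c * g w) = (\<lambda>w. c * connes g w)"
proof -
  have "(\<lambda>w. g w + h w - tau (\<lambda>w. g w + h w) w) = (\<lambda>w. (g w - tau g w) + (h w - tau h w))"
    by (simp add: tau_lin algebra_simps)
  then show "connes (\<lambda>w. g w + h w) = (\<lambda>w. connes g w + connes h w)"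
    unfolding connes_def by (simp add: unit_op_add cyclic_norm_add)
  have "(\<lambda>w. c * g w - tau (\<lambda>w. c * g w) w) = (\<lambda>w. c * (g w - tau g w))"
    by (simp add: tau_lin algebra_simps)
  then show "connes (\<lambda>w. c * g w) = (\<lambda>w. c * connes g w)"
    unfolding connes_def by (simp add: unit_op_scale cyclic_norm_scale)
qed

text \<open>The factor \<open>(1 - \<tau>) N\<close> in the middle vanishes.\<close>

lemma connes_connes: "connes (connes g) w = 0"
  by (simp add: connes_def tau_cyclic_norm unit_op_zero cyclic_norm_zero)

text \<open>With \<open>b N = N b'\<close> and \<open>(1 - \<tau>) b = b' (1 - \<tau>)\<close> the sum becomes
\<open>N (b' s + s b') (1 - \<tau>) = N (1 - \<tau>) = 0\<close>.\<close>

lemma hoch_connes: "hoch (connes g) w + connes (hoch g) w = 0"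
proof -
  let ?h = "\<lambda>v. g v - tau g v"
  have "connes (hoch g) w = cyclic_norm (unit_op (bprime ?h)) w" by (simp add: connes_def one_minus_tau_hoch[abs_def])
  moreover have "hoch (connes g) w = cyclic_norm (bprime (unit_op ?h)) w" by (simp add: connes_def hoch_cyclic_norm)
  ultimately have "hoch (connes g) w + connes (hoch g) w = cyclic_norm (\<lambda>v. bprime (unit_op ?h) v + unit_op (bprime ?h) v) w"
    by (simp add: cyclic_norm_add)
  also have "\<dots> = cyclic_norm ?h w"
  proof (cases "w = []")
    case False
    then show ?thesis by (intro cyclic_norm_cong bprime_unit_op) auto
  qed (simp add: cyclic_norm_def)
  also have "\<dots> = 0" by (simp add: cyclic_norm_diff cyclic_norm_tau)
  finally show ?thesis .
qed

end

section \<open>The differential on functions of words\<close>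

text \<open>The letter \<open>(d, a)\<close> is \<open>good\<close> if \<open>a\<close> has degree \<open>d\<close>, and \<open>null\<close> if \<open>a = 0\<close>. Null letters are needed
because \<open>deg (d x) = deg x - 1\<close> is truncated: for a letter of degree \<open>0\<close> the degree, and with it the
signs, would be wrong, but then \<open>d x\<close> is null and the functions of interest vanish on it.\<close>

locale graded_derivation = graded_monoid mul u deg
  for mul :: "'l \<Rightarrow> 'l \<Rightarrow> 'l" (infixl "\<star>" 70) and u :: 'l and deg :: "'l \<Rightarrow> nat" +
  fixes d :: "'l \<Rightarrow> 'l" and good null :: "'l \<Rightarrow> bool"
  assumes good_mul: "good x \<Longrightarrow> good y \<Longrightarrow> good (x \<star> y)"
    and good_unit: "good u"
    and good_d: "good x \<Longrightarrow> good (d x)"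
    and null_mul: "null x \<or> null y \<Longrightarrow> null (x \<star> y)"
    and null_d: "null x \<Longrightarrow> null (d x)"
    and null_d_unit: "null (d u)"
    and null_d_0: "good x \<Longrightarrow> deg x = 0 \<Longrightarrow> null (d x)"
    and null_d_d: "null (d (d x))"
    and deg_d: "deg (d x) = deg x - 1"
begin

fun word_diff :: "('l list \<Rightarrow> 'k::comm_ring_1) \<Rightarrow> 'l list \<Rightarrow> 'k"
  where "word_diff g [] = 0"
  | "word_diff g (x # w) = g (d x # w) + (-1) ^ deg x * word_diff (\<lambda>v. g (x # v)) w"

definition good_word :: "'l list \<Rightarrow> bool" where "good_word w \<longleftrightarrow> (\<forall>x\<in>set w. good x)"

definition kills_null :: "('l list \<Rightarrow> 'k::comm_ring_1) \<Rightarrow> bool"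
  where "kills_null g \<longleftrightarrow> (\<forall>w. (\<exists>x\<in>set w. null x) \<longrightarrow> g w = 0)"

text \<open>A condition on \<open>g\<close>, not on the letters: letters have no sum, so the Leibniz rule can only be expressed
through the values of functions that are additive in each letter.\<close>

definition leibniz :: "('l list \<Rightarrow> 'k::comm_ring_1) \<Rightarrow> bool"
  where "leibniz g \<longleftrightarrow> (\<forall>us x y vs. good_word us \<and> good x \<and> good y \<and> good_word vs \<longrightarrow>
    g (us @ d (x \<star> y) # vs) = g (us @ (d x \<star> y) # vs) + (-1) ^ deg x * g (us @ (x \<star> d y) # vs))"

lemma good_word_simps [simp]: "good_word []" "good_word (x # w) \<longleftrightarrow> good x \<and> good_word w" "good_word (v @ w) \<longleftrightarrow> good_word v \<and> good_word w"
  by (auto simp: good_word_def)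

lemma kills_nullD: "kills_null g \<Longrightarrow> null x \<Longrightarrow> g (us @ x # vs) = 0" "kills_null g \<Longrightarrow> null x \<Longrightarrow> g (x # vs) = 0"
  by (auto simp: kills_null_def)

lemma kills_null_Cons: "kills_null g \<Longrightarrow> kills_null (\<lambda>v. g (x # v))"
  by (auto simp: kills_null_def)

lemma leibnizD: "leibniz g \<Longrightarrow> good x \<Longrightarrow> good y \<Longrightarrow> good_word vs \<Longrightarrow>
    g (d (x \<star> y) # vs) = g ((d x \<star> y) # vs) + (-1) ^ deg x * g ((x \<star> d y) # vs)"
  unfolding leibniz_def by (metis append_Nil good_word_simps(1))

lemma leibniz_Cons: "leibniz g \<Longrightarrow> good x \<Longrightarrow> leibniz (\<lambda>v. g (x # v))"
  unfolding leibniz_def by (metis append_Cons good_word_simps(2))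

lemma word_diff_closed: "word_diff g w = (\<Sum>i<length w. (-1) ^ wdeg (take i w) * g (w[i := d (w ! i)]))"
proof (induction w arbitrary: g)
  case (Cons x w)
  show ?case
    by (simp add: Cons.IH sum.lessThan_Suc_shift power_add sum_distrib_left mult.assoc
        del: sum.lessThan_Suc)
qed simp

lemma word_diff_cong: "(\<And>v. length v = length w \<Longrightarrow> g v = h v) \<Longrightarrow> word_diff g w = word_diff h w"
  by (simp add: word_diff_closed)

lemma word_diff_add: "word_diff (\<lambda>w. g w + h w) = (\<lambda>w. word_diff g w + word_diff h w)"
  and word_diff_diff: "word_diff (\<lambda>w. g w - h w) = (\<lambda>w. word_diff g w - word_diff h w)"
  and word_diff_scale: "word_diff (\<lambda>w. c * g w) = (\<lambda>w. c * word_diff g w)"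
  and word_diff_uminus: "word_diff (\<lambda>w. - g w) = (\<lambda>w. - word_diff g w)"
  and word_diff_zero: "word_diff (\<lambda>w. 0) = (\<lambda>w. 0)"
  unfolding word_diff_closed[abs_def]
  by (simp_all add: sum.distrib sum_subtractf sum_distrib_left sum_negf algebra_simps)

lemma word_diff_sum: "word_diff (\<lambda>w. \<Sum>j\<in>J. g j w) = (\<lambda>w. \<Sum>j\<in>J. word_diff (g j) w)"
  by (induction J rule: infinite_finite_induct) (simp_all add: word_diff_add word_diff_zero)

lemma word_diff_append:
  "word_diff g (v @ w) = word_diff (\<lambda>v'. g (v' @ w)) v + (-1) ^ wdeg v * word_diff (\<lambda>w'. g (v @ w')) w"
  by (induction v arbitrary: g) (simp_all add: algebra_simps power_add)

text \<open>The operators preserve good words, and they are homogeneous for length and degree. With \<open>h = 0\<close> these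
congruences also determine the support of the result.\<close>

lemma face_gcong:
  "(\<And>v. good_word v \<Longrightarrow> length v + 1 = length w \<Longrightarrow> wdeg v = wdeg w \<Longrightarrow> g v = h v) \<Longrightarrow> good_word w
    \<Longrightarrow> face i g w = face i h w"
proof (induction i g w arbitrary: h rule: face.induct)
  case (2 i g x w)
  have "face i (\<lambda>v. g (x # v)) w = face i (\<lambda>v. h (x # v)) w"
    by (rule "2.IH") (use "2.prems" in auto)
  then show ?case by simp
qed (simp_all add: good_mul deg_mul)

lemma good_word_rot: "good_word w \<Longrightarrow> w \<noteq> [] \<Longrightarrow> good_word (last w # butlast w)"
  unfolding good_word_def by (auto dest: in_set_butlastD)

lemma wdeg_rot: "w \<noteq> [] \<Longrightarrow> deg (last w) + wdeg (butlast w) = wdeg w"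
  by (cases w rule: rev_cases) auto

lemma tau_gcong:
  "(\<And>v. good_word v \<Longrightarrow> length v = length w \<Longrightarrow> wdeg v = wdeg w \<Longrightarrow> g v = h v) \<Longrightarrow> good_word w \<Longrightarrow> tau g w = tau h w"
  using good_word_rot[of w] wdeg_rot[of w] by (simp add: tau_def)

lemma tau_pow_gcong:
  "(\<And>v. good_word v \<Longrightarrow> length v = length w \<Longrightarrow> wdeg v = wdeg w \<Longrightarrow> g v = h v) \<Longrightarrow> good_word w
    \<Longrightarrow> (tau ^^ k) g w = (tau ^^ k) h w"
proof (induction k arbitrary: w)
  case (Suc k)
  show ?case using Suc by (simp, intro tau_gcong) auto
qed simp

lemma cyclic_norm_gcong:
  "(\<And>v. good_word v \<Longrightarrow> length v = length w \<Longrightarrow> wdeg v = wdeg w \<Longrightarrow> g v = h v) \<Longrightarrow> good_word w \<Longrightarrow> cyclic_norm g w = cyclic_norm h w"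
  unfolding cyclic_norm_def by (intro sum.cong tau_pow_gcong) auto

lemma unit_op_gcong:
  "(\<And>v. good_word v \<Longrightarrow> length v = length w + 1 \<Longrightarrow> wdeg v = wdeg w \<Longrightarrow> g v = h v) \<Longrightarrow> good_word w \<Longrightarrow> unit_op g w = unit_op h w"
  by (simp add: unit_op_def good_unit deg_unit)

lemma connes_gcong:
  "(\<And>v. good_word v \<Longrightarrow> length v = length w + 1 \<Longrightarrow> wdeg v = wdeg w \<Longrightarrow> g v = h v) \<Longrightarrow> good_word w \<Longrightarrow> connes g w = connes h w"
  unfolding connes_def
  by (intro cyclic_norm_gcong unit_op_gcong arg_cong2[where f = "(-)"] tau_gcong) auto

lemma hoch_gcong:
  "(\<And>v. good_word v \<Longrightarrow> length v + 1 = length w \<Longrightarrow> wdeg v = wdeg w \<Longrightarrow> g v = h v) \<Longrightarrow> good_word w \<Longrightarrow> hoch g w = hoch h w"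
  unfolding hoch_def bprime_def
  by (intro arg_cong2[where f = "(+)"] sum.cong tau_gcong face_gcong refl) auto

lemma word_diff_gcong: "(\<And>v. good_word v \<Longrightarrow> length v = length w \<Longrightarrow> g v = h v) \<Longrightarrow> good_word w \<Longrightarrow> word_diff g w = word_diff h w"
proof (induction w arbitrary: g h)
  case (Cons x w)
  have "word_diff (\<lambda>v. g (x # v)) w = word_diff (\<lambda>v. h (x # v)) w" using Cons.prems by (intro Cons.IH) auto
  then show ?case using Cons.prems by (simp add: good_d)
qed simp

lemma kills_null_face: "kills_null g \<Longrightarrow> kills_null (face i g)"
proof -
  have "kills_null g \<Longrightarrow> \<exists>x\<in>set w. null x \<Longrightarrow> face i g w = 0" for w
  proof (induction i g w rule: face.induct)
    case (1 g x y w)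
    then have "\<exists>z\<in>set (x \<star> y # w). null z" using null_mul by auto
    then have "g (x \<star> y # w) = 0" using 1(1) unfolding kills_null_def by blast
    then show ?case by simp
  next
    case (2 i g x w)
    show ?case
    proof (cases "null x")
      case True
      then have "(\<lambda>v. g (x # v)) = (\<lambda>v. 0)" using kills_nullD(2)[OF 2(2)] by (intro ext) simp
      then show ?thesis by (simp add: face_zero)
    next
      case False
      then show ?thesis using 2(1)[OF kills_null_Cons[OF 2(2)]] 2(3) by simp
    qed
  qed simp_all
  then show "kills_null g \<Longrightarrow> kills_null (face i g)" by (auto simp: kills_null_def)
qed

lemma kills_null_tau: "kills_null g \<Longrightarrow> kills_null (tau g)"
  unfolding kills_null_def
proof (intro allI impI)
  fix w assume g: "\<forall>w. (\<exists>x\<in>set w. null x) \<longrightarrow> g w = 0" and w: "\<exists>x\<in>set w. null x"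
  then have "set (last w # butlast w) = set w" by (cases w rule: rev_cases) auto
  then have "g (last w # butlast w) = 0" using g w by blast
  then show "tau g w = 0" using w by (auto simp: tau_def)
qed

lemma kills_null_tau_pow: "kills_null g \<Longrightarrow> kills_null ((tau ^^ k) g)"
  by (induction k) (simp_all add: kills_null_tau)

lemma kills_null_unit_op: "kills_null g \<Longrightarrow> kills_null (unit_op g)"
  by (auto simp: kills_null_def unit_op_def)

lemma kills_null_diff: "kills_null g \<Longrightarrow> kills_null h \<Longrightarrow> kills_null (\<lambda>w. g w - h w)"
  by (auto simp: kills_null_def)

lemma kills_null_word_diff: "kills_null g \<Longrightarrow> kills_null (word_diff g)"
proof -
  have "\<exists>x\<in>set w. null x \<Longrightarrow> kills_null g \<Longrightarrow> word_diff g w = 0" for w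
  proof (induction w arbitrary: g)
    case (Cons x w)
    show ?case
    proof (cases "null x")
      case True
      then have "(\<lambda>v. g (x # v)) = (\<lambda>v. 0)" using kills_nullD(2)[OF Cons.prems(2)] by (intro ext) simp
      then show ?thesis using kills_nullD(2)[OF Cons.prems(2) null_d[OF True]] by (simp add: word_diff_zero)
    next
      case False
      then have w: "\<exists>x\<in>set w. null x" using Cons.prems(1) by auto
      then show ?thesis using Cons.IH[OF w kills_null_Cons[OF Cons.prems(2)]] Cons.prems(2)
        by (auto simp: kills_null_def)
    qed
  qed simp
  then show "kills_null g \<Longrightarrow> kills_null (word_diff g)" by (auto simp: kills_null_def)
qed

text \<open>The differential lowers the degree by one, which changes the sign \<open>(-1) ^ (c * wdeg v)\<close> by \<open>(-1) ^ c\<close>. This is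
used for the Koszul sign of a rotation, with \<open>c\<close> the degree of the rotated letter, and for the
sign in \<open>delta\<close>, with \<open>c = 1\<close>.\<close>

lemma word_diff_sign:
  "kills_null g \<Longrightarrow> good_word w \<Longrightarrow> word_diff (\<lambda>v. (-1) ^ (length v + c * wdeg v) * g v) w
    = (-1) ^ (length w + c * wdeg w + c) * word_diff g w"
proof (induction w arbitrary: g)
  case (Cons x w)
  let ?e = "(-1) ^ (1 + c * deg x)"
  have 1: "(-1) ^ (length (d x # w) + c * wdeg (d x # w)) * g (d x # w)
      = (-1) ^ (length (x # w) + c * wdeg (x # w) + c) * g (d x # w)"
  proof (cases "deg x")
    case 0
    then have "g (d x # w) = 0" using Cons.prems(2) by (intro kills_nullD(2)[OF Cons.prems(1)] null_d_0) auto
    then show ?thesis by simp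
  next
    case (Suc m)
    then show ?thesis by (simp add: deg_d algebra_simps power_add)
  qed
  have "(\<lambda>v. (-1) ^ (length (x # v) + c * wdeg (x # v)) * g (x # v))
      = (\<lambda>v. ?e * ((-1) ^ (length v + c * wdeg v) * g (x # v)))"
    by (simp add: power_add algebra_simps)
  then have 2: "word_diff (\<lambda>v. (-1) ^ (length (x # v) + c * wdeg (x # v)) * g (x # v)) w
      = ?e * ((-1) ^ (length w + c * wdeg w + c) * word_diff (\<lambda>v. g (x # v)) w)"
    using Cons.IH[OF kills_null_Cons[OF Cons.prems(1)]] Cons.prems(2) by (simp only: word_diff_scale) simp
  show ?case
    unfolding word_diff.simps 1 2 by (simp add: algebra_simps power_add)
qed simp

text \<open>Besides \<open>word_diff_sign\<close> for the unrotated letters, this needs that the degree of the rotated letter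
\<open>z\<close> drops by one in \<open>d z\<close>, which compensates the sign of passing \<open>d\<close> over the other letters.\<close>

lemma word_diff_tau: "kills_null g \<Longrightarrow> good_word w \<Longrightarrow> word_diff (tau g) w = tau (word_diff g) w"
proof (cases w rule: rev_cases)
  case (snoc v z)
  assume g: "kills_null g" and w: "good_word w"
  have z: "(-1) ^ wdeg v * tau g (v @ [d z]) = (-1) ^ (length v + deg z * wdeg v) * g (d z # v)"
  proof (cases "deg z")
    case 0
    then have "g (d z # v) = 0" using w snoc by (intro kills_nullD(2)[OF g] null_d_0) auto
    then show ?thesis by (simp add: tau_snoc)
  next
    case (Suc m)
    have "(-1) ^ wdeg v * tau g (v @ [d z]) = (-1) ^ (wdeg v + (length v + m * wdeg v)) * g (d z # v)"
      by (simp add: tau_snoc deg_d Suc power_add)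
    then show ?thesis by (simp add: Suc ac_simps)
  qed
  have "word_diff (\<lambda>v'. tau g (v' @ [z])) v = word_diff (\<lambda>v'. (-1) ^ (length v' + deg z * wdeg v') * g (z # v')) v"
    by (simp add: tau_snoc)
  also have "\<dots> = (-1) ^ (length v + deg z * wdeg v + deg z) * word_diff (\<lambda>v. g (z # v)) v"
    using w snoc by (intro word_diff_sign kills_null_Cons g) simp
  finally have "word_diff (tau g) w = (-1) ^ (length v + deg z * wdeg v) * g (d z # v)
      + (-1) ^ (length v + deg z * wdeg v + deg z) * word_diff (\<lambda>v. g (z # v)) v"
    unfolding snoc word_diff_append using z by simp
  also have "\<dots> = tau (word_diff g) w"
    unfolding snoc tau_snoc by (simp add: algebra_simps power_add)
  finally show ?thesis .
qed simp

lemma word_diff_tau_pow: "kills_null g \<Longrightarrow> good_word w \<Longrightarrow> word_diff ((tau ^^ k) g) w = (tau ^^ k) (word_diff g) w"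
proof (induction k arbitrary: w)
  case (Suc k)
  have "word_diff ((tau ^^ Suc k) g) w = tau (word_diff ((tau ^^ k) g)) w"
    using Suc.prems by (simp add: word_diff_tau kills_null_tau_pow)
  also have "\<dots> = tau ((tau ^^ k) (word_diff g)) w"
    using Suc by (intro tau_gcong) auto
  finally show ?case by simp
qed simp

lemma word_diff_cyclic_norm: "kills_null g \<Longrightarrow> good_word w \<Longrightarrow> word_diff (cyclic_norm g) w = cyclic_norm (word_diff g) w"
proof -
  assume g: "kills_null g" and w: "good_word w"
  have "word_diff (cyclic_norm g) w = word_diff (\<lambda>v. \<Sum>i<length w. (tau ^^ i) g v) w"
    by (rule word_diff_cong) (simp add: cyclic_norm_def)
  then show ?thesis using g w by (simp add: word_diff_sum word_diff_tau_pow cyclic_norm_def)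
qed

lemma word_diff_unit_op: "kills_null g \<Longrightarrow> word_diff (unit_op g) w = unit_op (word_diff g) w"
proof -
  assume g: "kills_null g"
  have "word_diff (unit_op g) w = word_diff (\<lambda>v. (-1) ^ (length w - 1) * g (v @ [u])) w"
    by (rule word_diff_cong) (simp add: unit_op_def)
  also have "\<dots> = (-1) ^ (length w - 1) * word_diff g (w @ [u])"
    using kills_nullD(1)[OF g null_d_unit, of w "[]"] by (simp add: word_diff_scale word_diff_append)
  finally show ?thesis by (simp add: unit_op_def)
qed

lemma word_diff_connes: "kills_null g \<Longrightarrow> good_word w \<Longrightarrow> word_diff (connes g) w = connes (word_diff g) w"
proof -
  assume g: "kills_null g" and w: "good_word w"
  let ?h = "\<lambda>v. g v - tau g v"
  have h: "kills_null ?h" using kills_null_diff[OF g kills_null_tau[OF g]] .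
  have "word_diff (connes g) w = cyclic_norm (unit_op (word_diff ?h)) w"
    unfolding connes_def using word_diff_cyclic_norm[OF kills_null_unit_op[OF h] w] word_diff_unit_op[OF h] by presburger
  also have "\<dots> = connes (word_diff g) w"
    unfolding connes_def by (intro cyclic_norm_gcong unit_op_gcong w) (simp_all add: word_diff_diff word_diff_tau[OF g])
  finally show ?thesis .
qed

lemma word_diff_face: "leibniz g \<Longrightarrow> good_word w \<Longrightarrow> word_diff (face i g) w = face i (word_diff g) w"
proof (induction i g w rule: face.induct)
  case (1 g x y w)
  then show ?case using leibnizD[OF 1(1), of x y w] by (simp add: deg_mul power_add algebra_simps)
next
  case (2 i g x w)
  then show ?case using 2(1) leibniz_Cons[OF 2(2)] by (simp add: face_lin word_diff_uminus algebra_simps)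
next
  case ("3_1" g)
  then show ?case by simp
next
  case ("3_2" g x)
  then show ?case by simp
next
  case ("3_3" i g)
  then show ?case by simp
qed

lemma word_diff_hoch: "kills_null g \<Longrightarrow> leibniz g \<Longrightarrow> good_word w \<Longrightarrow> word_diff (hoch g) w = hoch (word_diff g) w"
proof -
  assume g: "kills_null g" "leibniz g" and w: "good_word w"
  have "word_diff (bprime g) w = word_diff (\<lambda>v. \<Sum>i<length w - 1. face i g v) w"
    by (rule word_diff_cong) (simp add: bprime_def)
  then have 1: "word_diff (bprime g) w = bprime (word_diff g) w" using g w by (simp add: word_diff_sum word_diff_face bprime_def)
  have "word_diff (tau (face 0 g)) w = tau (word_diff (face 0 g)) w" by (rule word_diff_tau[OF kills_null_face[OF g(1)] w])
  also have "\<dots> = tau (face 0 (word_diff g)) w" using g w by (intro tau_gcong word_diff_face) auto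
  finally show ?thesis using 1 by (simp add: hoch_def[abs_def] word_diff_add)
qed

lemma word_diff_word_diff: "kills_null g \<Longrightarrow> good_word w \<Longrightarrow> word_diff (word_diff g) w = 0"
proof (induction w arbitrary: g)
  case (Cons x w)
  have dd: "g (d (d x) # w) = 0" using kills_nullD(2)[OF Cons.prems(1) null_d_d] .
  have s: "(-1) ^ deg (d x) * word_diff (\<lambda>v. g (d x # v)) w + (-1) ^ deg x * word_diff (\<lambda>v. g (d x # v)) w = 0"
  proof (cases "deg x")
    case 0
    then have "(\<lambda>v. g (d x # v)) = (\<lambda>v. 0)"
      using Cons.prems(2) by (intro ext kills_nullD(2)[OF Cons.prems(1)] null_d_0) auto
    then show ?thesis by (simp add: word_diff_zero)
  qed (simp add: deg_d)
  have "word_diff (word_diff (\<lambda>v. g (x # v))) w = 0" using Cons.IH[OF kills_null_Cons[OF Cons.prems(1)]] Cons.prems(2) by simp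
  then show ?case using dd s by (simp add: word_diff_add word_diff_scale algebra_simps)
qed simp

lemma word_diff_vanishes:
  "kills_null g \<Longrightarrow> good_word w \<Longrightarrow> (\<And>v. length v = length w \<Longrightarrow> wdeg v + 1 = wdeg w \<Longrightarrow> g v = 0) \<Longrightarrow> word_diff g w = 0"
proof (induction w arbitrary: g)
  case (Cons x w)
  have "g (d x # w) = 0"
  proof (cases "deg x = 0")
    case True
    then show ?thesis using Cons.prems(2) by (intro kills_nullD(2)[OF Cons.prems(1)] null_d_0) auto
  next
    case False
    then show ?thesis using Cons.prems(3)[of "d x # w"] by (simp add: deg_d)
  qed
  moreover have "word_diff (\<lambda>v. g (x # v)) w = 0"
    using Cons.prems by (intro Cons.IH kills_null_Cons) auto
  ultimately show ?case by simp
qed simp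

text \<open>On words of length \<open>n + 1\<close> and degree \<open>m + 1\<close> the sign is \<open>(-1)\<^sup>n (-1)\<^sup>m\<close>. This is the sign of
\<open>(-1)\<^sup>q\<^sup>-\<^sup>p \<delta>\<close> in the tricomplex, \<open>(-1)\<^sup>m\<close> being part of the definition of \<open>\<delta>\<close>.\<close>

definition delta :: "('l list \<Rightarrow> 'k::comm_ring_1) \<Rightarrow> 'l list \<Rightarrow> 'k"
  where "delta g w = (-1) ^ (length w + wdeg w) * word_diff g w"

definition twist :: "('l list \<Rightarrow> 'k::comm_ring_1) \<Rightarrow> 'l list \<Rightarrow> 'k"
  where "twist g w = (-1) ^ (length w + wdeg w) * g w"

lemma delta_twist: "delta g = twist (word_diff g)"
  by (simp add: delta_def twist_def fun_eq_iff)

lemma delta_add: "delta (\<lambda>w. g w + h w) = (\<lambda>w. delta g w + delta h w)"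
  and delta_scale: "delta (\<lambda>w. c * g w) = (\<lambda>w. c * delta g w)"
  unfolding delta_def by (simp_all add: word_diff_add word_diff_scale algebra_simps)

text \<open>Operators that change the length by one and preserve the degree anticommute with \<open>twist\<close>; those that
preserve both commute with it. Since the untwisted differential commutes with all of them, \<open>delta\<close>
anticommutes with \<open>b\<close> and \<open>B\<close>.\<close>

lemma face_twist: "face i (twist g) w = - twist (face i g) w"
proof (cases "Suc i < length w")
  case True
  then obtain us x y vs where w: "w = us @ x # y # vs" "length us = i"
    by (elim split_at[rotated]) simp
  show ?thesis
    unfolding w(1) twist_def
    by (simp add: face_append[OF w(2)[symmetric]] deg_mul ac_simps)
next
  case False
  then show ?thesis by (simp add: face_beyond twist_def)
qed

lemma tau_twist: "tau (twist g) w = twist (tau g) w"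
  by (cases w rule: rev_cases) (simp_all add: twist_def tau_snoc ac_simps)

lemma tau_pow_twist: "(tau ^^ k) (twist g) = twist ((tau ^^ k) g)"
  by (induction k) (simp_all add: tau_twist[abs_def])

lemma hoch_twist: "hoch (twist g) w = - twist (hoch g) w"
proof -
  have "tau (face 0 (twist g)) w = tau (\<lambda>v. - twist (face 0 g) v) w"
    by (rule tau_cong) (rule face_twist)
  also have "\<dots> = - twist (tau (face 0 g)) w" by (simp add: tau_lin tau_twist)
  finally show ?thesis
    by (simp add: hoch_def bprime_def face_twist twist_def sum_negf sum_distrib_left algebra_simps)
qed

lemma cyclic_norm_twist: "cyclic_norm (twist g) w = twist (cyclic_norm g) w"
  by (simp add: cyclic_norm_def tau_pow_twist twist_def sum_distrib_left)

lemma unit_op_twist: "unit_op (twist g) w = - twist (unit_op g) w"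
  by (simp add: unit_op_def twist_def deg_unit ac_simps)

lemma connes_twist: "connes (twist g) w = - twist (connes g) w"
proof -
  have "(\<lambda>v. twist g v - tau (twist g) v) = twist (\<lambda>v. g v - tau g v)"
    by (simp add: tau_twist fun_eq_iff) (simp add: twist_def algebra_simps)
  moreover have "cyclic_norm (\<lambda>v. - twist (unit_op h) v) w = - twist (cyclic_norm (unit_op h)) w" for h :: "'l list \<Rightarrow> 'a"
    using cyclic_norm_scale[of "-1" "twist (unit_op h)"] cyclic_norm_twist[of "unit_op h" w] by simp
  ultimately show ?thesis by (simp add: connes_def unit_op_twist[abs_def])
qed

lemma hoch_delta: "kills_null g \<Longrightarrow> leibniz g \<Longrightarrow> good_word w \<Longrightarrow> hoch (delta g) w + delta (hoch g) w = 0"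
  by (simp add: delta_twist hoch_twist) (simp add: twist_def word_diff_hoch)

lemma connes_delta: "kills_null g \<Longrightarrow> good_word w \<Longrightarrow> connes (delta g) w + delta (connes g) w = 0"
  by (simp add: delta_twist connes_twist) (simp add: twist_def word_diff_connes)

lemma delta_delta: "kills_null g \<Longrightarrow> good_word w \<Longrightarrow> delta (delta g) w = 0"
proof -
  assume g: "kills_null g" and w: "good_word w"
  have "word_diff (delta g) w = (-1) ^ (length w + wdeg w + 1) * word_diff (word_diff g) w"
    using word_diff_sign[OF kills_null_word_diff[OF g] w, of 1] by (simp add: delta_def[abs_def])
  then show ?thesis using word_diff_word_diff[OF g w] by (simp add: delta_def)
qed

end

section \<open>Tensor powers and their functionals\<close>

lemma lookup_pm_scale [simp]: "Poly_Mapping.lookup (pm_scale c f) x = c * Poly_Mapping.lookup f x"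
  unfolding pm_scale_def by (simp add: Poly_Mapping.map.rep_eq when_def)

interpretation pm: linear_quotients "pm_scale :: 'k::field \<Rightarrow> ('x \<Rightarrow>\<^sub>0 'k) \<Rightarrow> ('x \<Rightarrow>\<^sub>0 'k)"
  by unfold_locales (rule poly_mapping_eqI, simp add: lookup_add algebra_simps)+


definition lin_ext :: "('k::field \<Rightarrow> 'v \<Rightarrow> 'v::ab_group_add) \<Rightarrow> ('x \<Rightarrow> 'v) \<Rightarrow> ('x \<Rightarrow>\<^sub>0 'k) \<Rightarrow> 'v"
  where "lin_ext s H f = (\<Sum>x\<in>Poly_Mapping.keys f. s (Poly_Mapping.lookup f x) (H x))"

lemma lin_ext_superset:
  assumes "vector_space s" "finite A" "Poly_Mapping.keys f \<subseteq> A"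
  shows "lin_ext s H f = (\<Sum>x\<in>A. s (Poly_Mapping.lookup f x) (H x))"
proof -
  interpret vector_space s by fact
  show ?thesis
    unfolding lin_ext_def using assms by (intro sum.mono_neutral_left) (auto simp: in_keys_iff)
qed

lemma lin_ext_add:
  assumes "vector_space s"
  shows "lin_ext s H (f + g) = lin_ext s H f + lin_ext s H g"
proof -
  interpret vector_space s by fact
  let ?A = "Poly_Mapping.keys f \<union> Poly_Mapping.keys g"
  have "Poly_Mapping.keys (f + g) \<subseteq> ?A" by (rule keys_add)
  then show ?thesis
    by (simp add: lin_ext_superset[OF assms, of ?A] lookup_add scale_left_distrib sum.distrib)
qed

lemma lin_ext_scale:
  assumes "vector_space s"
  shows "lin_ext s H (pm_scale c f) = s c (lin_ext s H f)"
proof -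
  interpret vector_space s by fact
  have "Poly_Mapping.keys (pm_scale c f) \<subseteq> Poly_Mapping.keys f" by (auto simp: in_keys_iff)
  then show ?thesis
    by (simp add: lin_ext_superset[OF assms, of "Poly_Mapping.keys f"] scale_sum_right)
qed

lemma lin_ext_diff:
  assumes "vector_space s"
  shows "lin_ext s H (f - g) = lin_ext s H f - lin_ext s H g"
  using lin_ext_add[OF assms, of H "f - g" g] by simp

lemma lin_ext_single:
  assumes "vector_space s"
  shows "lin_ext s H (Poly_Mapping.single x 1) = H x"
proof -
  interpret vector_space s by fact
  show ?thesis by (simp add: lin_ext_def)
qed

lemma vector_space_mult: "vector_space ((*) :: 'k::field \<Rightarrow> 'k \<Rightarrow> 'k)"
  by unfold_locales (auto simp: algebra_simps)

lemma (in linear_quotients) presents_finsum: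
  assumes P: "presents M Z B \<pi>" and "\<And>i. i \<in> A \<Longrightarrow> f i \<in> Z"
  shows "finsum M (\<lambda>i. \<pi> (f i)) A = \<pi> (\<Sum>i\<in>A. f i)"
proof -
  interpret M: Module.module "ring_of_type_algebra :: 'k ring" M by (rule presents_module[OF P])
  note PD = presentsD[OF P]
  show ?thesis
    using assms(2)
  proof (induction A rule: infinite_finite_induct)
    case (insert a A)
    have "(\<Sum>i\<in>A. f i) \<in> Z" using insert.prems by (intro subspace_sum[OF PD(1)]) auto
    moreover have "finsum M (\<lambda>i. \<pi> (f i)) (insert a A) = \<pi> (f a) \<oplus>\<^bsub>M\<^esub> finsum M (\<lambda>i. \<pi> (f i)) A"
      using insert PD(8) by (intro M.finsum_insert) auto
    ultimately show ?case using insert PD(5) by simp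
  qed (simp_all add: presents_zero[OF P] M.finsum_infinite)
qed

context dga
begin

abbreviation gen :: "'a list \<Rightarrow> ('a list \<Rightarrow>\<^sub>0 'k)" where "gen xs \<equiv> Poly_Mapping.single xs 1"

definition free_part :: "nat \<Rightarrow> ('a list \<Rightarrow>\<^sub>0 'k) set"
  where "free_part n = {f. \<forall>xs\<in>Poly_Mapping.keys f. length xs = n}"

definition cls :: "nat \<Rightarrow> ('a list \<Rightarrow>\<^sub>0 'k) \<Rightarrow> ('a list \<Rightarrow>\<^sub>0 'k) set"
  where "cls n f = tensor_relations n +>\<^bsub>free_words n\<^esub> f"

lemma tensor_cls: "tensor xs = cls (length xs) (gen xs)"
  by (simp add: tensor_def cls_def)

lemma subspace_free_part: "pm.subspace (free_part n)"
  unfolding pm.subspace_def free_part_def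
proof (intro conjI ballI allI)
  fix f g :: "'a list \<Rightarrow>\<^sub>0 'k"
  assume "f \<in> {f. \<forall>xs\<in>Poly_Mapping.keys f. length xs = n}"
    and "g \<in> {f. \<forall>xs\<in>Poly_Mapping.keys f. length xs = n}"
  then show "f + g \<in> {f. \<forall>xs\<in>Poly_Mapping.keys f. length xs = n}"
    using Poly_Mapping.keys_add[of f g] by blast
qed (auto simp: in_keys_iff)

lemma gen_free_part: "length xs = n \<Longrightarrow> gen xs \<in> free_part n"
  by (simp add: free_part_def)

lemma subspace_relations: "pm.subspace (tensor_relations n)"
  unfolding tensor_relations_def by (rule pm.subspace_span)

lemma relation_add: "length us + 1 + length vs = n \<Longrightarrow>
    gen (us @ (x + y) # vs) - gen (us @ x # vs) - gen (us @ y # vs) \<in> tensor_relations n"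
  unfolding tensor_relations_def by (rule pm.span_base) blast

lemma relation_scale: "length us + 1 + length vs = n \<Longrightarrow>
    gen (us @ scale c x # vs) - pm_scale c (gen (us @ x # vs)) \<in> tensor_relations n"
  unfolding tensor_relations_def by (rule pm.span_base) blast

lemma relations_induct:
  assumes "r \<in> tensor_relations n" "pm.subspace {r. P r}"
    and "\<And>us vs x y. length us + 1 + length vs = n \<Longrightarrow>
      P (gen (us @ (x + y) # vs) - gen (us @ x # vs) - gen (us @ y # vs))"
    and "\<And>us vs c x. length us + 1 + length vs = n \<Longrightarrow>
      P (gen (us @ scale c x # vs) - pm_scale c (gen (us @ x # vs)))"
  shows "P r"
  using assms(1)[unfolded tensor_relations_def] assms(2)
  by (rule pm.span_induct) (use assms(3,4) in blast)

lemma relations_free_part: "tensor_relations n \<subseteq> free_part n"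
proof
  fix r assume "r \<in> tensor_relations n"
  then show "r \<in> free_part n"
    by (rule relations_induct)
      (auto intro!: pm.subspace_diff[OF subspace_free_part] pm.subspace_scale[OF subspace_free_part] gen_free_part
        simp: subspace_free_part)
qed

lemma presents_tensor_power: "pm.presents (tensor_power n) (free_part n) (tensor_relations n) (cls n)"
proof -
  have free: "pm.presents (free_words n) (free_part n) {0} (\<lambda>f. f)"
    unfolding pm.presents_def
  proof (intro conjI ballI allI)
    show "pm.subspace (free_part n)" by (rule subspace_free_part)
    show "{0} \<subseteq> free_part n" using pm.subspace_0[OF subspace_free_part] by simp
    show "pm.subspace {0}" by (rule pm.subspace_single_0)
  qed (simp_all add: free_words_def free_part_def)
  have c: "(free_words n)\<lparr>carrier := (\<lambda>f. f) ` free_part n\<rparr> = free_words n"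
    by (simp add: free_words_def free_part_def)
  have z: "{0} \<subseteq> tensor_relations n" using pm.subspace_0[OF subspace_relations] by simp
  have "cls n = (\<lambda>z. (\<lambda>f. f) ` tensor_relations n +>\<^bsub>free_words n\<^esub> z)"
    by (simp add: cls_def fun_eq_iff)
  moreover have "tensor_power n
      = quot_module ((free_words n)\<lparr>carrier := (\<lambda>f. f) ` free_part n\<rparr>) ((\<lambda>f. f) ` tensor_relations n)"
    unfolding c by (simp add: tensor_power_def)
  ultimately show ?thesis
    using pm.presents_quot_module[OF free subspace_free_part order_refl subspace_relations z relations_free_part]
    by (simp only:)
qed

lemmas cls_simps = pm.presentsD[OF presents_tensor_power]

lemma cls_eq_iff: "f \<in> free_part n \<Longrightarrow> f' \<in> free_part n \<Longrightarrow> cls n f = cls n f' \<longleftrightarrow> f - f' \<in> tensor_relations n"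
  using pm.presents_eq_iff[OF presents_tensor_power] .

abbreviation good :: "nat \<times> 'a \<Rightarrow> bool" where "good z \<equiv> snd z \<in> G (fst z)"

lemma phi_add: "phi (x + y) = phi x + phi y" and phi_scale: "phi (scale c x) = scale c (phi x)"
  using phi_linear by (auto simp: Vector_Spaces.linear_iff)

lemma phi_0: "phi 0 = 0"
  using phi_scale[of 0 0] by simp

lemma phi_e: "phi e = 0"
  using phi_graded_0[OF unit_graded] .

lemma G_0 [simp]: "0 \<in> G m" and G_add: "x \<in> G m \<Longrightarrow> y \<in> G m \<Longrightarrow> x + y \<in> G m"
  and G_scale: "x \<in> G m \<Longrightarrow> scale c x \<in> G m"
  using graded_subspace[of m] by (auto simp: subspace_0 subspace_add subspace_scale)

lemma G_phi: "x \<in> G m \<Longrightarrow> phi x \<in> G (m - 1)"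
  using phi_graded phi_graded_0 by (cases m) auto

definition lmul :: "nat \<times> 'a \<Rightarrow> nat \<times> 'a \<Rightarrow> nat \<times> 'a"
  where "lmul z z' = (fst z + fst z', snd z * snd z')"

definition lphi :: "nat \<times> 'a \<Rightarrow> nat \<times> 'a"
  where "lphi z = (fst z - 1, phi (snd z))"

lemma lmul_simps [simp]: "fst (lmul z z') = fst z + fst z'" "snd (lmul z z') = snd z * snd z'"
    "lmul (m, x) z = (m + fst z, x * snd z)" "lmul z (m, x) = (fst z + m, snd z * x)"
  and lphi_simps [simp]: "fst (lphi z) = fst z - 1" "snd (lphi z) = phi (snd z)"
    "lphi (m, x) = (m - 1, phi x)"
  by (simp_all add: lmul_def lphi_def)

sublocale W: graded_derivation lmul "(0, e)" fst lphi good "\<lambda>z. snd z = 0"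
  by unfold_locales
    (auto simp: mult.assoc unit_right mult_graded prod_eq_iff unit_graded phi_0 phi_e G_phi[simplified] phi_phi phi_graded_0)

text \<open>The functions of words that come from cochains: supported on words of homogeneous letters, and
linear in each letter of fixed degree. Additivity and homogeneity are combined in one equation.\<close>

definition cochain_fun :: "((nat \<times> 'a) list \<Rightarrow> 'k) \<Rightarrow> bool"
  where "cochain_fun g \<longleftrightarrow> (\<forall>w. \<not> W.good_word w \<longrightarrow> g w = 0) \<and>
    (\<forall>us d x y c vs. x \<in> G d \<longrightarrow> y \<in> G d \<longrightarrow>
      g (us @ (d, scale c x + y) # vs) = c * g (us @ (d, x) # vs) + g (us @ (d, y) # vs))"

lemma cochain_funD:
  assumes "cochain_fun g"
  shows "\<not> W.good_word w \<Longrightarrow> g w = 0"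
    "x \<in> G d \<Longrightarrow> y \<in> G d \<Longrightarrow> g (us @ (d, scale c x + y) # vs) = c * g (us @ (d, x) # vs) + g (us @ (d, y) # vs)"
    "x \<in> G d \<Longrightarrow> y \<in> G d \<Longrightarrow> g ((d, scale c x + y) # vs) = c * g ((d, x) # vs) + g ((d, y) # vs)"
  using assms unfolding cochain_fun_def by (blast, blast, metis append_Nil)

lemma cochain_fun_zero_letter:
  assumes "cochain_fun g"
  shows "g (us @ (d, 0) # vs) = 0"
  using cochain_funD(2)[OF assms G_0 G_0, of us d "-1" vs] by simp

lemma cochain_fun_scale:
  assumes "cochain_fun g" "x \<in> G d"
  shows "g (us @ (d, scale c x) # vs) = c * g (us @ (d, x) # vs)"
  using cochain_funD(2)[OF assms G_0, of us c vs] cochain_fun_zero_letter[OF assms(1)] by simp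

lemma cochain_fun_Cons: "cochain_fun g \<Longrightarrow> cochain_fun (\<lambda>v. g (z # v))"
proof -
  assume g: "cochain_fun g"
  have "g ((z # us) @ (d, scale c x + y) # vs) = c * g ((z # us) @ (d, x) # vs) + g ((z # us) @ (d, y) # vs)"
    if "x \<in> G d" "y \<in> G d" for us d x y c vs
    using cochain_funD(2)[OF g that, of "z # us" c vs] .
  moreover have "\<not> W.good_word w \<Longrightarrow> g (z # w) = 0" for w using cochain_funD(1)[OF g, of "z # w"] by simp
  ultimately show ?thesis unfolding cochain_fun_def by simp
qed

lemma kills_null_cochain_fun: "cochain_fun g \<Longrightarrow> W.kills_null g"
  unfolding W.kills_null_def
proof (intro allI impI)
  fix w :: "(nat \<times> 'a) list" assume g: "cochain_fun g" and "\<exists>z\<in>set w. snd z = 0"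
  then obtain us vs d where "w = us @ (d, 0) # vs" by (metis split_list prod.collapse)
  then show "g w = 0" using cochain_fun_zero_letter[OF g] by simp
qed

definition component :: "'a \<Rightarrow> nat \<Rightarrow> 'a"
  where "component x = (THE u. (\<forall>m. u m \<in> G m) \<and> finite {m. u m \<noteq> 0} \<and> x = (\<Sum>m | u m \<noteq> 0. u m))"

lemma component: "component x m \<in> G m" "finite {m. component x m \<noteq> 0}" "(\<Sum>m | component x m \<noteq> 0. component x m) = x"
  using theI'[OF graded_direct_sum[of x]] unfolding component_def by auto

lemma component_unique:
  assumes "\<And>m. u m \<in> G m" "finite S" "\<And>m. m \<notin> S \<Longrightarrow> u m = 0" "(\<Sum>m\<in>S. u m) = x"
  shows "component x = u"
proof -
  have fin: "finite {m. u m \<noteq> 0}" using assms(2,3) by (rule_tac finite_subset[of _ S]) auto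
  have "(\<Sum>m | u m \<noteq> 0. u m) = (\<Sum>m\<in>S. u m)"
    using assms(2,3) by (intro sum.mono_neutral_left) auto
  then show ?thesis
    unfolding component_def using assms fin
    by (intro the1_equality[OF graded_direct_sum]) auto
qed

lemma component_sum:
  assumes "finite S" "{m. component x m \<noteq> 0} \<subseteq> S"
  shows "(\<Sum>m\<in>S. component x m) = x"
  using sum.mono_neutral_left[OF assms, of "component x"] component(3)[of x] by auto

lemma component_lin: "component (scale c x + y) m = scale c (component x m) + component y m"
proof -
  let ?S = "{m. component x m \<noteq> 0} \<union> {m. component y m \<noteq> 0}"
  have S: "finite ?S" using component(2) by blast
  have "component (scale c x + y) = (\<lambda>m. scale c (component x m) + component y m)"
  proof (rule component_unique[OF _ S])
    show "(\<Sum>m\<in>?S. scale c (component x m) + component y m) = scale c x + y"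
      using component_sum[OF S, of x] component_sum[OF S, of y] by (simp add: sum.distrib flip: scale_sum_right)
  qed (auto simp: G_add G_scale component(1))
  then show ?thesis by simp
qed

lemma component_G: "x \<in> G d \<Longrightarrow> component x = (\<lambda>m. if m = d then x else 0)"
  by (rule component_unique[of _ "{d}"]) auto

text \<open>The multilinear function on arbitrary lists with prescribed values on homogeneous ones: each entry is
expanded into its homogeneous components.\<close>

fun ml_extension :: "((nat \<times> 'a) list \<Rightarrow> 'k) \<Rightarrow> 'a list \<Rightarrow> 'k"
  where "ml_extension g [] = g []"
  | "ml_extension g (x # xs) = (\<Sum>m | component x m \<noteq> 0. ml_extension (\<lambda>w. g ((m, component x m) # w)) xs)"

lemma ml_extension_lin: "ml_extension (\<lambda>w. c * g w + h w) xs = c * ml_extension g xs + ml_extension h xs"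
  by (induction xs arbitrary: g h) (simp_all add: sum.distrib sum_distrib_left)

lemma ml_extension_0: "ml_extension (\<lambda>w. 0) xs = 0"
  by (induction xs) simp_all

lemma ml_extension_superset:
  assumes "cochain_fun g" "finite S" "{m. component x m \<noteq> 0} \<subseteq> S"
  shows "ml_extension g (x # xs) = (\<Sum>m\<in>S. ml_extension (\<lambda>w. g ((m, component x m) # w)) xs)"
proof -
  have "ml_extension (\<lambda>w. g ((m, component x m) # w)) xs = 0" if "component x m = 0" for m
    using cochain_fun_zero_letter[OF assms(1), of "[]"] that by (simp add: ml_extension_0)
  then show ?thesis using assms(2,3) by (simp, intro sum.mono_neutral_left) auto
qed

lemma ml_extension_multilinear:
  assumes "cochain_fun g"
  shows "ml_extension g (us @ (scale c x + y) # vs) = c * ml_extension g (us @ x # vs) + ml_extension g (us @ y # vs)"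
  using assms
proof (induction us arbitrary: g)
  case Nil
  let ?S = "{m. component x m \<noteq> 0} \<union> {m. component y m \<noteq> 0}"
  have S: "finite ?S" "{m. component (scale c x + y) m \<noteq> 0} \<subseteq> ?S" "{m. component x m \<noteq> 0} \<subseteq> ?S"
    "{m. component y m \<noteq> 0} \<subseteq> ?S"
    using component(2) by (auto simp: component_lin)
  have "(\<lambda>w. g ((m, component (scale c x + y) m) # w))
      = (\<lambda>w. c * g ((m, component x m) # w) + g ((m, component y m) # w))" for m
    using cochain_funD(3)[OF Nil component(1) component(1)] by (simp add: component_lin)
  then show ?case
    by (simp only: append_Nil ml_extension_superset[OF Nil S(1,2)] ml_extension_superset[OF Nil S(1,3)]
        ml_extension_superset[OF Nil S(1,4)] ml_extension_lin sum.distrib sum_distrib_left)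
next
  case (Cons z us)
  show ?case using Cons.IH[OF cochain_fun_Cons[OF Cons.prems]] by (simp add: sum.distrib sum_distrib_left)
qed

lemma ml_extension_homogeneous:
  assumes "cochain_fun g" "homogeneous ds xs"
  shows "ml_extension g xs = g (zip ds xs)"
  using assms(2)[unfolded homogeneous_def] assms(1)
proof (induction ds xs arbitrary: g rule: list_all2_induct)
  case (Cons d ds x xs)
  have "ml_extension g (x # xs) = (\<Sum>m\<in>{d}. ml_extension (\<lambda>w. g ((m, component x m) # w)) xs)"
    using Cons.hyps by (intro ml_extension_superset[OF Cons.prems]) (auto simp: component_G)
  then show ?case using Cons by (simp add: component_G cochain_fun_Cons)
qed simp

end

section \<open>Cochains as multilinear functions of homogeneous words\<close>

context linear_quotients
begin

lemma presents_restrict: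
  assumes P: "presents M Z B \<pi>" and "subspace Z1" "Z1 \<subseteq> Z"
  shows "presents (M\<lparr>carrier := \<pi> ` Z1\<rparr>) Z1 (Z1 \<inter> B) \<pi>"
  unfolding presents_def
proof (intro conjI ballI allI)
  show "subspace (Z1 \<inter> B)" using assms(2) presentsD(2)[OF P] by (rule subspace_inter)
qed (use assms(2,3) presentsD[OF P] in \<open>auto simp: subset_iff\<close>)

lemma dual_linear:
  assumes P: "presents M Z B \<pi>" and f: "f \<in> carrier (dual_module M)"
    and x: "x \<in> Z" and y: "y \<in> Z"
  shows "f (\<pi> (scale c x + y)) = c * f (\<pi> x) + f (\<pi> y)"
proof -
  note PD = presentsD[OF P]
  have 1: "f (s \<oplus>\<^bsub>M\<^esub> t) = f s + f t" "f (c \<odot>\<^bsub>M\<^esub> t) = c * f t"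
    if "s \<in> carrier M" "t \<in> carrier M" for s t
    using f that by (auto simp: dual_module_def)
  have cx: "scale c x \<in> Z" using subspace_scale[OF PD(1) x] .
  have "f (\<pi> (scale c x + y)) = f (\<pi> (scale c x)) + f (\<pi> y)"
    unfolding PD(5)[OF cx y] using 1(1) PD(8) cx y by blast
  also have "f (\<pi> (scale c x)) = c * f (\<pi> x)"
    unfolding PD(6)[OF x] using 1(2) PD(8) x by blast
  finally show ?thesis .
qed

lemma dual_zero:
  assumes P: "presents M Z B \<pi>" and f: "f \<in> carrier (dual_module M)" and b: "b \<in> B"
  shows "f (\<pi> b) = 0"
proof -
  note PD = presentsD[OF P]
  have 0: "0 \<in> Z" using subspace_0[OF PD(1)] .
  have "f (\<pi> 0) = 0" using dual_linear[OF P f 0 0, of "-1"] by simp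
  moreover have "\<pi> b = \<pi> 0" using PD(3,7) b presents_zero[OF P] by auto
  ultimately show ?thesis by simp
qed

text \<open>Functionals vanish outside the carrier, so equality on generators suffices.\<close>

lemma dual_eqI:
  assumes P: "presents M (span S) B \<pi>"
    and f: "f \<in> carrier (dual_module M)" "f' \<in> carrier (dual_module M)"
    and eq: "\<And>s. s \<in> S \<Longrightarrow> f (\<pi> s) = f' (\<pi> s)"
  shows "f = f'"
proof
  fix t
  show "f t = f' t"
  proof (cases "t \<in> carrier M")
    case True
    then obtain z where z: "z \<in> span S" "t = \<pi> z" using presentsD(4)[OF P] by blast
    have "span S \<subseteq> {z \<in> span S. f (\<pi> z) = f' (\<pi> z)}"
    proof (rule span_minimal)
      show "S \<subseteq> {z \<in> span S. f (\<pi> z) = f' (\<pi> z)}" using eq span_base by blast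
      have 0: "f (\<pi> 0) = f' (\<pi> 0)"
        using dual_zero[OF P f(1)] dual_zero[OF P f(2)] subspace_0[OF presentsD(2)[OF P]] by simp
      have "f (\<pi> (scale c x + y)) = f' (\<pi> (scale c x + y))"
        if "x \<in> span S" "y \<in> span S" "f (\<pi> x) = f' (\<pi> x)" "f (\<pi> y) = f' (\<pi> y)" for c x y
        using dual_linear[OF P f(1) that(1,2)] dual_linear[OF P f(2) that(1,2)] that(3,4) by simp
      from this[of _ _ 1] this[of _ 0] 0 subspace_0[OF subspace_span, of S]
      show "subspace {z \<in> span S. f (\<pi> z) = f' (\<pi> z)}"
        by (auto simp: subspace_def span_0 span_add span_scale)
    qed
    then have "f (\<pi> z) = f' (\<pi> z)" using z(1) by blast
    then show ?thesis using z by simp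
  next
    case False
    then show ?thesis using f by (simp add: dual_module_def)
  qed
qed

lemma dual_exists:
  assumes P: "presents M Z B \<pi>"
    and L: "\<And>c x y. x \<in> Z \<Longrightarrow> y \<in> Z \<Longrightarrow> L (scale c x + y) = c * L x + (L y :: 'k)"
    and LB: "\<And>b. b \<in> B \<Longrightarrow> L b = 0"
  obtains f where "f \<in> carrier (dual_module M)" "\<And>z. z \<in> Z \<Longrightarrow> f (\<pi> z) = L z"
proof
  note PD = presentsD[OF P]
  define f where "f t = (if t \<in> carrier M then L (SOME z. z \<in> Z \<and> \<pi> z = t) else 0)" for t
  show f: "f (\<pi> z) = L z" if z: "z \<in> Z" for z
  proof -
    define y where "y = (SOME y. y \<in> Z \<and> \<pi> y = \<pi> z)"
    have y: "y \<in> Z" "\<pi> y = \<pi> z"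
      using someI[of "\<lambda>y. y \<in> Z \<and> \<pi> y = \<pi> z" z] z unfolding y_def by blast+
    then have "y - z \<in> B" using presents_eq_iff[OF P] z by blast
    then have "L (y - z) = 0" "y - z \<in> Z" using LB PD(3) by auto
    then have "L y = L z" using L[of "y - z" z 1] z by simp
    then show ?thesis unfolding f_def y_def using PD(8)[OF z] by simp
  qed
  have "L 0 = 0" using LB subspace_0[OF PD(2)] by simp
  then have s: "L (x + y) = L x + L y" "L (scale c x) = c * L x" if "x \<in> Z" "y \<in> Z" for c x y
    using L[of x y 1] L[of x 0 c] subspace_0[OF PD(1)] that by simp_all
  show "f \<in> carrier (dual_module M)"
    unfolding dual_module_def
  proof (simp, intro conjI ballI allI impI)
    fix t t' assume "t \<in> carrier M" "t' \<in> carrier M"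
    then obtain z z' where z: "z \<in> Z" "t = \<pi> z" "z' \<in> Z" "t' = \<pi> z'" using PD(4) by (metis imageE)
    show "f (t \<oplus>\<^bsub>M\<^esub> t') = f t + f t'"
      unfolding z(2,4) PD(5)[OF z(1,3), symmetric] using f z s subspace_add[OF PD(1)] by simp
  next
    fix c t assume "t \<in> carrier M"
    then obtain z where z: "z \<in> Z" "t = \<pi> z" using PD(4) by (metis imageE)
    show "f (c \<odot>\<^bsub>M\<^esub> t) = c * f t"
      unfolding z(2) PD(6)[OF z(1), symmetric] using f z s subspace_scale[OF PD(1)] by simp
  qed (simp add: f_def)
qed

end

context dga
begin

definition hom_words :: "nat \<Rightarrow> nat \<Rightarrow> ('a list \<Rightarrow>\<^sub>0 'k) set"
  where "hom_words n m = {gen xs | ds xs. homogeneous ds xs \<and> length xs = n \<and> sum_list ds = m}"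

definition hom_span :: "nat \<Rightarrow> nat \<Rightarrow> ('a list \<Rightarrow>\<^sub>0 'k) set"
  where "hom_span n m = pm.span (hom_words n m)"

lemma hom_span_free_part: "hom_span n m \<subseteq> free_part n"
  unfolding hom_span_def
  by (rule pm.span_minimal[OF _ subspace_free_part]) (auto simp: hom_words_def intro: gen_free_part)

lemma presents_tensor_graded:
  "pm.presents (tensor_graded n m) (hom_span n m) (hom_span n m \<inter> tensor_relations n) (cls n)"
proof -
  have "tensor_graded n m = (tensor_power n)\<lparr>carrier := cls n ` hom_span n m\<rparr>"
    by (simp add: tensor_graded_def cls_def[abs_def] hom_span_def hom_words_def)
  then show ?thesis
    using pm.presents_restrict[OF presents_tensor_power _ hom_span_free_part] by (simp add: hom_span_def)
qed

lemma hom_wordsI: "homogeneous ds xs \<Longrightarrow> length xs = n \<Longrightarrow> sum_list ds = m \<Longrightarrow> gen xs \<in> hom_words n m"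
  unfolding hom_words_def by blast

lemma hom_spanI: "homogeneous ds xs \<Longrightarrow> length xs = n \<Longrightarrow> sum_list ds = m \<Longrightarrow> gen xs \<in> hom_span n m"
  unfolding hom_span_def by (intro pm.span_base hom_wordsI)

lemma cochain_eqI:
  assumes "f \<in> carrier (cochains n m)" "f' \<in> carrier (cochains n m)"
    and "\<And>ds xs. homogeneous ds xs \<Longrightarrow> length xs = n + 1 \<Longrightarrow> sum_list ds = m \<Longrightarrow>
      f (tensor xs) = f' (tensor xs)"
  shows "f = f'"
  using assms unfolding cochains_def
  by (intro pm.dual_eqI[OF presents_tensor_graded[of "n + 1" m, unfolded hom_span_def]])
    (auto simp: hom_words_def tensor_cls)

lemma cochain_of_eqI:
  assumes "f \<in> carrier (cochains n m)"
    and "\<And>ds xs. homogeneous ds xs \<Longrightarrow> length xs = n + 1 \<Longrightarrow> sum_list ds = m \<Longrightarrow>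
      f (tensor xs) = h ds xs"
  shows "cochain_of n m h = f"
  unfolding cochain_of_def
proof (rule the_equality)
  show "f \<in> carrier (cochains n m) \<and>
      (\<forall>ds xs. homogeneous ds xs \<and> length xs = n + 1 \<and> sum_list ds = m \<longrightarrow> f (tensor xs) = h ds xs)"
    using assms by blast
  fix f' assume f': "f' \<in> carrier (cochains n m) \<and>
      (\<forall>ds xs. homogeneous ds xs \<and> length xs = n + 1 \<and> sum_list ds = m \<longrightarrow> f' (tensor xs) = h ds xs)"
  show "f' = f"
    by (rule cochain_eqI[of _ n m]) (use assms f' in auto)
qed

text \<open>The cochain with values \<open>g\<close> on homogeneous tensors. It depends only on the values of \<open>g\<close> on words of
length \<open>n + 1\<close> and degree \<open>m\<close>, so one function \<open>g\<close> can encode cochains of all bidegrees.\<close>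

definition word_cochain :: "nat \<Rightarrow> nat \<Rightarrow> ((nat \<times> 'a) list \<Rightarrow> 'k) \<Rightarrow> ('a list \<Rightarrow>\<^sub>0 'k) set \<Rightarrow> 'k"
  where "word_cochain n m g = cochain_of n m (\<lambda>ds xs. g (zip ds xs))"

definition valid_word :: "nat \<Rightarrow> nat \<Rightarrow> (nat \<times> 'a) list \<Rightarrow> bool"
  where "valid_word n m w \<longleftrightarrow> W.good_word w \<and> length w = n + 1 \<and> W.wdeg w = m"

lemma homogeneous_map: "homogeneous (map fst w) (map snd w) \<longleftrightarrow> W.good_word w"
  by (induction w) (auto simp: homogeneous_def)

lemma homogeneous_zip:
  assumes "homogeneous ds xs"
  shows "length ds = length xs" "map fst (zip ds xs) = ds" "map snd (zip ds xs) = xs"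
    "W.good_word (zip ds xs)" "W.wdeg (zip ds xs) = sum_list ds"
proof -
  show l: "length ds = length xs" using assms unfolding homogeneous_def by (rule list_all2_lengthD)
  then show m: "map fst (zip ds xs) = ds" "map snd (zip ds xs) = xs" by simp_all
  then show "W.good_word (zip ds xs)" using assms homogeneous_map[of "zip ds xs"] by simp
  show "W.wdeg (zip ds xs) = sum_list ds" using m by (simp add: W.wdeg_def)
qed

lemma wdeg_map: "W.wdeg w = sum_list (map fst w)"
  by (simp add: W.wdeg_def)

lemma cochain_of_cong:
  assumes "\<And>ds xs. homogeneous ds xs \<Longrightarrow> length xs = n + 1 \<Longrightarrow> sum_list ds = m \<Longrightarrow> h ds xs = h' ds xs"
  shows "cochain_of n m h = cochain_of n m h'"
proof -
  have "(\<forall>ds xs. homogeneous ds xs \<and> length xs = n + 1 \<and> sum_list ds = m \<longrightarrow> f (tensor xs) = h ds xs)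
    \<longleftrightarrow> (\<forall>ds xs. homogeneous ds xs \<and> length xs = n + 1 \<and> sum_list ds = m \<longrightarrow> f (tensor xs) = h' ds xs)"
    for f
    using assms by (metis (no_types, lifting))
  then show ?thesis unfolding cochain_of_def by simp
qed

lemma cochain_of_word_cochain:
  assumes "\<And>w. valid_word n m w \<Longrightarrow> h (map fst w) (map snd w) = g w"
  shows "cochain_of n m h = word_cochain n m g"
  unfolding word_cochain_def
proof (rule cochain_of_cong)
  fix ds xs assume "homogeneous ds xs" "length xs = n + 1" "sum_list ds = m"
  then show "h ds xs = g (zip ds xs)"
    using homogeneous_zip[of ds xs] assms[of "zip ds xs"] by (simp add: valid_word_def)
qed

lemma word_cochain_cong:
  assumes "\<And>w. valid_word n m w \<Longrightarrow> g w = h w"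
  shows "word_cochain n m g = word_cochain n m h"
proof -
  have "cochain_of n m (\<lambda>ds xs. g (zip ds xs)) = word_cochain n m h"
    by (rule cochain_of_word_cochain) (use assms in \<open>simp add: zip_map_fst_snd\<close>)
  then show ?thesis unfolding word_cochain_def[of n m g] .
qed

text \<open>A multilinear function descends to the tensor power.\<close>

lemma ml_extension_linear_relations:
  assumes "cochain_fun g" "r \<in> tensor_relations n"
  shows "lin_ext (*) (ml_extension g) r = 0"
  using assms(2)
proof (rule relations_induct)
  note L = lin_ext_add[OF vector_space_mult] lin_ext_diff[OF vector_space_mult]
    lin_ext_scale[OF vector_space_mult] lin_ext_single[OF vector_space_mult]
  have 0: "lin_ext (*) (ml_extension g) 0 = 0" by (simp add: lin_ext_def)
  show "pm.subspace {r. lin_ext (*) (ml_extension g) r = 0}"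
    by (simp add: pm.subspace_def L 0)
  fix us vs x y
  show "lin_ext (*) (ml_extension g) (gen (us @ (x + y) # vs) - gen (us @ x # vs) - gen (us @ y # vs)) = 0"
    using ml_extension_multilinear[OF assms(1), of us 1 x y vs] by (simp add: L)
  fix c
  have "ml_extension g (us @ 0 # vs) = 0"
    using ml_extension_multilinear[OF assms(1), of us "-1" 0 0 vs] by simp
  then show "lin_ext (*) (ml_extension g) (gen (us @ scale c x # vs) - pm_scale c (gen (us @ x # vs))) = 0"
    using ml_extension_multilinear[OF assms(1), of us c x 0 vs] by (simp add: L)
qed

text \<open>Existence of the cochain: the linear extension of \<open>ml_extension g\<close> kills the relations, and its
values on homogeneous tensors are those of \<open>g\<close>.\<close>

lemma word_cochain:
  assumes "cochain_fun g"
  shows "word_cochain n m g \<in> carrier (cochains n m)"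
    and "valid_word n m w \<Longrightarrow> word_cochain n m g (tensor (map snd w)) = g w"
proof -
  note L = lin_ext_add[OF vector_space_mult] lin_ext_scale[OF vector_space_mult]
    lin_ext_single[OF vector_space_mult]
  obtain f where f: "f \<in> carrier (dual_module (tensor_graded (n + 1) m))"
    "\<And>z. z \<in> hom_span (n + 1) m \<Longrightarrow> f (cls (n + 1) z) = lin_ext (*) (ml_extension g) z"
    by (rule pm.dual_exists[OF presents_tensor_graded[of "n + 1" m], of "lin_ext (*) (ml_extension g)"])
      (auto simp: L ml_extension_linear_relations[OF assms])
  have f_val: "f (tensor xs) = g (zip ds xs)"
    if "homogeneous ds xs" "length xs = n + 1" "sum_list ds = m" for ds xs
    using f(2)[OF hom_spanI[OF that]] ml_extension_homogeneous[OF assms that(1)] that(2) by (simp add: tensor_cls L)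
  have "f \<in> carrier (cochains n m)" using f(1) by (simp add: cochains_def)
  moreover from this have eq: "word_cochain n m g = f"
    unfolding word_cochain_def by (rule cochain_of_eqI) (rule f_val)
  ultimately show "word_cochain n m g \<in> carrier (cochains n m)" by simp
  assume "valid_word n m w"
  then have "homogeneous (map fst w) (map snd w)" "length (map snd w) = n + 1" "sum_list (map fst w) = m"
    by (auto simp: valid_word_def homogeneous_map wdeg_map)
  from f_val[OF this] show "word_cochain n m g (tensor (map snd w)) = g w" by (simp add: eq zip_map_fst_snd)
qed

lemma cochain_linear:
  assumes "f \<in> carrier (cochains n m)" "x \<in> hom_span (n + 1) m" "y \<in> hom_span (n + 1) m"
  shows "f (cls (n + 1) (pm_scale c x + y)) = c * f (cls (n + 1) x) + f (cls (n + 1) y)"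
  using pm.dual_linear[OF presents_tensor_graded assms(1)[unfolded cochains_def] assms(2,3)] .

lemma cochain_add: "f \<in> carrier (cochains n m) \<Longrightarrow> f' \<in> carrier (cochains n m)
    \<Longrightarrow> (\<lambda>t. f t + f' t) \<in> carrier (cochains n m)"
  and cochain_scale: "f \<in> carrier (cochains n m) \<Longrightarrow> (\<lambda>t. c * f t) \<in> carrier (cochains n m)"
  by (auto simp: cochains_def dual_module_def algebra_simps)

lemma word_cochain_add:
  assumes "cochain_fun g" "cochain_fun h" "cochain_fun (\<lambda>w. g w + h w)"
  shows "word_cochain n m (\<lambda>w. g w + h w) t = word_cochain n m g t + word_cochain n m h t"
proof -
  have "word_cochain n m (\<lambda>w. g w + h w) = (\<lambda>t. word_cochain n m g t + word_cochain n m h t)"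
  proof (rule cochain_eqI[OF word_cochain(1)[OF assms(3)] cochain_add[OF word_cochain(1)[OF assms(1)] word_cochain(1)[OF assms(2)]]])
    fix ds xs assume h: "homogeneous ds xs" "length xs = n + 1" "sum_list ds = m"
    then have "valid_word n m (zip ds xs)" using homogeneous_zip[OF h(1)] by (simp add: valid_word_def)
    from word_cochain(2)[OF assms(1) this] word_cochain(2)[OF assms(2) this] word_cochain(2)[OF assms(3) this]
    show "word_cochain n m (\<lambda>w. g w + h w) (tensor xs) = word_cochain n m g (tensor xs) + word_cochain n m h (tensor xs)"
      using homogeneous_zip[OF h(1)] by simp
  qed
  then show ?thesis by simp
qed

lemma word_cochain_scale:
  assumes "cochain_fun g" "cochain_fun (\<lambda>w. c * g w)"
  shows "word_cochain n m (\<lambda>w. c * g w) t = c * word_cochain n m g t"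
proof -
  have "word_cochain n m (\<lambda>w. c * g w) = (\<lambda>t. c * word_cochain n m g t)"
  proof (rule cochain_eqI[OF word_cochain(1)[OF assms(2)] cochain_scale[OF word_cochain(1)[OF assms(1)]]])
    fix ds xs assume h: "homogeneous ds xs" "length xs = n + 1" "sum_list ds = m"
    then have "valid_word n m (zip ds xs)" using homogeneous_zip[OF h(1)] by (simp add: valid_word_def)
    from word_cochain(2)[OF assms(1) this] word_cochain(2)[OF assms(2) this]
    show "word_cochain n m (\<lambda>w. c * g w) (tensor xs) = c * word_cochain n m g (tensor xs)"
      using homogeneous_zip[OF h(1)] by simp
  qed
  then show ?thesis by simp
qed

text \<open>The inverse of \<open>word_cochain\<close>.\<close>

definition word_fun :: "nat \<Rightarrow> nat \<Rightarrow> (('a list \<Rightarrow>\<^sub>0 'k) set \<Rightarrow> 'k) \<Rightarrow> (nat \<times> 'a) list \<Rightarrow> 'k"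
  where "word_fun n m f w = (if valid_word n m w then f (tensor (map snd w)) else 0)"

lemma cochain_fun_word_fun:
  assumes f: "f \<in> carrier (cochains n m)"
  shows "cochain_fun (word_fun n m f)"
  unfolding cochain_fun_def
proof (intro conjI allI impI)
  fix us :: "(nat \<times> 'a) list" and d :: nat and x y :: 'a and c vs
  assume xy: "x \<in> G d" "y \<in> G d"
  have cxy: "scale c x + y \<in> G d" using xy G_add G_scale by blast
  let ?w = "\<lambda>z. us @ (d, z) # vs"
  show "word_fun n m f (?w (scale c x + y)) = c * word_fun n m f (?w x) + word_fun n m f (?w y)"
  proof (cases "valid_word n m (?w 0)")
    case True
    then have v: "valid_word n m (?w z)" if "z \<in> G d" for z using that by (simp add: valid_word_def)
    have l: "length us + 1 + length vs = n + 1" using True by (simp add: valid_word_def)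
    let ?s = "\<lambda>z. gen (map snd us @ z # map snd vs)"
    have S: "?s z \<in> hom_span (n + 1) m" if "z \<in> G d" for z
      using v[OF that] hom_spanI[of "map fst (?w z)" "map snd (?w z)" "n + 1" m]
      unfolding homogeneous_map by (simp add: valid_word_def wdeg_map)
    have t: "tensor (map snd (?w z)) = cls (n + 1) (?s z)" for z using l by (simp add: tensor_cls)
    have "?s (scale c x + y) - (pm_scale c (?s x) + ?s y)
        = (?s (scale c x + y) - ?s (scale c x) - ?s y) + (?s (scale c x) - pm_scale c (?s x))"
      by simp
    also have "\<dots> \<in> tensor_relations (n + 1)"
      using l by (intro pm.subspace_add[OF subspace_relations] relation_add relation_scale) simp_all
    finally have r: "?s (scale c x + y) - (pm_scale c (?s x) + ?s y) \<in> tensor_relations (n + 1)" .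
    have F: "?s z \<in> free_part (n + 1)" for z using l by (intro gen_free_part) simp
    have "pm_scale c (?s x) + ?s y \<in> free_part (n + 1)"
      using pm.subspace_add[OF subspace_free_part pm.subspace_scale[OF subspace_free_part F] F] .
    then have "cls (n + 1) (?s (scale c x + y)) = cls (n + 1) (pm_scale c (?s x) + ?s y)"
      using cls_eq_iff[OF F] r by blast
    then have "f (cls (n + 1) (?s (scale c x + y))) = c * f (cls (n + 1) (?s x)) + f (cls (n + 1) (?s y))"
      using cochain_linear[OF f S[OF xy(1)] S[OF xy(2)]] by simp
    then show ?thesis unfolding word_fun_def t using v xy cxy by simp
  next
    case False
    then have "\<not> valid_word n m (?w z)" if "z \<in> G d" for z using that by (simp add: valid_word_def)
    then show ?thesis using xy cxy by (simp add: word_fun_def)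
  qed
qed (simp add: word_fun_def valid_word_def)

lemma word_cochain_word_fun:
  assumes f: "f \<in> carrier (cochains n m)"
  shows "word_cochain n m (word_fun n m f) = f"
proof (rule cochain_eqI[OF word_cochain(1)[OF cochain_fun_word_fun[OF f]] f])
  fix ds xs assume h: "homogeneous ds xs" "length xs = n + 1" "sum_list ds = m"
  then have v: "valid_word n m (zip ds xs)" using homogeneous_zip[OF h(1)] by (simp add: valid_word_def)
  show "word_cochain n m (word_fun n m f) (tensor xs) = f (tensor xs)"
    using word_cochain(2)[OF cochain_fun_word_fun[OF f] v] v homogeneous_zip(3)[OF h(1)] by (simp add: word_fun_def)
qed

text \<open>A product of two letters can be homogeneous although its factors are not, and so can the image of a
letter under the differential. The faces and the differential therefore have to be cut off outside
good words to give a \<open>cochain_fun\<close>, whereas rotation and \<open>s\<close> preserve the support in good words.\<close>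

definition truncate :: "((nat \<times> 'a) list \<Rightarrow> 'k) \<Rightarrow> (nat \<times> 'a) list \<Rightarrow> 'k"
  where "truncate g w = (if W.good_word w then g w else 0)"

definition multilinear :: "((nat \<times> 'a) list \<Rightarrow> 'k) \<Rightarrow> bool"
  where "multilinear g \<longleftrightarrow> (\<forall>us d x y c vs. W.good_word us \<longrightarrow> W.good_word vs \<longrightarrow> x \<in> G d \<longrightarrow> y \<in> G d \<longrightarrow>
      g (us @ (d, scale c x + y) # vs) = c * g (us @ (d, x) # vs) + g (us @ (d, y) # vs))"

lemma cochain_fun_truncate:
  assumes "multilinear g"
  shows "cochain_fun (truncate g)"
  unfolding cochain_fun_def
proof (intro conjI allI impI)
  fix us :: "(nat \<times> 'a) list" and d :: nat and x y :: 'a and c vs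
  assume xy: "x \<in> G d" "y \<in> G d"
  have "scale c x + y \<in> G d" using xy G_add G_scale by blast
  then show "truncate g (us @ (d, scale c x + y) # vs) = c * truncate g (us @ (d, x) # vs) + truncate g (us @ (d, y) # vs)"
    using assms xy unfolding multilinear_def by (auto simp: truncate_def)
qed (simp add: truncate_def)

lemma multilinear_cochain_fun: "cochain_fun g \<Longrightarrow> multilinear g"
  unfolding cochain_fun_def multilinear_def by blast

lemma multilinear_add: "multilinear g \<Longrightarrow> multilinear h \<Longrightarrow> multilinear (\<lambda>w. g w + h w)"
  unfolding multilinear_def by (auto simp: algebra_simps)

lemma multilinear_wlen:
  assumes "multilinear g"
  shows "multilinear (\<lambda>w. c (length w) (W.wdeg w) * g w)"
  using assms unfolding multilinear_def by (auto simp: algebra_simps)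

lemma multilinear_sum:
  assumes "\<And>i. multilinear (g i)"
  shows "multilinear (\<lambda>w. \<Sum>i<length w - k. g i w)"
  using assms unfolding multilinear_def by (simp add: sum.distrib sum_distrib_left)

lemma multilinear_face:
  assumes "cochain_fun g"
  shows "multilinear (W.face i g)"
proof -
  have "W.face i g (us @ (d, scale c x + y) # vs)
      = c * W.face i g (us @ (d, x) # vs) + W.face i g (us @ (d, y) # vs)"
    if "W.good_word us" "W.good_word vs" "x \<in> G d" "y \<in> G d" for us d x y c vs
    using assms that(1)
  proof (induction us arbitrary: i g)
    case Nil
    show ?case
    proof (cases i)
      case 0
      show ?thesis
      proof (cases vs)
        case (Cons z vs')
        obtain m b where z: "z = (m, b)" "b \<in> G m" using \<open>W.good_word vs\<close> Cons by (cases z) auto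
        have "(scale c x + y) * b = scale c (x * b) + y * b"
          by (simp add: distrib_right scale_mult_left)
        then show ?thesis
          using cochain_funD(3)[OF Nil(1) mult_graded[OF that(3) z(2)] mult_graded[OF that(4) z(2)]] 0 Cons z(1) by simp
      qed (simp add: 0)
    next
      case (Suc j)
      have "(\<lambda>v. g ((d, scale c x + y) # v)) = (\<lambda>v. c * g ((d, x) # v) + g ((d, y) # v))"
        using cochain_funD(3)[OF Nil(1) that(3,4)] by simp
      then show ?thesis by (simp add: Suc W.face_lin)
    qed
  next
    case (Cons a us)
    show ?case
    proof (cases i)
      case 0
      show ?thesis
      proof (cases us)
        case Nil
        obtain m b where a: "a = (m, b)" "b \<in> G m" using Cons.prems(2) by (cases a) auto
        have "b * (scale c x + y) = scale c (b * x) + b * y"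
          by (simp add: distrib_left scale_mult_right)
        then show ?thesis
          using cochain_funD(3)[OF Cons.prems(1) mult_graded[OF a(2) that(3)] mult_graded[OF a(2) that(4)]]
            0 Nil a(1) by simp
      next
        case (Cons b us')
        then show ?thesis
          using cochain_funD(2)[OF cochain_fun_Cons[OF Cons.prems(1)] that(3,4)] 0 by simp
      qed
    next
      case (Suc j)
      then show ?thesis using Cons.IH[OF cochain_fun_Cons[OF Cons.prems(1), of a], of j] Cons.prems(2) by simp
    qed
  qed
  then show ?thesis unfolding multilinear_def by blast
qed

lemma cochain_fun_diff: "cochain_fun g \<Longrightarrow> cochain_fun h \<Longrightarrow> cochain_fun (\<lambda>w. g w - h w)"
  and cochain_fun_plus: "cochain_fun g \<Longrightarrow> cochain_fun h \<Longrightarrow> cochain_fun (\<lambda>w. g w + h w)"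
  and cochain_fun_smult: "cochain_fun g \<Longrightarrow> cochain_fun (\<lambda>w. a * g w)"
  and cochain_fun_null: "cochain_fun (\<lambda>w. 0)"
  unfolding cochain_fun_def by (auto simp: algebra_simps)

lemma cochain_fun_tau:
  assumes "cochain_fun g"
  shows "cochain_fun (W.tau g)"
  unfolding cochain_fun_def
proof (intro conjI allI impI)
  fix w :: "(nat \<times> 'a) list" assume w: "\<not> W.good_word w"
  then have "w \<noteq> []" by auto
  then have "set (last w # butlast w) = set w" by (cases w rule: rev_cases) auto
  then have "\<not> W.good_word (last w # butlast w)" using w by (simp only: W.good_word_def not_False_eq_True)
  then show "W.tau g w = 0" using cochain_funD(1)[OF assms] \<open>w \<noteq> []\<close> by (simp add: W.tau_def)
next
  fix us :: "(nat \<times> 'a) list" and d :: nat and x y :: 'a and c vs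
  assume xy: "x \<in> G d" "y \<in> G d"
  show "W.tau g (us @ (d, scale c x + y) # vs) = c * W.tau g (us @ (d, x) # vs) + W.tau g (us @ (d, y) # vs)"
  proof (cases vs rule: rev_cases)
    case Nil
    then show ?thesis using cochain_funD(3)[OF assms xy] by (simp add: W.tau_snoc algebra_simps)
  next
    case (snoc vs' b)
    have eq: "us @ z # vs = (us @ z # vs') @ [b]" for z by (simp add: snoc)
    show ?thesis
      using cochain_funD(2)[OF cochain_fun_Cons[OF assms] xy, of b us c vs'] unfolding eq W.tau_snoc
      by (simp add: algebra_simps)
  qed
qed

lemma cochain_fun_tau_pow: "cochain_fun g \<Longrightarrow> cochain_fun ((W.tau ^^ i) g)"
  by (induction i) (simp_all add: cochain_fun_tau)

lemma cochain_fun_cyclic_norm: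
  assumes "cochain_fun g"
  shows "cochain_fun (W.cyclic_norm g)"
proof -
  note t = cochain_fun_tau_pow[OF assms]
  show ?thesis
    unfolding cochain_fun_def W.cyclic_norm_def
    by (simp add: cochain_funD(1)[OF t] cochain_funD(2)[OF t] sum.distrib sum_distrib_left distrib_left)
qed

lemma cochain_fun_unit_op:
  assumes "cochain_fun g"
  shows "cochain_fun (W.unit_op g)"
  unfolding cochain_fun_def W.unit_op_def
  using cochain_funD(1)[OF assms] cochain_funD(2)[OF assms] by (simp add: algebra_simps)

lemma cochain_fun_connes: "cochain_fun g \<Longrightarrow> cochain_fun (W.connes g)"
  unfolding W.connes_def by (intro cochain_fun_cyclic_norm cochain_fun_unit_op cochain_fun_diff cochain_fun_tau)

lemma multilinear_cong:
  assumes "multilinear g" "\<And>w. W.good_word w \<Longrightarrow> g w = h w"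
  shows "multilinear h"
  unfolding multilinear_def
proof (intro allI impI)
  fix us :: "(nat \<times> 'a) list" and d :: nat and x y :: 'a and c vs
  assume a: "W.good_word us" "W.good_word vs" "x \<in> G d" "y \<in> G d"
  then have "scale c x + y \<in> G d" using G_add G_scale by blast
  then show "h (us @ (d, scale c x + y) # vs) = c * h (us @ (d, x) # vs) + h (us @ (d, y) # vs)"
    using assms(1) a unfolding multilinear_def by (simp flip: assms(2))
qed

lemma multilinear_hoch:
  assumes "cochain_fun g"
  shows "multilinear (W.hoch g)"
proof -
  have "multilinear (W.tau (truncate (W.face 0 g)))" using multilinear_cochain_fun[OF cochain_fun_tau[OF cochain_fun_truncate[OF multilinear_face[OF assms]]]] .
  moreover have "W.tau (truncate (W.face 0 g)) w = W.tau (W.face 0 g) w" if "W.good_word w" for w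
    by (rule W.tau_gcong[OF _ that]) (simp add: truncate_def)
  ultimately have "multilinear (W.tau (W.face 0 g))" by (rule multilinear_cong)
  moreover have "multilinear (W.bprime g)"
    unfolding W.bprime_def[abs_def] by (rule multilinear_sum) (rule multilinear_face[OF assms])
  ultimately show ?thesis unfolding W.hoch_def[abs_def] by (rule multilinear_add[rotated])
qed

lemma multilinear_word_diff:
  assumes "cochain_fun g"
  shows "multilinear (W.word_diff g)"
proof -
  have "W.word_diff g (us @ (d, scale c x + y) # vs) = c * W.word_diff g (us @ (d, x) # vs) + W.word_diff g (us @ (d, y) # vs)"
    if "x \<in> G d" "y \<in> G d" for us d x y c vs
    using assms
  proof (induction us arbitrary: g)
    case Nil
    have "(\<lambda>v. g ((d, scale c x + y) # v)) = (\<lambda>v. c * g ((d, x) # v) + g ((d, y) # v))"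
      using cochain_funD(3)[OF Nil that] by simp
    moreover have "g ((d - 1, phi (scale c x + y)) # vs) = c * g ((d - 1, phi x) # vs) + g ((d - 1, phi y) # vs)"
      using cochain_funD(3)[OF Nil G_phi[OF that(1)] G_phi[OF that(2)]] by (simp add: phi_add phi_scale)
    ultimately show ?case by (simp add: W.word_diff_add W.word_diff_scale algebra_simps)
  next
    case (Cons a us)
    show ?case
      using Cons.IH[OF cochain_fun_Cons[OF Cons.prems, of a]] cochain_funD(2)[OF cochain_fun_Cons[OF Cons.prems] that]
      by (simp add: algebra_simps)
  qed
  then show ?thesis unfolding multilinear_def by blast
qed

text \<open>In the two summands of the Leibniz rule the degrees of the letters agree with that of the left-hand
side unless a factor has degree \<open>0\<close>; in this case its differential is \<open>0\<close>, and so is the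
corresponding value of \<open>g\<close>.\<close>

lemma leibniz_cochain_fun:
  assumes "cochain_fun g"
  shows "W.leibniz g"
  unfolding W.leibniz_def
proof (intro allI impI)
  fix us x y vs assume a: "W.good_word us \<and> good x \<and> good y \<and> W.good_word vs"
  obtain d1 x1 d2 x2 where [simp]: "x = (d1, x1)" "y = (d2, x2)" by (metis surj_pair)
  have x: "x1 \<in> G d1" "x2 \<in> G d2" using a by auto
  note z = cochain_fun_zero_letter[OF assms]
  have L: "phi (x1 * x2) = phi x1 * x2 + scale ((-1) ^ d1) (x1 * phi x2)"
    using phi_leibniz[OF x(1)] .
  have e: "us @ (d1 + d2 - 1, phi (x1 * x2)) # vs
      = us @ (d1 + d2 - 1, scale ((-1) ^ d1) (x1 * phi x2) + phi x1 * x2) # vs"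
    by (simp add: L add.commute)
  have "g (us @ (d1 + d2 - 1, phi (x1 * x2)) # vs)
      = g (us @ (d1 - 1 + d2, phi x1 * x2) # vs) + (-1) ^ d1 * g (us @ (d1 + (d2 - 1), x1 * phi x2) # vs)"
  proof (cases "d1 = 0")
    case True
    then have p1: "phi x1 = 0" using x phi_graded_0 by simp
    have "x1 * phi x2 \<in> G (d2 - 1)" using mult_graded[OF x(1) G_phi[OF x(2)]] True by simp
    then show ?thesis
      using cochain_fun_scale[OF assms, of "x1 * phi x2" "d2 - 1" us 1 vs] True p1 z unfolding e by simp
  next
    case d1: False
    have g1: "phi x1 * x2 \<in> G (d1 + d2 - 1)"
      using mult_graded[OF G_phi[OF x(1)] x(2)] d1 by simp
    show ?thesis
    proof (cases "d2 = 0")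
      case True
      then have "phi x2 = 0" using x phi_graded_0 by simp
      then show ?thesis using True d1 z unfolding e by simp
    next
      case False
      have g2: "x1 * phi x2 \<in> G (d1 + d2 - 1)"
        using mult_graded[OF x(1) G_phi[OF x(2)]] False by simp
      have "d1 - 1 + d2 = d1 + d2 - 1" "d1 + (d2 - 1) = d1 + d2 - 1" using d1 False by auto
      then show ?thesis unfolding e cochain_funD(2)[OF assms g2 g1] by simp
    qed
  qed
  then show "g (us @ lphi (lmul x y) # vs)
      = g (us @ lmul (lphi x) y # vs) + (-1) ^ fst x * g (us @ lmul x (lphi y) # vs)"
    by simp
qed

section \<open>The operators on cochains\<close>

lemma word_cochain_val:
  assumes "cochain_fun g" "valid_word n m v" "xs = map snd v"
  shows "word_cochain n m g (tensor xs) = g v"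
  using word_cochain(2)[OF assms(1,2)] assms(3) by simp

text \<open>Here and below, the operator of the definition takes a cochain to the one with prescribed values on
homogeneous tensors, and these values are the ones computed by the operator on words.\<close>

lemma op_tau_word_cochain:
  assumes "cochain_fun g"
  shows "op_tau n m (word_cochain n m g) = word_cochain n m (W.tau g)"
  unfolding op_tau_def
proof (rule cochain_of_word_cochain)
  fix w assume w: "valid_word n m w"
  then have ne: "w \<noteq> []" by (auto simp: valid_word_def)
  then obtain v z where vz: "w = v @ [z]" by (metis rev_exhaust)
  have "valid_word n m (z # v)" using w by (simp add: valid_word_def vz)
  then have "word_cochain n m g (tensor (last (map snd w) # butlast (map snd w))) = g (z # v)"
    by (rule word_cochain_val[OF assms]) (simp add: vz)
  moreover have "length v = n" using w by (simp add: valid_word_def vz)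
  ultimately show "(-1) ^ (n + gamma (map fst w)) * word_cochain n m g (tensor (last (map snd w) # butlast (map snd w)))
      = W.tau g w"
    unfolding vz W.tau_snoc by (simp add: gamma_def wdeg_map butlast_append)
qed

lemma op_N_word_cochain:
  assumes "cochain_fun g"
  shows "op_N n m (word_cochain n m g) = word_cochain n m (W.cyclic_norm g)"
proof -
  have p: "(op_tau n m ^^ i) (word_cochain n m g) = word_cochain n m ((W.tau ^^ i) g)" for i
    by (induction i) (simp_all add: op_tau_word_cochain[OF cochain_fun_tau_pow[OF assms]])
  have s: "cochain_fun (\<lambda>w. \<Sum>i<k. (W.tau ^^ i) g w)" for k
    by (induction k) (auto intro!: cochain_fun_plus cochain_fun_tau_pow assms simp: cochain_fun_null)
  have "word_cochain n m (\<lambda>w. \<Sum>i<k. (W.tau ^^ i) g w) t = (\<Sum>i<k. word_cochain n m ((W.tau ^^ i) g) t)" for k t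
  proof (induction k)
    case 0
    show ?case using word_cochain_scale[OF cochain_fun_null, of 0 n m t] by (simp add: cochain_fun_null)
  next
    case (Suc k)
    show ?case
      using word_cochain_add[OF s[of k] cochain_fun_tau_pow[OF assms, of k]] s[of "Suc k"] Suc by simp
  qed
  then have "op_N n m (word_cochain n m g) = word_cochain n m (\<lambda>w. \<Sum>i<Suc n. (W.tau ^^ i) g w)"
    unfolding op_N_def p lessThan_Suc_atMost[symmetric] by (intro ext) (simp only:)
  also have "\<dots> = word_cochain n m (W.cyclic_norm g)"
    by (rule word_cochain_cong) (simp add: valid_word_def W.cyclic_norm_def)
  finally show ?thesis .
qed

lemma op_s_word_cochain:
  assumes "cochain_fun g"
  shows "op_s n m (word_cochain (n + 1) m g) = word_cochain n m (W.unit_op g)"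
  unfolding op_s_def
proof (rule cochain_of_word_cochain)
  fix w assume w: "valid_word n m w"
  then have "valid_word (n + 1) m (w @ [(0, e)])" by (simp add: valid_word_def unit_graded)
  then have "word_cochain (n + 1) m g (tensor (map snd w @ [e])) = g (w @ [(0, e)])"
    by (rule word_cochain_val[OF assms]) simp
  then show "(-1) ^ n * word_cochain (n + 1) m g (tensor (map snd w @ [e])) = W.unit_op g w"
    using w by (simp add: W.unit_op_def valid_word_def)
qed

lemma op_B_word_cochain:
  assumes "cochain_fun g"
  shows "op_B n m (word_cochain (n + 1) m g) = word_cochain n m (W.connes g)"
proof -
  have d: "cochain_fun (\<lambda>w. g w - W.tau g w)" by (intro cochain_fun_diff cochain_fun_tau assms)
  have m: "cochain_fun (\<lambda>w. - 1 * W.tau g w)" by (intro cochain_fun_smult cochain_fun_tau assms)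
  have "(\<lambda>t. word_cochain (n + 1) m g t - op_tau (n + 1) m (word_cochain (n + 1) m g) t)
      = word_cochain (n + 1) m (\<lambda>w. g w - W.tau g w)"
    using word_cochain_add[OF assms m] d word_cochain_scale[OF cochain_fun_tau[OF assms] m]
    by (intro ext) (simp add: op_tau_word_cochain[OF assms])
  then show ?thesis
    unfolding op_B_def W.connes_def by (simp add: op_s_word_cochain[OF d, simplified] op_N_word_cochain[OF cochain_fun_unit_op[OF d]])
qed

lemma op_b_word_cochain:
  assumes "cochain_fun g" "0 < n"
  shows "op_b n m (word_cochain (n - 1) m g) = word_cochain n m (W.hoch g)"
  unfolding op_b_def
proof (rule cochain_of_word_cochain)
  fix w assume w: "valid_word n m w"
  let ?f = "word_cochain (n - 1) m g" and ?xs = "map snd w" and ?ds = "map fst w"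
  have lw: "length w = n + 1" using w by (simp add: valid_word_def)
  have 1: "(-1) ^ i * ?f (tensor (take i ?xs @ (?xs ! i * ?xs ! (i + 1)) # drop (i + 2) ?xs)) = W.face i g w"
    if i: "i < n" for i
  proof -
    obtain us x y vs where d: "w = us @ x # y # vs" "length us = i"
      using i lw by (elim W.split_at[rotated]) simp
    have nth: "?xs ! i = snd x" "?xs ! (i + 1) = snd y" using d by (auto simp: nth_append)
    have v: "valid_word (n - 1) m (us @ lmul x y # vs)"
      using w assms(2) by (auto simp: valid_word_def d(1) mult_graded)
    have "take i ?xs @ (?xs ! i * ?xs ! (i + 1)) # drop (i + 2) ?xs
        = map snd (us @ lmul x y # vs)"
      unfolding nth using d by simp
    then show ?thesis
      using word_cochain_val[OF assms(1) v] W.face_append[OF d(2)[symmetric], of g x y vs] d(1) by simp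
  qed
  obtain x u z where xz: "w = x # u @ [z]"
  proof -
    have "w \<noteq> []" "tl w \<noteq> []" using lw assms(2) by (auto simp flip: length_0_conv)
    then show ?thesis using that by (metis append_butlast_last_id list.collapse)
  qed
  have v: "valid_word (n - 1) m (lmul z x # u)"
    using w assms(2) by (auto simp: valid_word_def xz mult_graded)
  have "?f (tensor ((last ?xs * hd ?xs) # butlast (tl ?xs))) = g (lmul z x # u)"
    by (rule word_cochain_val[OF assms(1) v]) (simp add: xz butlast_append)
  moreover have "W.tau (W.face 0 g) w = (-1) ^ (n + gamma ?ds) * g (lmul z x # u)"
  proof -
    have "w = (x # u) @ [z]" "length (x # u) = n" using xz lw by auto
    then show ?thesis
      using W.tau_snoc[of "W.face 0 g" "x # u" z] by (simp add: gamma_def wdeg_map butlast_append)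
  qed
  ultimately show "(\<Sum>i<n. (-1) ^ i * ?f (tensor (take i ?xs @ (?xs ! i * ?xs ! (i + 1)) # drop (i + 2) ?xs)))
      + (-1) ^ (n + gamma ?ds) * ?f (tensor ((last ?xs * hd ?xs) # butlast (tl ?xs))) = W.hoch g w"
    unfolding W.hoch_def W.bprime_def using 1 lw by simp
qed

end

section \<open>The differential of the tensor powers\<close>

context dga
begin

lemma free_part_minimal:
  assumes Q: "pm.subspace Q" and gen: "\<And>xs. length xs = n \<Longrightarrow> gen xs \<in> Q"
  shows "free_part n \<subseteq> Q"
proof
  fix f assume f: "f \<in> free_part n"
  have "f = (\<Sum>xs\<in>Poly_Mapping.keys f. pm_scale (Poly_Mapping.lookup f xs) (gen xs))"
  proof (rule poly_mapping_eqI)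
    fix ys
    have "Poly_Mapping.lookup (\<Sum>xs\<in>Poly_Mapping.keys f. pm_scale (Poly_Mapping.lookup f xs) (gen xs)) ys
        = (\<Sum>xs\<in>Poly_Mapping.keys f. if ys = xs then Poly_Mapping.lookup f xs else 0)"
      unfolding lookup_sum by (intro sum.cong) (auto simp: lookup_single when_def)
    then show "Poly_Mapping.lookup f ys
        = Poly_Mapping.lookup (\<Sum>xs\<in>Poly_Mapping.keys f. pm_scale (Poly_Mapping.lookup f xs) (gen xs)) ys"
      by (simp only: sum.delta' finite_keys) (simp add: in_keys_iff)
  qed
  moreover have "\<dots> \<in> Q"
    using f by (intro pm.subspace_sum[OF Q] pm.subspace_scale[OF Q] gen) (auto simp: free_part_def)
  ultimately show "f \<in> Q" by simp
qed

text \<open>Homogeneous words generate the free vector space modulo the relations: the entries of a word are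
replaced one after the other by sums of homogeneous components.\<close>

lemma homogeneous_minimal:
  assumes Q: "pm.subspace Q" and rel: "tensor_relations n \<subseteq> Q"
    and hom: "\<And>ds xs. homogeneous ds xs \<Longrightarrow> length xs = n \<Longrightarrow> gen xs \<in> Q"
  shows "free_part n \<subseteq> Q"
proof (rule free_part_minimal[OF Q])
  fix xs :: "'a list" assume "length xs = n"
  moreover have "gen (us @ vs) \<in> Q" if "homogeneous ds us" "length us + length vs = n" for ds us vs
    using that
  proof (induction vs arbitrary: us ds)
    case Nil
    then show ?case using hom by simp
  next
    case (Cons x vs)
    let ?S = "{z. gen (us @ z # vs) \<in> Q}"
    have l: "length us + 1 + length vs = n" using Cons.prems by simp
    have scal: "scale c z \<in> ?S" if "z \<in> ?S" for c z
      using pm.subspace_add[OF Q subsetD[OF rel relation_scale[OF l, of c z]]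
          pm.subspace_scale[OF Q that[simplified], of c]] by simp
    have "gen (us @ x # vs) \<in> Q" if "x \<in> ?S" for x using that by simp
    have S: "subspace ?S"
      unfolding subspace_def
    proof (intro conjI ballI allI)
      \<comment> \<open>the set is not empty: it contains the homogeneous components of \<open>x\<close>\<close>
      have "gen (us @ component x 0 # vs) \<in> Q"
        using Cons.IH[of "ds @ [0]" "us @ [component x 0]"] Cons.prems component(1)
        by (simp add: homogeneous_def list_all2_appendI)
      then show "0 \<in> ?S" using scal[of "component x 0" 0] by simp
    next
      fix y z assume "y \<in> ?S" "z \<in> ?S"
      then have "(gen (us @ (y + z) # vs) - gen (us @ y # vs) - gen (us @ z # vs))
          + (gen (us @ y # vs) + gen (us @ z # vs)) \<in> Q"
        using rel relation_add[OF l, of y z] by (intro pm.subspace_add[OF Q]) auto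
      then show "y + z \<in> ?S" by simp
    qed (rule scal)
    have "component x m \<in> ?S" for m
      using Cons.IH[of "ds @ [m]" "us @ [component x m]"] Cons.prems component(1)
      by (simp add: homogeneous_def list_all2_appendI)
    then have "(\<Sum>m | component x m \<noteq> 0. component x m) \<in> ?S" by (intro subspace_sum[OF S])
    then show ?case by (simp add: component(3))
  qed
  from this[of "[]" "[]" xs] show "gen xs \<in> Q" using \<open>length xs = n\<close> by (simp add: homogeneous_def)
qed

text \<open>The grading involution, \<open>(-1)\<^sup>m\<close> in degree \<open>m\<close>. Since it is linear, it turns the signs in
\<open>\<phi>\<^sup>\<otimes>\<^sup>n\<close> into a formula that makes sense for words of inhomogeneous elements; this gives the existence
of \<open>tensor_diff\<close>.\<close>

definition grading_inv :: "'a \<Rightarrow> 'a"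
  where "grading_inv x = (\<Sum>m | component x m \<noteq> 0. scale ((-1) ^ m) (component x m))"

lemma grading_inv_superset: "finite S \<Longrightarrow> {m. component x m \<noteq> 0} \<subseteq> S \<Longrightarrow> grading_inv x = (\<Sum>m\<in>S. scale ((-1) ^ m) (component x m))"
  unfolding grading_inv_def by (intro sum.mono_neutral_left) auto

lemma grading_inv_lin: "grading_inv (scale c x + y) = scale c (grading_inv x) + grading_inv y"
proof -
  let ?S = "{m. component x m \<noteq> 0} \<union> {m. component y m \<noteq> 0}"
  have S: "finite ?S" "{m. component (scale c x + y) m \<noteq> 0} \<subseteq> ?S" "{m. component x m \<noteq> 0} \<subseteq> ?S"
    "{m. component y m \<noteq> 0} \<subseteq> ?S"
    using component(2) by (auto simp: component_lin)
  show ?thesis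
    unfolding grading_inv_superset[OF S(1,2)] grading_inv_superset[OF S(1,3)] grading_inv_superset[OF S(1,4)]
    by (simp add: component_lin scale_right_distrib sum.distrib scale_sum_right mult.commute)
qed

lemma grading_inv_add: "grading_inv (x + y) = grading_inv x + grading_inv y"
  using grading_inv_lin[of 1 x y] by simp

lemma grading_inv_scale: "grading_inv (scale c x) = scale c (grading_inv x)"
  using grading_inv_lin[of c x 0] by (simp add: grading_inv_def[of 0] component_G[OF G_0, of 0] cong: if_cong)

lemma grading_inv_G: "x \<in> G d \<Longrightarrow> grading_inv x = scale ((-1) ^ d) x"
  by (subst grading_inv_superset[of "{d}"]) (auto simp: component_G split: if_splits)

definition diff_term :: "nat \<Rightarrow> 'a list \<Rightarrow> 'a list"
  where "diff_term i xs = map grading_inv (take i xs) @ phi (xs ! i) # drop (Suc i) xs"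

definition diff_word :: "'a list \<Rightarrow> ('a list \<Rightarrow>\<^sub>0 'k)"
  where "diff_word xs = (\<Sum>i<length xs. gen (diff_term i xs))"

lemma vector_space_pm_scale: "vector_space pm_scale"
  by (rule pm.vector_space_axioms)

lemma diff_term_lengths: "i < length xs \<Longrightarrow> length (diff_term i xs) = length xs"
  by (simp add: diff_term_def)

text \<open>A summand of the differential depends on a given entry of the word through one linear map: the
identity, \<open>\<phi>\<close> or the grading involution, according to the position of the entry. Hence the
differential maps relations to relations.\<close>

lemma diff_term_split:
  assumes "i < length us + 1 + length vs"
  obtains us' vs' L where "length us' + 1 + length vs' = length us + 1 + length vs"
    "\<And>z. diff_term i (us @ z # vs) = us' @ L z # vs'"
    "\<And>x y. L (x + y) = L x + L y" "\<And>c x. L (scale c x) = scale c (L x)"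
proof -
  consider "i < length us" | "i = length us" | "length us < i" by linarith
  then show ?thesis
  proof cases
    case 1
    show ?thesis
      by (rule that[of "map grading_inv (take i us) @ phi (us ! i) # drop (Suc i) us" vs "\<lambda>z. z"])
        (use 1 in \<open>auto simp: diff_term_def nth_append\<close>)
  next
    case 2
    show ?thesis
      by (rule that[of "map grading_inv us" vs phi]) (use 2 in \<open>auto simp: diff_term_def phi_add phi_scale\<close>)
  next
    case 3
    define j where "j = i - length us - 1"
    have j: "i = Suc (length us + j)" "j < length vs" using 3 assms by (auto simp: j_def)
    show ?thesis
      by (rule that[of "map grading_inv us" "diff_term j vs" grading_inv])
        (use j in \<open>auto simp: diff_term_def grading_inv_add grading_inv_scale nth_append\<close>)
  qed
qed

lemma diff_word_relations:
  assumes l: "length us + 1 + length vs = n"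
  shows "diff_word (us @ (x + y) # vs) - diff_word (us @ x # vs) - diff_word (us @ y # vs) \<in> tensor_relations n"
    and "diff_word (us @ scale c x # vs) - pm_scale c (diff_word (us @ x # vs)) \<in> tensor_relations n"
proof -
  let ?t = "\<lambda>i z. gen (diff_term i (us @ z # vs))"
  have d: "diff_word (us @ z # vs) = (\<Sum>i<n. ?t i z)" for z
    unfolding diff_word_def using l by (intro sum.cong) auto
  have "?t i (x + y) - ?t i x - ?t i y \<in> tensor_relations n
      \<and> ?t i (scale c x) - pm_scale c (?t i x) \<in> tensor_relations n" if i: "i < n" for i
  proof -
    obtain us' vs' L where L: "length us' + 1 + length vs' = length us + 1 + length vs"
      "\<And>z. diff_term i (us @ z # vs) = us' @ L z # vs'"
      "\<And>x y. L (x + y) = L x + L y" "\<And>c x. L (scale c x) = scale c (L x)"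
      using diff_term_split[of i us vs] i l by metis
    have l': "length us' + 1 + length vs' = n" using L(1) l by simp
    show ?thesis unfolding L(2-4) using relation_add[OF l'] relation_scale[OF l'] by blast
  qed
  then have "(\<Sum>i<n. ?t i (x + y) - ?t i x - ?t i y) \<in> tensor_relations n"
    "(\<Sum>i<n. ?t i (scale c x) - pm_scale c (?t i x)) \<in> tensor_relations n"
    by (intro pm.subspace_sum[OF subspace_relations]; simp)+
  then show "diff_word (us @ (x + y) # vs) - diff_word (us @ x # vs) - diff_word (us @ y # vs) \<in> tensor_relations n"
    "diff_word (us @ scale c x # vs) - pm_scale c (diff_word (us @ x # vs)) \<in> tensor_relations n"
    unfolding d by (simp_all add: sum_subtractf pm.scale_sum_right)
qed

definition free_diff :: "('a list \<Rightarrow>\<^sub>0 'k) \<Rightarrow> ('a list \<Rightarrow>\<^sub>0 'k)"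
  where "free_diff = lin_ext pm_scale diff_word"

lemma free_diff_simps: "free_diff (f + g) = free_diff f + free_diff g" "free_diff (f - g) = free_diff f - free_diff g"
    "free_diff (pm_scale c f) = pm_scale c (free_diff f)" "free_diff (gen xs) = diff_word xs"
  unfolding free_diff_def
  by (rule lin_ext_add[OF vector_space_pm_scale] lin_ext_diff[OF vector_space_pm_scale] lin_ext_scale[OF vector_space_pm_scale] lin_ext_single[OF vector_space_pm_scale])+

lemma endo_free_diff: "pm.endo free_diff"
  unfolding pm.endo_def by (simp add: free_diff_simps)

lemma diff_word_free_part: "length xs = n \<Longrightarrow> diff_word xs \<in> free_part n"
  unfolding diff_word_def by (intro pm.subspace_sum[OF subspace_free_part] gen_free_part) (simp add: diff_term_lengths)

lemma subspace_vimage_free_diff: "pm.subspace S \<Longrightarrow> pm.subspace {f. free_diff f \<in> S}"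
  using pm.endo_0[OF endo_free_diff] by (simp add: pm.subspace_def free_diff_simps)

lemma free_diff_free_part: "free_diff ` free_part n \<subseteq> free_part n"
proof -
  have "free_part n \<subseteq> {f. free_diff f \<in> free_part n}"
    by (rule free_part_minimal[OF subspace_vimage_free_diff[OF subspace_free_part]]) (simp add: free_diff_simps diff_word_free_part)
  then show ?thesis by blast
qed

lemma free_diff_relations: "free_diff ` tensor_relations n \<subseteq> tensor_relations n"
proof -
  have "free_diff r \<in> tensor_relations n" if "r \<in> tensor_relations n" for r
    using that
    by (rule relations_induct)
      (simp_all add: subspace_vimage_free_diff[OF subspace_relations] free_diff_simps diff_word_relations)
  then show ?thesis by blast
qed

definition tensor_d :: "nat \<Rightarrow> ('a list \<Rightarrow>\<^sub>0 'k) set \<Rightarrow> ('a list \<Rightarrow>\<^sub>0 'k) set"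
  where "tensor_d n = restrict (pm.induced_map (free_part n) (cls n) (cls n) free_diff) (carrier (tensor_power n))"

lemma tensor_d_cls: "z \<in> free_part n \<Longrightarrow> tensor_d n (cls n z) = cls n (free_diff z)"
  unfolding tensor_d_def
  using pm.induced_map_apply[OF presents_tensor_power presents_tensor_power endo_free_diff free_diff_free_part free_diff_relations]
    cls_simps(8) by simp

lemma module_tensor_power: "Module.module (ring_of_type_algebra :: 'k ring) (tensor_power n)"
  by (rule pm.presents_module[OF presents_tensor_power])

lemma tensor_d_hom: "tensor_d n \<in> mod_hom ring_of_type_algebra (tensor_power n) (tensor_power n)"
proof -
  interpret M: Module.module "ring_of_type_algebra :: 'k ring" "tensor_power n"
    by (rule module_tensor_power)
  show ?thesis
    using pm.induced_map_hom[OF presents_tensor_power presents_tensor_power endo_free_diff free_diff_free_part free_diff_relations, of n]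
    unfolding mod_hom_def tensor_d_def by (auto simp: Pi_iff)
qed

lemma grading_inv_prefix:
  assumes "homogeneous ds us" "length pre + length us + length vs = n"
  shows "gen (pre @ map grading_inv us @ vs) - pm_scale ((-1) ^ sum_list ds) (gen (pre @ us @ vs)) \<in> tensor_relations n"
  using assms(1)[unfolded homogeneous_def] assms(2)
proof (induction ds us arbitrary: pre rule: list_all2_induct)
  case Nil
  then show ?case using pm.subspace_0[OF subspace_relations] by simp
next
  case (Cons d ds x us)
  let ?c = "(-1) ^ sum_list ds :: 'k"
  have 1: "gen ((pre @ [grading_inv x]) @ map grading_inv us @ vs) - pm_scale ?c (gen ((pre @ [grading_inv x]) @ us @ vs)) \<in> tensor_relations n"
    by (rule Cons.IH) (use Cons.prems in simp)
  have "gen (pre @ scale ((-1) ^ d) x # us @ vs) - pm_scale ((-1) ^ d) (gen (pre @ x # us @ vs)) \<in> tensor_relations n"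
    by (rule relation_scale) (use Cons.prems in simp)
  then have 2: "pm_scale ?c (gen (pre @ grading_inv x # us @ vs) - pm_scale ((-1) ^ d) (gen (pre @ x # us @ vs)))
      \<in> tensor_relations n"
    using Cons.hyps(1) by (intro pm.subspace_scale[OF subspace_relations]) (simp add: grading_inv_G)
  show ?case
    using pm.subspace_add[OF subspace_relations 1 2]
    by (simp add: pm.scale_right_diff_distrib power_add mult.commute)
qed

lemma homogeneous_nth: "homogeneous ds xs \<Longrightarrow> i < length xs \<Longrightarrow> xs ! i \<in> G (ds ! i)"
  unfolding homogeneous_def by (rule list_all2_nthD2)

lemma homogeneous_take: "homogeneous ds xs \<Longrightarrow> homogeneous (take i ds) (take i xs)"
  unfolding homogeneous_def by (rule list_all2_takeI)

text \<open>The differential of a homogeneous word, with explicit signs; it agrees with \<open>diff_word\<close> up to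
relations.\<close>

definition signed_diff :: "nat list \<Rightarrow> 'a list \<Rightarrow> ('a list \<Rightarrow>\<^sub>0 'k)"
  where "signed_diff ds xs = (\<Sum>i<length xs. pm_scale ((-1) ^ sum_list (take i ds)) (gen (xs[i := phi (xs ! i)])))"

lemma diff_word_signed_diff:
  assumes "homogeneous ds xs" "length xs = n"
  shows "diff_word xs - signed_diff ds xs \<in> tensor_relations n"
proof -
  have "gen (diff_term i xs) - pm_scale ((-1) ^ sum_list (take i ds)) (gen (xs[i := phi (xs ! i)])) \<in> tensor_relations n"
    if "i < length xs" for i
    using grading_inv_prefix[OF homogeneous_take[OF assms(1)], of "[]" i "phi (xs ! i) # drop (Suc i) xs" n] that assms(2)
    by (simp add: diff_term_def upd_conv_take_nth_drop)
  then have "(\<Sum>i<length xs. gen (diff_term i xs) - pm_scale ((-1) ^ sum_list (take i ds)) (gen (xs[i := phi (xs ! i)])))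
      \<in> tensor_relations n"
    by (intro pm.subspace_sum[OF subspace_relations]) simp
  then show ?thesis by (simp add: diff_word_def signed_diff_def sum_subtractf)
qed

lemma signed_diff_free_part: "length xs = n \<Longrightarrow> signed_diff ds xs \<in> free_part n"
  unfolding signed_diff_def
  by (intro pm.subspace_sum[OF subspace_free_part] pm.subspace_scale[OF subspace_free_part] gen_free_part) simp

lemma tensor_d_tensor:
  assumes "homogeneous ds xs" "length xs = n"
  shows "tensor_d n (tensor xs) = cls n (signed_diff ds xs)"
proof -
  have "tensor_d n (tensor xs) = cls n (diff_word xs)"
    using tensor_d_cls[OF gen_free_part[OF assms(2)]] by (simp add: tensor_cls assms(2) free_diff_simps)
  then show ?thesis
    using cls_eq_iff[OF diff_word_free_part[OF assms(2)] signed_diff_free_part[OF assms(2)]] diff_word_signed_diff[OF assms] by simp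
qed

lemma cls_signed_diff:
  assumes "length xs = n"
  shows "(\<Oplus>\<^bsub>tensor_power n\<^esub> i \<in> {..<n}. (-1) ^ sum_list (take i ds)
      \<odot>\<^bsub>tensor_power n\<^esub> tensor (xs[i := phi (xs ! i)])) = cls n (signed_diff ds xs)"
proof -
  interpret M: Module.module "ring_of_type_algebra :: 'k ring" "tensor_power n"
    by (rule module_tensor_power)
  let ?f = "\<lambda>i. pm_scale ((-1) ^ sum_list (take i ds)) (gen (xs[i := phi (xs ! i)]))"
  have f: "?f i \<in> free_part n" for i
    using assms by (intro pm.subspace_scale[OF subspace_free_part] gen_free_part) simp
  have "(\<Oplus>\<^bsub>tensor_power n\<^esub> i \<in> {..<n}. (-1) ^ sum_list (take i ds)
      \<odot>\<^bsub>tensor_power n\<^esub> tensor (xs[i := phi (xs ! i)])) = (\<Oplus>\<^bsub>tensor_power n\<^esub> i \<in> {..<n}. cls n (?f i))"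
    using assms by (simp add: tensor_cls cls_simps(6) gen_free_part)
  also have "\<dots> = cls n (\<Sum>i<n. ?f i)"
    using f by (intro pm.presents_finsum[OF presents_tensor_power])
  finally show ?thesis by (simp add: signed_diff_def assms)
qed

text \<open>Uniqueness of \<open>tensor_diff\<close>, because the tensor power is generated by homogeneous tensors.\<close>

lemma hom_eqI:
  assumes "h \<in> mod_hom ring_of_type_algebra (tensor_power n) (tensor_power n)"
    "h' \<in> mod_hom ring_of_type_algebra (tensor_power n) (tensor_power n)"
    and ext: "h \<in> extensional (carrier (tensor_power n))" "h' \<in> extensional (carrier (tensor_power n))"
    and eq: "\<And>ds xs. homogeneous ds xs \<Longrightarrow> length xs = n \<Longrightarrow> h (tensor xs) = h' (tensor xs)"
  shows "h = h'"
proof -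
  let ?Q = "{z \<in> free_part n. h (cls n z) = h' (cls n z)}"
  have lin: "k (cls n (z + z')) = k (cls n z) \<oplus>\<^bsub>tensor_power n\<^esub> k (cls n z')"
    "k (cls n (pm_scale c z)) = c \<odot>\<^bsub>tensor_power n\<^esub> k (cls n z)"
    if "k \<in> {h, h'}" "z \<in> free_part n" "z' \<in> free_part n" for k c z z'
  proof -
    have k: "k \<in> mod_hom ring_of_type_algebra (tensor_power n) (tensor_power n)" using that(1) assms(1,2) by blast
    then show "k (cls n (z + z')) = k (cls n z) \<oplus>\<^bsub>tensor_power n\<^esub> k (cls n z')"
      "k (cls n (pm_scale c z)) = c \<odot>\<^bsub>tensor_power n\<^esub> k (cls n z)"
      using cls_simps(5)[OF that(2,3)] cls_simps(6)[OF that(2)] cls_simps(8)[OF that(2)] cls_simps(8)[OF that(3)]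
      unfolding mod_hom_def by (auto simp: ring_of_type_algebra_def)
  qed
  interpret M: Module.module "ring_of_type_algebra :: 'k ring" "tensor_power n"
    by (rule module_tensor_power)
  have kc: "k (cls n z) \<in> carrier (tensor_power n)" if "k \<in> {h, h'}" "z \<in> free_part n" for k z
    using that assms(1,2) cls_simps(8)[OF that(2)] unfolding mod_hom_def by auto
  have zero: "k (cls n z) = \<zero>\<^bsub>tensor_power n\<^esub>" if k: "k \<in> {h, h'}" and z: "z \<in> tensor_relations n" for k z
  proof -
    have 0: "0 \<in> free_part n" using pm.subspace_0[OF subspace_free_part] .
    have "cls n z = cls n 0" using cls_simps(7)[of z n] z relations_free_part cls_simps(7)[OF 0] pm.subspace_0[OF subspace_relations] by auto
    then have "k (cls n z) = k (cls n (pm_scale 0 0))" by simp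
    also have "\<dots> = 0 \<odot>\<^bsub>tensor_power n\<^esub> k (cls n 0)" using lin(2)[OF k 0 0] .
    also have "\<dots> = \<zero>\<^bsub>tensor_power n\<^esub>"
      using M.smult_l_null[OF kc[OF k 0]] by (simp add: ring_of_type_algebra_def)
    finally show ?thesis .
  qed
  have rel: "tensor_relations n \<subseteq> ?Q" using zero[of h] zero[of h'] relations_free_part[of n] by (simp add: subset_iff)
  have Q: "pm.subspace ?Q"
    unfolding pm.subspace_def
  proof (intro conjI ballI allI)
    show "0 \<in> ?Q" using rel pm.subspace_0[OF subspace_relations] by blast
  next
    fix z z' assume "z \<in> ?Q" "z' \<in> ?Q"
    then show "z + z' \<in> ?Q"
      using lin(1)[of h z z'] lin(1)[of h' z z'] pm.subspace_add[OF subspace_free_part] by simp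
  next
    fix c z assume "z \<in> ?Q"
    then show "pm_scale c z \<in> ?Q"
      using lin(2)[of h z z c] lin(2)[of h' z z c] pm.subspace_scale[OF subspace_free_part] by simp
  qed
  have "free_part n \<subseteq> ?Q"
    by (rule homogeneous_minimal[OF Q rel]) (use eq in \<open>simp add: tensor_cls gen_free_part\<close>)
  then have Q_all: "h (cls n z) = h' (cls n z)" if "z \<in> free_part n" for z using that by (simp add: subset_iff)
  have "h t = h' t" if "t \<in> carrier (tensor_power n)" for t
  proof -
    have "t \<in> cls n ` free_part n" using that by (simp only: cls_simps(4))
    then obtain z where z: "t = cls n z" "z \<in> free_part n" by (rule imageE)
    show ?thesis unfolding z(1) by (rule Q_all[OF z(2)])
  qed
  then show ?thesis using ext by (intro extensionalityI)
qed

lemma tensor_d_extensional: "tensor_d n \<in> extensional (carrier (tensor_power n))"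
  unfolding tensor_d_def by (rule restrict_extensional)

lemma tensor_diff_tensor_d: "tensor_diff n = tensor_d n"
proof -
  let ?S = "\<lambda>ds xs. \<Oplus>\<^bsub>tensor_power n\<^esub> i \<in> {..<n}.
      (-1) ^ sum_list (take i ds) \<odot>\<^bsub>tensor_power n\<^esub> tensor (xs[i := phi (xs ! i)])"
  let ?P = "\<lambda>D. D \<in> mod_hom ring_of_type_algebra (tensor_power n) (tensor_power n) \<and>
      D \<in> extensional (carrier (tensor_power n)) \<and>
      (\<forall>ds xs. homogeneous ds xs \<and> length xs = n \<longrightarrow> D (tensor xs) = ?S ds xs)"
  have val: "tensor_d n (tensor xs) = ?S ds xs" if "homogeneous ds xs" "length xs = n" for ds xs
    unfolding tensor_d_tensor[OF that] cls_signed_diff[OF that(2)] ..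
  have tensor_d: "?P (tensor_d n)" using tensor_d_hom tensor_d_extensional val by blast
  have "h = tensor_d n" if h: "?P h" for h
  proof (rule hom_eqI)
    show "h (tensor xs) = tensor_d n (tensor xs)" if "homogeneous ds xs" "length xs = n" for ds xs
      unfolding val[OF that] using h that by blast
  qed (use h tensor_d in blast)+
  then show ?thesis unfolding tensor_diff_def using tensor_d by (intro the_equality)
qed

text \<open>A second presentation of the graded parts, by words up to relations. It is needed because the
differential of a homogeneous word may contain words with an entry \<open>0\<close> that have the wrong degree;
these are relations, but they do not lie in \<open>hom_span\<close>.\<close>

definition hom_span_rel :: "nat \<Rightarrow> nat \<Rightarrow> ('a list \<Rightarrow>\<^sub>0 'k) set"
  where "hom_span_rel n m = {z + r | z r. z \<in> hom_span n m \<and> r \<in> tensor_relations n}"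

lemma subspace_hom_span_rel: "pm.subspace (hom_span_rel n m)"
  unfolding hom_span_rel_def hom_span_def by (rule pm.subspace_sums[OF pm.subspace_span subspace_relations])

lemma hom_span_rel_relations: "tensor_relations n \<subseteq> hom_span_rel n m" and hom_span_rel_hom_span: "hom_span n m \<subseteq> hom_span_rel n m"
proof -
  have "0 \<in> hom_span n m" "0 \<in> tensor_relations n"
    unfolding hom_span_def by (rule pm.span_zero, rule pm.subspace_0[OF subspace_relations])
  then show "tensor_relations n \<subseteq> hom_span_rel n m" "hom_span n m \<subseteq> hom_span_rel n m"
    unfolding hom_span_rel_def by (force, metis (mono_tags, lifting) add.right_neutral mem_Collect_eq subsetI)
qed

lemma hom_span_rel_free_part: "hom_span_rel n m \<subseteq> free_part n"
  unfolding hom_span_rel_def using hom_span_free_part relations_free_part pm.subspace_add[OF subspace_free_part] by blast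

lemma presents_tensor_graded_hom_span_rel: "pm.presents (tensor_graded n m) (hom_span_rel n m) (tensor_relations n) (cls n)"
proof -
  have "cls n ` hom_span_rel n m = cls n ` hom_span n m"
  proof (rule equalityI[OF subsetI image_mono[OF hom_span_rel_hom_span]])
    fix t assume "t \<in> cls n ` hom_span_rel n m"
    then obtain z r where z: "z \<in> hom_span n m" "r \<in> tensor_relations n" "t = cls n (z + r)"
      unfolding hom_span_rel_def by blast
    have zf: "z \<in> free_part n" and "r \<in> free_part n" using z(1,2) hom_span_free_part relations_free_part by blast+
    then have "z + r \<in> free_part n" using pm.subspace_add[OF subspace_free_part] by blast
    then have "t = cls n z" using cls_eq_iff[OF _ zf] z(2,3) by simp
    then show "t \<in> cls n ` hom_span n m" using z by blast
  qed
  moreover have "tensor_graded n m = (tensor_power n)\<lparr>carrier := cls n ` hom_span n m\<rparr>"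
    by (simp add: tensor_graded_def cls_def[abs_def] hom_span_def hom_words_def)
  ultimately show ?thesis
    using pm.presents_restrict[OF presents_tensor_power subspace_hom_span_rel hom_span_rel_free_part, of n m] hom_span_rel_relations
    by (simp add: Int_absorb1)
qed

lemma gen_zero_relation:
  assumes "length us + 1 + length vs = n"
  shows "gen (us @ 0 # vs) \<in> tensor_relations n"
  using relation_scale[OF assms, of 0 0] by simp

lemma upd_hom_span_rel:
  assumes "homogeneous ds xs" "length xs = n" "sum_list ds = Suc m" "i < n"
  shows "gen (xs[i := phi (xs ! i)]) \<in> hom_span_rel n m"
proof (cases "ds ! i")
  case 0
  then have "phi (xs ! i) = 0" using homogeneous_nth[OF assms(1), of i] assms phi_graded_0[of "xs ! i"] by simp
  then have "xs[i := phi (xs ! i)] = take i xs @ 0 # drop (Suc i) xs"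
    using assms by (simp add: upd_conv_take_nth_drop)
  then show ?thesis
    using gen_zero_relation[of "take i xs" "drop (Suc i) xs" n] assms hom_span_rel_relations by auto
next
  case (Suc d)
  have l: "length ds = n" using assms homogeneous_zip(1) by metis
  have "homogeneous (ds[i := d]) (xs[i := phi (xs ! i)])"
    using assms(1) homogeneous_nth[OF assms(1), of i] assms Suc phi_graded unfolding homogeneous_def
    by (intro list_all2_update_cong) auto
  moreover have "sum_list (ds[i := d]) = m"
    using assms l Suc by (simp add: sum_list_update)
  ultimately show ?thesis
    using hom_spanI[of "ds[i := d]" "xs[i := phi (xs ! i)]" n m] assms hom_span_rel_hom_span by auto
qed

lemma free_diff_hom_span: "z \<in> hom_span n (Suc m) \<Longrightarrow> free_diff z \<in> hom_span_rel n m"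
proof -
  have "hom_words n (Suc m) \<subseteq> {z. free_diff z \<in> hom_span_rel n m}"
  proof
    fix z assume "z \<in> hom_words n (Suc m)"
    then obtain ds xs where h: "homogeneous ds xs" "length xs = n" "sum_list ds = Suc m" "z = gen xs"
      unfolding hom_words_def by blast
    have "signed_diff ds xs \<in> hom_span_rel n m"
      unfolding signed_diff_def using upd_hom_span_rel[OF h(1-3)] h(2)
      by (intro pm.subspace_sum[OF subspace_hom_span_rel] pm.subspace_scale[OF subspace_hom_span_rel]) simp
    moreover have "diff_word xs - signed_diff ds xs \<in> hom_span_rel n m" using diff_word_signed_diff[OF h(1,2)] hom_span_rel_relations by blast
    ultimately have "(diff_word xs - signed_diff ds xs) + signed_diff ds xs \<in> hom_span_rel n m"
      by (intro pm.subspace_add[OF subspace_hom_span_rel])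
    then show "z \<in> {z. free_diff z \<in> hom_span_rel n m}" by (simp add: h(4) free_diff_simps)
  qed
  then have "hom_span n (Suc m) \<subseteq> {z. free_diff z \<in> hom_span_rel n m}"
    unfolding hom_span_def by (rule pm.span_minimal[OF _ subspace_vimage_free_diff[OF subspace_hom_span_rel]])
  then show "z \<in> hom_span n (Suc m) \<Longrightarrow> free_diff z \<in> hom_span_rel n m" by blast
qed

lemma cochain_sum:
  assumes f: "f \<in> carrier (cochains n m)" and z: "\<And>i. i < k \<Longrightarrow> z i \<in> hom_span_rel (n + 1) m"
  shows "f (cls (n + 1) (\<Sum>i<(k :: nat). pm_scale (c i) (z i))) = (\<Sum>i<k. c i * f (cls (n + 1) (z i)))"
  using z
proof (induction k)
  case 0
  show ?case
    using pm.dual_zero[OF presents_tensor_graded_hom_span_rel f[unfolded cochains_def] pm.subspace_0[OF subspace_relations]]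
    by simp
next
  case (Suc k)
  have "(\<Sum>i<k. pm_scale (c i) (z i)) \<in> hom_span_rel (n + 1) m"
    using Suc.prems by (intro pm.subspace_sum[OF subspace_hom_span_rel] pm.subspace_scale[OF subspace_hom_span_rel]) simp
  then have "f (cls (n + 1) (pm_scale (c k) (z k) + (\<Sum>i<k. pm_scale (c i) (z i))))
      = c k * f (cls (n + 1) (z k)) + f (cls (n + 1) (\<Sum>i<k. pm_scale (c i) (z i)))"
    using Suc.prems by (intro pm.dual_linear[OF presents_tensor_graded_hom_span_rel f[unfolded cochains_def]]) simp_all
  then show ?case using Suc by (simp add: add.commute)
qed

lemma op_delta_cochain:
  assumes f: "f \<in> carrier (cochains n m)"
  shows "op_delta n m f \<in> carrier (cochains n (m + 1))"
    and "z \<in> hom_span (n + 1) (m + 1) \<Longrightarrow> op_delta n m f (cls (n + 1) z) = (-1) ^ m * f (cls (n + 1) (free_diff z))"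
proof -
  let ?M = "tensor_graded (n + 1) (m + 1)"
  note P = pm.presentsD[OF presents_tensor_graded[of "n + 1" "m + 1"]]
  have val: "op_delta n m f (cls (n + 1) z) = (-1) ^ m * f (cls (n + 1) (free_diff z))" if "z \<in> hom_span (n + 1) (m + 1)" for z
    unfolding op_delta_def tensor_diff_tensor_d using P(8)[OF that] tensor_d_cls[OF subsetD[OF hom_span_free_part that]] by simp
  then show "z \<in> hom_span (n + 1) (m + 1) \<Longrightarrow> op_delta n m f (cls (n + 1) z) = (-1) ^ m * f (cls (n + 1) (free_diff z))" .
  have lin: "f (cls (n + 1) (free_diff (pm_scale c x + y)))
      = c * f (cls (n + 1) (free_diff x)) + f (cls (n + 1) (free_diff y))"
    if "x \<in> hom_span (n + 1) (m + 1)" "y \<in> hom_span (n + 1) (m + 1)" for c x y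
    unfolding free_diff_simps using that
    by (intro pm.dual_linear[OF presents_tensor_graded_hom_span_rel f[unfolded cochains_def]] free_diff_hom_span) simp_all
  have zero: "f (cls (n + 1) (free_diff b)) = 0" if "b \<in> hom_span (n + 1) (m + 1) \<inter> tensor_relations (n + 1)" for b
    using that free_diff_relations
    by (intro pm.dual_zero[OF presents_tensor_graded_hom_span_rel f[unfolded cochains_def]]) auto
  obtain f' where f': "f' \<in> carrier (dual_module ?M)"
    "\<And>z. z \<in> hom_span (n + 1) (m + 1) \<Longrightarrow> f' (cls (n + 1) z) = (-1) ^ m * f (cls (n + 1) (free_diff z))"
  proof (rule pm.dual_exists[OF presents_tensor_graded[of "n + 1" "m + 1"]])
    show "(-1) ^ m * f (cls (n + 1) (free_diff (pm_scale c x + y)))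
        = c * ((-1) ^ m * f (cls (n + 1) (free_diff x))) + (-1) ^ m * f (cls (n + 1) (free_diff y))"
      if "x \<in> hom_span (n + 1) (m + 1)" "y \<in> hom_span (n + 1) (m + 1)" for c x y
      unfolding lin[OF that] by (simp add: distrib_left mult.left_commute)
    show "(-1) ^ m * f (cls (n + 1) (free_diff b)) = 0"
      if "b \<in> hom_span (n + 1) (m + 1) \<inter> tensor_relations (n + 1)" for b
      unfolding zero[OF that] by simp
  qed blast
  have "op_delta n m f = f'"
  proof
    fix t
    show "op_delta n m f t = f' t"
    proof (cases "t \<in> carrier ?M")
      case True
      then obtain z where "z \<in> hom_span (n + 1) (m + 1)" "t = cls (n + 1) z" using P(4) by blast
      then show ?thesis using val f'(2) by simp
    next
      case False
      then show ?thesis using f'(1) by (simp add: op_delta_def dual_module_def)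
    qed
  qed
  then show "op_delta n m f \<in> carrier (cochains n (m + 1))" using f'(1) by (simp add: cochains_def)
qed

text \<open>Entries of degree \<open>0\<close> have to be treated separately: their differential is \<open>0\<close>, so that both sides
vanish, although the degrees do not match.\<close>

lemma op_delta_word_cochain:
  assumes "cochain_fun g"
  shows "op_delta n m (word_cochain n m g) = word_cochain n (m + 1) (\<lambda>w. (-1) ^ m * W.word_diff g w)"
proof -
  have "cochain_of n (m + 1) (\<lambda>ds xs. (-1) ^ m * W.word_diff g (zip ds xs)) = op_delta n m (word_cochain n m g)"
  proof (rule cochain_of_eqI[OF op_delta_cochain(1)[OF word_cochain(1)[OF assms]]])
    fix ds xs assume h: "homogeneous ds xs" "length xs = n + 1" "sum_list ds = m + 1"
    let ?f = "word_cochain n m g" and ?w = "zip ds xs"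
    note f = word_cochain(1)[OF assms, of n m]
    have m: "sum_list ds = Suc m" using h by simp
    have ld: "length ds = n + 1" using homogeneous_zip(1)[OF h(1)] h(2) by simp
    have "op_delta n m ?f (tensor xs) = (-1) ^ m * ?f (cls (n + 1) (diff_word xs))"
      using op_delta_cochain(2)[OF f hom_spanI[OF h]] h(2) by (simp add: tensor_cls free_diff_simps)
    also have "cls (n + 1) (diff_word xs) = cls (n + 1) (signed_diff ds xs)"
      using cls_eq_iff[OF diff_word_free_part[OF h(2)] signed_diff_free_part[OF h(2)]] diff_word_signed_diff[OF h(1,2)] by blast
    also have "?f (cls (n + 1) (signed_diff ds xs))
        = (\<Sum>i<n + 1. (-1) ^ sum_list (take i ds) * ?f (cls (n + 1) (gen (xs[i := phi (xs ! i)]))))"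
      unfolding signed_diff_def h(2) by (rule cochain_sum[OF f]) (rule upd_hom_span_rel[OF h(1,2) m])
    also have "\<dots> = (\<Sum>i<n + 1. (-1) ^ W.wdeg (take i ?w) * g (?w[i := lphi (?w ! i)]))"
    proof (rule sum.cong[OF refl])
      fix i assume "i \<in> {..<n + 1}"
      then have i: "i < n + 1" by simp
      have wi: "?w ! i = (ds ! i, xs ! i)" using i h(2) ld by simp
      have x: "xs ! i \<in> G (ds ! i)" using homogeneous_nth[OF h(1)] i h(2) by simp
      have v: "?f (cls (n + 1) (gen (xs[i := phi (xs ! i)]))) = g (?w[i := lphi (?w ! i)])"
      proof (cases "ds ! i")
        case 0
        then have p: "phi (xs ! i) = 0" using x phi_graded_0[of "xs ! i"] by simp
        have "xs[i := phi (xs ! i)] = take i xs @ 0 # drop (Suc i) xs"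
          using i h(2) p by (simp add: upd_conv_take_nth_drop)
        then have "gen (xs[i := phi (xs ! i)]) \<in> tensor_relations (n + 1)"
          using gen_zero_relation[of "take i xs" "drop (Suc i) xs" "n + 1"] i h(2) by simp
        then have "?f (cls (n + 1) (gen (xs[i := phi (xs ! i)]))) = 0"
          by (rule pm.dual_zero[OF presents_tensor_graded_hom_span_rel f[unfolded cochains_def]])
        moreover have "?w[i := lphi (?w ! i)] = take i ?w @ (ds ! i - 1, 0) # drop (Suc i) ?w"
          using i h(2) ld p wi by (simp add: upd_conv_take_nth_drop)
        ultimately show ?thesis using cochain_fun_zero_letter[OF assms] by simp
      next
        case (Suc d)
        let ?v = "zip (ds[i := d]) (xs[i := phi (xs ! i)])"
        have hv: "homogeneous (ds[i := d]) (xs[i := phi (xs ! i)])"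
          using h(1) x Suc phi_graded unfolding homogeneous_def by (intro list_all2_update_cong) auto
        have "sum_list (ds[i := d]) = m" using h(3) ld Suc i by (simp add: sum_list_update)
        then have "valid_word n m ?v" using homogeneous_zip[OF hv] h(2) by (simp add: valid_word_def)
        from word_cochain(2)[OF assms this] have "?f (tensor (xs[i := phi (xs ! i)])) = g ?v"
          by (simp only: homogeneous_zip(3)[OF hv])
        moreover have "?v = ?w[i := lphi (?w ! i)]" using wi Suc by (simp add: update_zip)
        ultimately show ?thesis by (simp add: tensor_cls h(2))
      qed
      have "W.wdeg (take i ?w) = sum_list (take i ds)"
        using homogeneous_zip(5)[OF homogeneous_take[OF h(1)]] by (simp add: take_zip)
      then show "(-1) ^ sum_list (take i ds) * ?f (cls (n + 1) (gen (xs[i := phi (xs ! i)])))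
          = (-1) ^ W.wdeg (take i ?w) * g (?w[i := lphi (?w ! i)])"
        using v by simp
    qed
    also have "\<dots> = W.word_diff g ?w" using h(2) ld by (simp add: W.word_diff_closed)
    finally show "op_delta n m ?f (tensor xs) = (-1) ^ m * W.word_diff g ?w" .
  qed
  then show ?thesis unfolding word_cochain_def[of n "m + 1"] ..
qed

end

section \<open>The double complex of families of words\<close>

definition family_scale :: "'k::field \<Rightarrow> ('i \<Rightarrow> 'w \<Rightarrow> 'k) \<Rightarrow> ('i \<Rightarrow> 'w \<Rightarrow> 'k)"
  where "family_scale c x = (\<lambda>i w. c * x i w)"

interpretation fs: linear_quotients "family_scale :: 'k::field \<Rightarrow> ('i \<Rightarrow> 'w \<Rightarrow> 'k) \<Rightarrow> ('i \<Rightarrow> 'w \<Rightarrow> 'k)"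
  by unfold_locales (simp_all add: family_scale_def fun_eq_iff algebra_simps)

context dga
begin

text \<open>A family \<open>x\<close> encodes an element of the tricomplex: \<open>x p w\<close> is the value on \<open>w\<close> of its component in
\<open>C\<^sup>q\<^sup>-\<^sup>p(A)\<^sup>r\<close>, where \<open>q - p + 1\<close> and \<open>r\<close> are the length and the degree of \<open>w\<close>. All components live in one
vector space, and only the first index has to be kept.\<close>

definition families :: "(nat \<Rightarrow> (nat \<times> 'a) list \<Rightarrow> 'k) set"
  where "families = {x. \<forall>i. cochain_fun (x i) \<and> x i [] = 0}"

text \<open>\<open>P i n m\<close> tells whether a component in \<open>C\<^sup>n(A)\<^sup>m\<close> at first index \<open>i\<close> is allowed.\<close>

definition supp_on :: "(nat \<Rightarrow> nat \<Rightarrow> nat \<Rightarrow> bool) \<Rightarrow> (nat \<Rightarrow> (nat \<times> 'a) list \<Rightarrow> 'k) set"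
  where "supp_on P = {x \<in> families. \<forall>i w. w \<noteq> [] \<longrightarrow> \<not> P i (length w - 1) (W.wdeg w) \<longrightarrow> x i w = 0}"

lemma supp_onD:
  assumes "x \<in> supp_on P"
  shows "cochain_fun (x i)" "x i [] = 0" "w \<noteq> [] \<Longrightarrow> \<not> P i (length w - 1) (W.wdeg w) \<Longrightarrow> x i w = 0"
  using assms by (auto simp: supp_on_def families_def)

lemma subspace_supp_on: "fs.subspace (supp_on P)"
  unfolding fs.subspace_def supp_on_def families_def family_scale_def plus_fun_def zero_fun_def
  by (auto intro: cochain_fun_plus cochain_fun_smult simp: cochain_fun_null)

lemma supp_on_mono: "(\<And>i n m. P i n m \<Longrightarrow> Q i n m) \<Longrightarrow> supp_on P \<subseteq> supp_on Q"
  unfolding supp_on_def by blast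

lemma cochain_fun_family:
  assumes "\<And>n m. cochain_fun (F n m)"
  shows "cochain_fun (\<lambda>w. F (length w) (W.wdeg w) w)"
  unfolding cochain_fun_def using cochain_funD(1)[OF assms] cochain_funD(2)[OF assms] by simp

definition to_sum :: "'i set \<Rightarrow> ('i \<Rightarrow> nat) \<Rightarrow> ('i \<Rightarrow> nat) \<Rightarrow> ('i \<Rightarrow> nat) \<Rightarrow>
    (nat \<Rightarrow> (nat \<times> 'a) list \<Rightarrow> 'k) \<Rightarrow> 'i \<Rightarrow> ('a list \<Rightarrow>\<^sub>0 'k) set \<Rightarrow> 'k"
  where "to_sum I a n m x = (\<lambda>k\<in>I. word_cochain (n k) (m k) (x (a k)))"

text \<open>This covers both the total complex, indexed by triples, and the columns, indexed by one number: the
functions \<open>a\<close>, \<open>n\<close>, \<open>m\<close> give the first index and the bidegree that belong to an index of the sum.\<close>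

lemma presents_direct_sum:
  assumes fin: "finite I"
    and inj: "\<And>k l. k \<in> I \<Longrightarrow> l \<in> I \<Longrightarrow> a k = a l \<Longrightarrow> n k = n l \<Longrightarrow> m k = m l \<Longrightarrow> k = l"
    and P: "\<And>i j r. P i j r \<longleftrightarrow> (\<exists>k\<in>I. a k = i \<and> n k = j \<and> m k = r)"
  shows "fs.presents (direct_sum_module I (\<lambda>k. cochains (n k) (m k))) (supp_on P) {0} (to_sum I a n m)"
    (is "fs.presents ?M _ _ ?\<pi>")
  unfolding fs.presents_def
proof (intro conjI ballI allI)
  show "fs.subspace (supp_on P)" by (rule subspace_supp_on)
  show "fs.subspace {0 :: nat \<Rightarrow> (nat \<times> 'a) list \<Rightarrow> 'k}" by (rule fs.subspace_single_0)
  show "{0} \<subseteq> supp_on P" using fs.subspace_0[OF subspace_supp_on] by simp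
  show "?\<pi> ` supp_on P = carrier ?M"
  proof (intro equalityI subsetI)
    fix y assume "y \<in> ?\<pi> ` supp_on P"
    then obtain x where x: "x \<in> supp_on P" "y = ?\<pi> x" by blast
    show "y \<in> carrier ?M"
      unfolding x(2) direct_sum_module_def to_sum_def
      using fin word_cochain(1)[OF supp_onD(1)[OF x(1)]] by (auto intro: finite_subset[OF _ fin])
  next
    fix y assume y: "y \<in> carrier ?M"
    then have yE: "y \<in> (\<Pi>\<^sub>E k\<in>I. carrier (cochains (n k) (m k)))" by (simp add: direct_sum_module_def)
    \<comment> \<open>the second argument is the length of the word, which exceeds the cochain degree by one\<close>
    define F where "F i l d = (if \<exists>k\<in>I. a k = i \<and> l = n k + 1 \<and> m k = d
      then word_fun (l - 1) d (y (THE k. k \<in> I \<and> a k = i \<and> l = n k + 1 \<and> m k = d)) else (\<lambda>w. 0))" for i l d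
    have Fk: "F (a k) (n k + 1) (m k) = word_fun (n k) (m k) (y k)" if k: "k \<in> I" for k
    proof -
      have "(THE l. l \<in> I \<and> a l = a k \<and> n k + 1 = n l + 1 \<and> m l = m k) = k"
        by (rule the_equality) (use k inj in auto)
      then show ?thesis using k by (auto simp: F_def)
    qed
    have F: "cochain_fun (F i l d)" for i l d
    proof (cases "\<exists>k\<in>I. a k = i \<and> l = n k + 1 \<and> m k = d")
      case True
      then obtain k where k: "k \<in> I" "i = a k" "l = n k + 1" "d = m k" by blast
      show ?thesis unfolding k(2-4) Fk[OF k(1)] using yE k(1) by (intro cochain_fun_word_fun) auto
    next
      case False
      then show ?thesis unfolding F_def by (simp only: if_False cochain_fun_null)
    qed
    let ?x = "\<lambda>i w. F i (length w) (W.wdeg w) w"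
    have "?x i [] = 0" for i by (simp add: F_def)
    moreover have "?x i w = 0" if "w \<noteq> []" "\<not> P i (length w - 1) (W.wdeg w)" for i w
    proof -
      have "\<not> (\<exists>k\<in>I. a k = i \<and> length w = n k + 1 \<and> m k = W.wdeg w)" using that(2) unfolding P by auto
      then show ?thesis unfolding F_def by (simp only: if_False)
    qed
    moreover have "cochain_fun (?x i)" for i by (rule cochain_fun_family) (rule F)
    ultimately have x: "?x \<in> supp_on P" unfolding supp_on_def families_def by blast
    have "?\<pi> ?x = y"
    proof (rule extensionalityI[of _ I])
      show "?\<pi> ?x \<in> extensional I" by (simp add: to_sum_def)
      show "y \<in> extensional I" using yE by (simp add: PiE_def)
      fix k assume k: "k \<in> I"
      have "word_cochain (n k) (m k) (?x (a k)) = word_cochain (n k) (m k) (word_fun (n k) (m k) (y k))"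
        by (rule word_cochain_cong) (use Fk[OF k] in \<open>simp add: valid_word_def\<close>)
      also have "\<dots> = y k" using yE k by (intro word_cochain_word_fun) auto
      finally show "?\<pi> ?x k = y k" using k by (simp add: to_sum_def)
    qed
    then show "y \<in> ?\<pi> ` supp_on P" using x by blast
  qed
next
  fix x y assume xy: "x \<in> supp_on P" "y \<in> supp_on P"
  note s = supp_onD(1)[OF xy(1)] supp_onD(1)[OF xy(2)]
  have "word_cochain (n k) (m k) ((x + y) (a k)) = (\<lambda>t. word_cochain (n k) (m k) (x (a k)) t + word_cochain (n k) (m k) (y (a k)) t)" for k
    using word_cochain_add[OF s cochain_fun_plus[OF s]] by (simp add: plus_fun_def fun_eq_iff)
  then show "?\<pi> (x + y) = ?\<pi> x \<oplus>\<^bsub>?M\<^esub> ?\<pi> y"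
    by (simp add: to_sum_def direct_sum_module_def cochains_def dual_module_def restrict_def fun_eq_iff)
next
  fix c x assume x: "x \<in> supp_on P"
  note s = supp_onD(1)[OF x]
  have "word_cochain (n k) (m k) (family_scale c x (a k)) = (\<lambda>t. c * word_cochain (n k) (m k) (x (a k)) t)" for k
    using word_cochain_scale[OF s cochain_fun_smult[OF s]] by (simp add: family_scale_def fun_eq_iff)
  then show "?\<pi> (family_scale c x) = c \<odot>\<^bsub>?M\<^esub> ?\<pi> x"
    by (simp add: to_sum_def direct_sum_module_def cochains_def dual_module_def restrict_def fun_eq_iff)
next
  fix x assume x: "x \<in> supp_on P"
  have z: "\<zero>\<^bsub>?M\<^esub> = (\<lambda>k\<in>I. (\<lambda>t. 0))"
    by (simp add: direct_sum_module_def cochains_def dual_module_def)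
  show "?\<pi> x = \<zero>\<^bsub>?M\<^esub> \<longleftrightarrow> x \<in> {0}"
  proof
    assume 0: "?\<pi> x = \<zero>\<^bsub>?M\<^esub>"
    have "x i w = 0" for i w
    proof (rule ccontr)
      assume nz: "x i w \<noteq> 0"
      then have "w \<noteq> []" "W.good_word w" using supp_onD(2)[OF x] cochain_funD(1)[OF supp_onD(1)[OF x]] by blast+
      moreover from this nz have "P i (length w - 1) (W.wdeg w)" using supp_onD(3)[OF x] by blast
      ultimately obtain k where k: "k \<in> I" "a k = i" "valid_word (n k) (m k) w"
        unfolding P valid_word_def by (auto simp: Suc_diff_1)
      have "?\<pi> x k = (\<lambda>t. 0)" unfolding 0 z using k(1) by simp
      then have "word_cochain (n k) (m k) (x i) (tensor (map snd w)) = 0" using k by (simp add: to_sum_def)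
      then show False using word_cochain(2)[OF supp_onD(1)[OF x] k(3), of i] nz by simp
    qed
    then show "x \<in> {0}" by (simp add: fun_eq_iff)
  next
    assume "x \<in> {0}"
    then have "x (a k) = (\<lambda>w. 0)" for k by (simp add: fun_eq_iff)
    moreover have "word_cochain (n k) (m k) (\<lambda>w. 0) = (\<lambda>t. 0)" for k
      using word_cochain_scale[OF cochain_fun_null, of 0 "n k" "m k"] by (simp add: cochain_fun_null fun_eq_iff)
    ultimately have "word_cochain (n k) (m k) (x (a k)) = (\<lambda>t. 0)" for k by simp
    then show "?\<pi> x = \<zero>\<^bsub>?M\<^esub>" by (simp add: to_sum_def z)
  qed
qed

text \<open>The horizontal differential is \<open>b\<close>, and the vertical one is \<open>B\<close>, which raises the first index, plus the
signed differential of the algebra.\<close>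

definition hor :: "(nat \<Rightarrow> (nat \<times> 'a) list \<Rightarrow> 'k) \<Rightarrow> nat \<Rightarrow> (nat \<times> 'a) list \<Rightarrow> 'k"
  where "hor x i = truncate (W.hoch (x i))"

definition ver_B :: "(nat \<Rightarrow> (nat \<times> 'a) list \<Rightarrow> 'k) \<Rightarrow> nat \<Rightarrow> (nat \<times> 'a) list \<Rightarrow> 'k"
  where "ver_B x i w = (if 0 < i then W.connes (x (i - 1)) w else 0)"

definition ver_delta :: "(nat \<Rightarrow> (nat \<times> 'a) list \<Rightarrow> 'k) \<Rightarrow> nat \<Rightarrow> (nat \<times> 'a) list \<Rightarrow> 'k"
  where "ver_delta x i = truncate (W.delta (x i))"

definition ver :: "(nat \<Rightarrow> (nat \<times> 'a) list \<Rightarrow> 'k) \<Rightarrow> nat \<Rightarrow> (nat \<times> 'a) list \<Rightarrow> 'k"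
  where "ver x = ver_B x + ver_delta x"

lemma op_Nil [simp]: "W.hoch g [] = 0" "W.connes g [] = 0" "W.delta g [] = 0"
  by (simp_all add: W.hoch_def W.bprime_def W.connes_def W.cyclic_norm_def W.delta_def)

lemma truncate_Nil [simp]: "truncate g [] = g []"
  by (simp add: truncate_def)

lemma cochain_fun_hor: "x \<in> families \<Longrightarrow> cochain_fun (hor x i)"
  and cochain_fun_ver_B: "x \<in> families \<Longrightarrow> cochain_fun (ver_B x i)"
  and cochain_fun_ver_delta: "x \<in> families \<Longrightarrow> cochain_fun (ver_delta x i)"
proof -
  assume "x \<in> families"
  then have s: "cochain_fun (x j)" for j by (simp add: families_def)
  show "cochain_fun (hor x i)" unfolding hor_def by (rule cochain_fun_truncate[OF multilinear_hoch[OF s]])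
  show "cochain_fun (ver_B x i)"
    using cochain_fun_connes[OF s[of "i - 1"]] cochain_fun_null by (cases "0 < i") (simp_all add: ver_B_def[abs_def])
  show "cochain_fun (ver_delta x i)"
    unfolding ver_delta_def W.delta_def[abs_def]
    using multilinear_wlen[OF multilinear_word_diff[OF s[of i]], of "\<lambda>l d. (-1) ^ (l + d)"] by (rule cochain_fun_truncate)
qed

lemma cochain_fun_ver: "x \<in> families \<Longrightarrow> cochain_fun (ver x i)"
  using cochain_fun_plus[OF cochain_fun_ver_B[of x i] cochain_fun_ver_delta[of x i]] by (simp add: ver_def plus_fun_def)

lemma hor_families: "x \<in> families \<Longrightarrow> hor x \<in> families" and ver_families: "x \<in> families \<Longrightarrow> ver x \<in> families"
  using cochain_fun_hor[of x] cochain_fun_ver[of x] by (auto simp: families_def hor_def ver_def ver_B_def ver_delta_def)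

lemma connes_null: "W.connes (\<lambda>w. 0 :: 'k) w = 0"
  using W.connes_scale[of "0 :: 'k" "\<lambda>w. 0"] by (simp add: fun_eq_iff)

lemma endo_hor: "fs.endo hor"
proof -
  have "truncate (\<lambda>w. g w + h w) w = truncate g w + truncate h w" "truncate (\<lambda>w. c * g w) w = c * truncate g w" for g h c w
    by (simp_all add: truncate_def)
  then show ?thesis
    unfolding fs.endo_def hor_def family_scale_def plus_fun_def by (simp add: W.hoch_add W.hoch_scale fun_eq_iff)
qed

lemma endo_ver: "fs.endo ver"
proof -
  have "truncate (\<lambda>w. g w + h w) w = truncate g w + truncate h w" "truncate (\<lambda>w. c * g w) w = c * truncate g w" for g h c w
    by (simp_all add: truncate_def)
  then show ?thesis
    unfolding fs.endo_def ver_def ver_B_def[abs_def] ver_delta_def family_scale_def plus_fun_def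
    by (simp add: W.connes_add W.connes_scale W.delta_add W.delta_scale fun_eq_iff algebra_simps)
qed

lemma hor_supp:
  assumes x: "x \<in> supp_on P" and PQ: "\<And>i n m. P i n m \<Longrightarrow> Q i (n + 1) m"
  shows "hor x \<in> supp_on Q"
proof -
  have "hor x i w = 0" if w: "w \<noteq> []" "\<not> Q i (length w - 1) (W.wdeg w)" for i w
  proof (cases "W.good_word w")
    case True
    have "W.hoch (x i) w = W.hoch (\<lambda>v. 0) w"
    proof (rule W.hoch_gcong[OF _ True])
      fix v assume v: "length v + 1 = length w" "W.wdeg v = W.wdeg w"
      show "x i v = 0"
      proof (cases "v = []")
        case False
        then have "length w - 1 = length v - 1 + 1" using v by (cases v) auto
        then have "\<not> P i (length v - 1) (W.wdeg v)" using PQ[of i "length v - 1" "W.wdeg v"] w(2) v by auto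
        then show ?thesis using supp_onD(3)[OF x False] by blast
      qed (use supp_onD(2)[OF x] in simp)
    qed
    then show ?thesis by (simp add: hor_def truncate_def W.hoch_zero)
  qed (simp add: hor_def truncate_def)
  moreover have "hor x \<in> families" using x by (intro hor_families) (simp add: supp_on_def)
  ultimately show ?thesis by (simp add: supp_on_def)
qed

lemma ver_supp:
  assumes x: "x \<in> supp_on P"
    and PB: "\<And>i n m. P i (n + 1) m \<Longrightarrow> Q (i + 1) n m" and Pd: "\<And>i n m. P i n m \<Longrightarrow> Q i n (m + 1)"
  shows "ver x \<in> supp_on Q"
proof -
  have "ver x i w = 0" if w: "w \<noteq> []" "\<not> Q i (length w - 1) (W.wdeg w)" for i w
  proof (cases "W.good_word w")
    case True
    have "W.connes (x (i - 1)) w = W.connes (\<lambda>v. 0) w" if i: "0 < i"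
    proof (rule W.connes_gcong[OF _ True])
      fix v assume v: "length v = length w + 1" "W.wdeg v = W.wdeg w"
      then have "v \<noteq> []" "length v - 1 = length w - 1 + 1" using w(1) by (cases w; auto)+
      moreover have "\<not> P (i - 1) (length w - 1 + 1) (W.wdeg w)"
        using PB[of "i - 1" "length w - 1" "W.wdeg w"] w(2) i by auto
      ultimately show "x (i - 1) v = 0" using supp_onD(3)[OF x] v(2) by metis
    qed
    then have 1: "ver_B x i w = 0" by (simp add: ver_B_def connes_null)
    have "W.word_diff (x i) w = 0"
    proof (rule W.word_diff_vanishes[OF kills_null_cochain_fun[OF supp_onD(1)[OF x]] True])
      fix v assume v: "length v = length w" "W.wdeg v + 1 = W.wdeg w"
      then have "v \<noteq> []" using w(1) by auto
      moreover have "\<not> P i (length w - 1) (W.wdeg v)"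
        using Pd[of i "length w - 1" "W.wdeg v"] w(2) v(2) by auto
      ultimately show "x i v = 0" using supp_onD(3)[OF x] v(1) by metis
    qed
    then have "ver_delta x i w = 0" by (simp add: ver_delta_def truncate_def W.delta_def)
    then show ?thesis using 1 by (simp add: ver_def)
  next
    case False
    have "x \<in> families" using x by (simp add: supp_on_def)
    then show ?thesis using cochain_funD(1)[OF cochain_fun_ver False] by simp
  qed
  moreover have "ver x \<in> families" using x by (intro ver_families) (simp add: supp_on_def)
  ultimately show ?thesis by (simp add: supp_on_def)
qed

text \<open>The square of \<open>b + B + \<delta>\<close> vanishes because each of the three squares to zero and any two of them
anticommute. At first index \<open>0\<close> no component arrives under \<open>B\<close>, and the terms without \<open>B\<close> vanish by
themselves.\<close>

lemma hor_ver_square: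
  assumes x: "x \<in> families"
  shows "hor (hor x + ver x) + ver (hor x + ver x) = 0"
proof (intro ext)
  fix i and w :: "(nat \<times> 'a) list"
  have s: "cochain_fun (x j)" for j using x by (simp add: families_def)
  note kills_null = kills_null_cochain_fun[OF s] and leibniz = leibniz_cochain_fun[OF s]
  let ?D = "hor x + ver x"
  have D: "?D \<in> families" using hor_families[OF x] ver_families[OF x] cochain_fun_plus
    by (simp add: families_def plus_fun_def)
  show "(hor ?D + ver ?D) i w = 0 i w"
  proof (cases "W.good_word w")
    case False
    then show ?thesis using cochain_funD(1)[OF cochain_fun_hor[OF D] False] cochain_funD(1)[OF cochain_fun_ver[OF D] False] by simp
  next
    case w: True
    let ?b = "\<lambda>j. W.hoch (x j)" and ?d = "\<lambda>j. W.delta (x j)"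
    let ?B = "\<lambda>j v. if 0 < j then W.connes (x (j - 1)) v else 0"
    have raw: "?D j v = ?b j v + (?B j v + ?d j v)" if "W.good_word v" for j v
      using that by (simp add: hor_def ver_def ver_B_def ver_delta_def truncate_def)
    let ?R = "\<lambda>j v. ?b j v + (?B j v + ?d j v)"
    have 1: "hor ?D i w = W.hoch (?R i) w"
    proof -
      have "W.hoch (?D i) w = W.hoch (?R i) w" by (rule W.hoch_gcong[OF raw w])
      then show ?thesis using w by (simp only: hor_def[of ?D] truncate_def if_True)
    qed
    have 2: "ver_B ?D i w = (if 0 < i then W.connes (?R (i - 1)) w else 0)"
    proof -
      have "W.connes (?D (i - 1)) w = W.connes (?R (i - 1)) w" by (rule W.connes_gcong[OF raw w])
      then show ?thesis by (simp only: ver_B_def[of ?D])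
    qed
    have 3: "ver_delta ?D i w = W.delta (?R i) w"
    proof -
      have "W.word_diff (?D i) w = W.word_diff (?R i) w" by (rule W.word_diff_gcong[OF raw w])
      then have "W.delta (?D i) w = W.delta (?R i) w" unfolding W.delta_def[of _ w] by (simp only:)
      then show ?thesis using w by (simp only: ver_delta_def[of ?D] truncate_def if_True)
    qed
    have bd: "W.hoch (?d j) w + W.delta (?b j) w = 0" for j by (rule W.hoch_delta[OF kills_null leibniz w])
    have Bd: "W.connes (?d j) w + W.delta (W.connes (x j)) w = 0" for j by (rule W.connes_delta[OF kills_null w])
    have dd: "W.delta (?d j) w = 0" for j by (rule W.delta_delta[OF kills_null w])
    have bB: "W.hoch (W.connes (x j)) w + W.connes (?b j) w = 0" for j by (rule W.hoch_connes)
    have "hor ?D i w + (ver_B ?D i w + ver_delta ?D i w) = 0"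
    proof (cases i)
      case 0
      have "W.hoch (?R 0) w = W.hoch (?d 0) w"
        by (simp add: W.hoch_add W.hoch_hoch)
      moreover have "W.delta (?R 0) w = W.delta (?b 0) w"
        by (simp add: W.delta_add dd)
      ultimately show ?thesis using bd[of 0] unfolding 1 2 3 unfolding 0 by simp
    next
      case (Suc j)
      have BB': "W.connes (?B j) w = 0"
        by (cases "0 < j") (simp_all add: W.connes_connes connes_null)
      have "W.hoch (?R (Suc j)) w = W.hoch (W.connes (x j)) w + W.hoch (?d (Suc j)) w"
        by (simp add: W.hoch_add W.hoch_hoch)
      moreover have "W.delta (?R (Suc j)) w = W.delta (?b (Suc j)) w + W.delta (W.connes (x j)) w"
        by (simp add: W.delta_add dd)
      moreover have "W.connes (?R j) w = W.connes (?b j) w + W.connes (?d j) w"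
        using BB' by (simp only: W.connes_add) simp
      ultimately have "hor ?D i w + (ver_B ?D i w + ver_delta ?D i w)
          = (W.hoch (W.connes (x j)) w + W.connes (?b j) w) + (W.hoch (?d (Suc j)) w + W.delta (?b (Suc j)) w)
            + (W.connes (?d j) w + W.delta (W.connes (x j)) w)"
        unfolding 1 2 3 unfolding Suc diff_Suc_1 by (simp add: algebra_simps)
      then show ?thesis using bd[of "Suc j"] Bd[of j] bB[of j] by simp
    qed
    then show ?thesis by (simp add: ver_def)
  qed
qed

text \<open>The column is \<open>i + n = q\<close> and the row is \<open>i + m = p + r\<close>.\<close>

definition Gr :: "int \<Rightarrow> int \<Rightarrow> (nat \<Rightarrow> (nat \<times> 'a) list \<Rightarrow> 'k) set"
  where "Gr p t = supp_on (\<lambda>i n m. int (i + n) = p \<and> int (i + m) = t)"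

definition Fil :: "int \<Rightarrow> int \<Rightarrow> (nat \<Rightarrow> (nat \<times> 'a) list \<Rightarrow> 'k) set"
  where "Fil n p = supp_on (\<lambda>i j m. int (i + j + i + m) = n \<and> p \<le> int (i + j))"

definition proj :: "int \<Rightarrow> (nat \<Rightarrow> (nat \<times> 'a) list \<Rightarrow> 'k) \<Rightarrow> nat \<Rightarrow> (nat \<times> 'a) list \<Rightarrow> 'k"
  where "proj p x = (\<lambda>i w. if int i + int (length w) - 1 = p then x i w else 0)"

lemma proj_families: "x \<in> families \<Longrightarrow> proj p x \<in> families"
proof -
  assume x: "x \<in> families"
  have "cochain_fun (proj p x i)" for i
    unfolding proj_def
    using cochain_fun_family[of "\<lambda>l d. if int i + int l - 1 = p then x i else (\<lambda>w. 0)"] x cochain_fun_null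
    by (simp add: families_def if_distrib[where f = "\<lambda>g. g _"] cong: if_cong)
  then show ?thesis using x by (simp add: families_def proj_def)
qed

lemma proj_hor: "proj p (hor x) = hor (proj (p - 1) x)"
proof (intro ext)
  fix i w
  show "proj p (hor x) i w = hor (proj (p - 1) x) i w"
  proof (cases "W.good_word w")
    case True
    have "W.hoch (proj (p - 1) x i) w = W.hoch (if int i + int (length w) - 1 = p then x i else (\<lambda>v. 0)) w"
      by (rule W.hoch_gcong[OF _ True]) (auto simp: proj_def)
    then show ?thesis by (simp add: proj_def hor_def truncate_def W.hoch_zero)
  qed (simp add: proj_def hor_def truncate_def)
qed

lemma proj_ver:
  assumes "x \<in> families"
  shows "proj p (ver x) = ver (proj p x)"
proof (intro ext)
  fix i and w :: "(nat \<times> 'a) list"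
  show "proj p (ver x) i w = ver (proj p x) i w"
  proof (cases "W.good_word w")
    case w: True
    let ?on = "int i + int (length w) - 1 = p"
    have "W.connes (proj p x (i - 1)) w = W.connes (if ?on then x (i - 1) else (\<lambda>v. 0)) w" if "0 < i"
      by (rule W.connes_gcong[OF _ w]) (use that in \<open>auto simp: proj_def\<close>)
    then have 1: "ver_B (proj p x) i w = (if ?on then ver_B x i w else 0)"
      by (simp add: ver_B_def connes_null)
    have "W.word_diff (proj p x i) w = W.word_diff (if ?on then x i else (\<lambda>v. 0)) w"
      by (rule W.word_diff_gcong[OF _ w]) (auto simp: proj_def)
    then have 2: "ver_delta (proj p x) i w = (if ?on then ver_delta x i w else 0)"
      by (simp add: ver_delta_def truncate_def W.delta_def W.word_diff_zero)
    show ?thesis by (simp add: ver_def 1 2) (simp add: proj_def ver_def)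
  next
    case False
    then show ?thesis
      using cochain_funD(1)[OF cochain_fun_ver[OF proj_families[OF assms]] False] cochain_funD(1)[OF cochain_fun_ver[OF assms] False]
      by (simp add: proj_def)
  qed
qed

text \<open>The first quadrant condition holds because the column and the row of a component are sums of natural
numbers.\<close>

lemma word_double_complex: "bounded_double_complex family_scale Gr Fil proj hor ver"
proof
  fix p t n q p' :: int and x :: "nat \<Rightarrow> (nat \<times> 'a) list \<Rightarrow> 'k"
  show "fs.endo hor" "fs.endo ver" by (rule endo_hor endo_ver)+
  show "fs.endo (proj p)" by (simp add: fs.endo_def proj_def family_scale_def fun_eq_iff)
  show "fs.subspace (Gr p t)" "fs.subspace (Fil n p)" unfolding Gr_def Fil_def by (rule subspace_supp_on)+
  show "Fil n (p + 1) \<subseteq> Fil n p" unfolding Fil_def by (rule supp_on_mono) auto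
  show "Fil n p = Fil n 0" if "p \<le> 0" unfolding Fil_def using that by (intro arg_cong[of _ _ supp_on]) (auto simp: fun_eq_iff)
  show "Gr p t \<subseteq> Fil (p + t) p" unfolding Gr_def Fil_def by (rule supp_on_mono) auto
  have nonzero: "w \<noteq> []" if "x \<in> supp_on P" "x i w \<noteq> 0" for P i w
    using supp_onD(2)[OF that(1)] that(2) by auto
  show "Fil n p = {0}" if "n < p"
  proof -
    have "Fil n p \<subseteq> {0}"
    proof
      fix y assume y: "y \<in> Fil n p"
      have "y i w = 0" for i w
        using supp_onD(2)[OF y[unfolded Fil_def], of i] supp_onD(3)[OF y[unfolded Fil_def], of w i] that
        by (cases "w = []") auto
      then show "y \<in> {0}" by (simp add: fun_eq_iff)
    qed
    then show ?thesis using fs.subspace_0[OF subspace_supp_on] unfolding Fil_def by blast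
  qed
  have len: "int i + int (length w) - 1 = p \<longleftrightarrow> int (i + (length w - 1)) = p" if "w \<noteq> []" for i p and w :: "(nat \<times> 'a) list"
    using that by (cases w) auto
  have proj: "proj p x i w = (if int (i + (length w - 1)) = p then x i w else 0)" if "w \<noteq> []" for p x i and w :: "(nat \<times> 'a) list"
    using len[OF that] by (simp add: proj_def)
  show "proj p x \<in> Gr p (n - p)" if x: "x \<in> Fil n p"
  proof -
    have "proj p x \<in> families" using x by (intro proj_families) (simp add: Fil_def supp_on_def)
    moreover have "proj p x i w = 0"
      if "w \<noteq> []" "\<not> (int (i + (length w - 1)) = p \<and> int (i + W.wdeg w) = n - p)" for i w
      using supp_onD(3)[OF x[unfolded Fil_def] that(1), of i] that proj[OF that(1)] by auto
    ultimately show ?thesis unfolding Gr_def supp_on_def by blast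
  qed
  show "proj p x = 0 \<longleftrightarrow> x \<in> Fil n (p + 1)" if x: "x \<in> Fil n p"
  proof
    assume 0: "proj p x = 0"
    have "x i w = 0"
      if "w \<noteq> []" "\<not> (int (i + (length w - 1) + i + W.wdeg w) = n \<and> p + 1 \<le> int (i + (length w - 1)))" for i w
      using supp_onD(3)[OF x[unfolded Fil_def] that(1), of i] that proj[OF that(1), of p x i] fun_cong[OF fun_cong[OF 0], of i w]
      by (cases "int (i + (length w - 1)) = p") auto
    then show "x \<in> Fil n (p + 1)" using x unfolding Fil_def supp_on_def by blast
  next
    assume x: "x \<in> Fil n (p + 1)"
    have "proj p x i w = 0" for i w
      using supp_onD(2)[OF x[unfolded Fil_def], of i] supp_onD(3)[OF x[unfolded Fil_def], of w i] proj[of w p x i]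
      by (cases "w = []") (auto simp: proj_def)
    then show "proj p x = 0" by (simp add: fun_eq_iff)
  qed
  show "proj p' x = (if p' = p then x else 0)" if x: "x \<in> Gr p t"
  proof (intro ext)
    fix i w
    show "proj p' x i w = (if p' = p then x else 0) i w"
      using supp_onD(2)[OF x[unfolded Gr_def], of i] supp_onD(3)[OF x[unfolded Gr_def], of w i] proj[of w p' x i]
      by (cases "w = []") (auto simp: proj_def)
  qed
  show "hor x \<in> Gr (p + 1) t" if "x \<in> Gr p t" using that unfolding Gr_def by (rule hor_supp) auto
  show "ver x \<in> Gr p (t + 1)" if "x \<in> Gr p t" using that unfolding Gr_def by (rule ver_supp) auto
  have families: "x \<in> families" if "x \<in> Fil n p" for x n p using that by (simp add: Fil_def supp_on_def)
  show "hor x + ver x \<in> Fil (n + 1) p" if "x \<in> Fil n p"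
  proof -
    have "hor x \<in> Fil (n + 1) p" using that unfolding Fil_def by (rule hor_supp) auto
    moreover have "ver x \<in> Fil (n + 1) p" using that unfolding Fil_def by (rule ver_supp) auto
    ultimately show ?thesis unfolding Fil_def using fs.subspace_add[OF subspace_supp_on] by blast
  qed
  show "hor (hor x + ver x) + ver (hor x + ver x) = 0" if "x \<in> Fil n p" by (rule hor_ver_square[OF families[OF that]])
  show "proj p (hor x + ver x) = hor (proj (p - 1) x) + ver (proj p x)" if "x \<in> Fil n q"
  proof -
    have "proj p (hor x + ver x) = proj p (hor x) + proj p (ver x)" by (simp add: proj_def fun_eq_iff)
    then show ?thesis by (simp add: proj_hor proj_ver[OF families[OF that]])
  qed
qed

end

section \<open>The spectral sequence of a dga\<close>

context dga
begin

lemma word_cochain_null: "word_cochain n m (\<lambda>w. 0) t = 0"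
  using word_cochain_scale[OF cochain_fun_null, of 0 n m t] by (simp add: cochain_fun_null)

text \<open>In degree \<open>n = 0\<close> no component arrives under \<open>b\<close>; on the side of words, \<open>b\<close> gives \<open>0\<close> on words of length
one. The next two lemmas treat the boundary cases of \<open>B\<close> and \<open>\<delta>\<close> in the same way.\<close>

lemma op_b_component:
  assumes "x \<in> families"
  shows "(if 0 < n then op_b n m (word_cochain (n - 1) m (x i)) t else 0) = word_cochain n m (hor x i) t"
proof (cases "0 < n")
  case True
  have "word_cochain n m (hor x i) = word_cochain n m (W.hoch (x i))"
    by (rule word_cochain_cong) (simp add: hor_def truncate_def valid_word_def)
  then show ?thesis using True assms op_b_word_cochain[of "x i" n m] by (simp add: families_def)
next
  case False
  have "word_cochain n m (hor x i) = word_cochain n m (\<lambda>w. 0)"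
  proof (rule word_cochain_cong)
    fix w assume "valid_word n m w"
    then obtain z where "w = [z]" using False by (cases w) (auto simp: valid_word_def)
    then show "hor x i w = 0" by (simp add: hor_def truncate_def W.hoch_def W.bprime_def W.tau_def)
  qed
  then show ?thesis using False by (simp add: word_cochain_null)
qed

lemma op_B_component:
  assumes "x \<in> families"
  shows "(if 0 < i then op_B n m (word_cochain (n + 1) m (x (i - 1))) t else 0) = word_cochain n m (ver_B x i) t"
proof (cases "0 < i")
  case True
  then have "ver_B x i = W.connes (x (i - 1))" by (simp add: ver_B_def fun_eq_iff)
  then show ?thesis using True assms op_B_word_cochain[of "x (i - 1)" n m] by (simp add: families_def)
next
  case False
  then have "ver_B x i = (\<lambda>w. 0)" by (simp add: ver_B_def fun_eq_iff)
  then show ?thesis using False by (simp add: word_cochain_null)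
qed

lemma op_delta_component:
  assumes "x \<in> families"
  shows "(if 0 < m then (-1) ^ n * op_delta n (m - 1) (word_cochain n (m - 1) (x i)) t else 0)
    = word_cochain n m (ver_delta x i) t"
proof (cases m)
  case 0
  have s: "cochain_fun (x i)" using assms by (simp add: families_def)
  have "word_cochain n m (ver_delta x i) = word_cochain n m (\<lambda>w. 0)"
  proof (rule word_cochain_cong)
    fix w assume w: "valid_word n m w"
    have "W.word_diff (x i) w = 0"
      by (rule W.word_diff_vanishes[OF kills_null_cochain_fun[OF s]]) (use w 0 in \<open>auto simp: valid_word_def\<close>)
    then show "ver_delta x i w = 0" by (simp add: ver_delta_def truncate_def W.delta_def)
  qed
  then show ?thesis using 0 by (simp add: word_cochain_null)
next
  case (Suc k)
  have s: "cochain_fun (x i)" using assms by (simp add: families_def)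
  let ?g = "truncate (\<lambda>w. (-1) ^ k * W.word_diff (x i) w)"
  have g: "cochain_fun ?g"
    using multilinear_wlen[OF multilinear_word_diff[OF s], of "\<lambda>l d. (-1) ^ k"] by (rule cochain_fun_truncate)
  have "op_delta n k (word_cochain n k (x i)) = word_cochain n m ?g"
    unfolding op_delta_word_cochain[OF s] using Suc by (simp, intro word_cochain_cong) (simp add: truncate_def valid_word_def)
  then have "(-1) ^ n * op_delta n k (word_cochain n k (x i)) t = word_cochain n m (\<lambda>w. (-1) ^ n * ?g w) t"
    using word_cochain_scale[OF g cochain_fun_smult[OF g]] by simp
  also have "word_cochain n m (\<lambda>w. (-1) ^ n * ?g w) = word_cochain n m (ver_delta x i)"
    by (rule word_cochain_cong) (simp add: ver_delta_def truncate_def valid_word_def W.delta_def Suc power_add)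
  finally show ?thesis using Suc by simp
qed

lemma word_cochain_ver:
  assumes "x \<in> families"
  shows "word_cochain n m (ver x i) t = word_cochain n m (ver_B x i) t + word_cochain n m (ver_delta x i) t"
  using word_cochain_add[OF cochain_fun_ver_B[OF assms] cochain_fun_ver_delta[OF assms] cochain_fun_ver[OF assms, of i, unfolded ver_def plus_fun_apply plus_fun_def]]
  by (simp add: ver_def plus_fun_def)

lemma word_cochain_total:
  assumes "x \<in> families"
  shows "word_cochain n m ((hor x + ver x) i) t
    = word_cochain n m (hor x i) t + (word_cochain n m (ver_B x i) t + word_cochain n m (ver_delta x i) t)"
proof -
  note s = cochain_fun_hor[OF assms, of i] cochain_fun_ver[OF assms, of i]
  have "word_cochain n m ((hor x + ver x) i) t = word_cochain n m (hor x i) t + word_cochain n m (ver x i) t"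
    using word_cochain_add[OF s cochain_fun_plus[OF s]] by (simp add: plus_fun_def)
  then show ?thesis by (simp add: word_cochain_ver[OF assms])
qed

definition tot_of :: "int \<Rightarrow> (nat \<Rightarrow> (nat \<times> 'a) list \<Rightarrow> 'k) \<Rightarrow> nat \<times> nat \<times> nat \<Rightarrow> ('a list \<Rightarrow>\<^sub>0 'k) set \<Rightarrow> 'k"
  where "tot_of n = to_sum (tot_index n) fst (\<lambda>k. fst (snd k) - fst k) (\<lambda>k. snd (snd k))"

definition col_of :: "int \<Rightarrow> int \<Rightarrow> (nat \<Rightarrow> (nat \<times> 'a) list \<Rightarrow> 'k) \<Rightarrow> nat \<Rightarrow> ('a list \<Rightarrow>\<^sub>0 'k) set \<Rightarrow> 'k"
  where "col_of p t = to_sum (col_index p t) (\<lambda>i. i) (\<lambda>i. nat (p - int i)) (\<lambda>i. nat (t - int i))"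

lemma presents_tot: "fs.presents (tot n) (Fil n 0) {0} (tot_of n)"
proof -
  have "finite (tot_index n)"
    by (rule finite_subset[of _ "{..nat n} \<times> {..nat n} \<times> {..nat n}"]) (auto simp: tot_index_def)
  moreover have "(int (i + j + i + r) = n \<and> 0 \<le> int (i + j)) \<longleftrightarrow>
      (\<exists>k\<in>tot_index n. fst k = i \<and> fst (snd k) - fst k = j \<and> snd (snd k) = r)" for i j r
  proof
    assume "int (i + j + i + r) = n \<and> 0 \<le> int (i + j)"
    then show "\<exists>k\<in>tot_index n. fst k = i \<and> fst (snd k) - fst k = j \<and> snd (snd k) = r"
      by (intro bexI[of _ "(i, i + j, r)"]) (auto simp: tot_index_def)
  qed (auto simp: tot_index_def)
  moreover have "tot n = direct_sum_module (tot_index n)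
      (\<lambda>k. cochains (fst (snd k) - fst k) (snd (snd k)))"
    by (simp add: tot_def EC_def case_prod_beta')
  ultimately show ?thesis
    unfolding Fil_def tot_of_def by (simp, intro presents_direct_sum) (auto simp: tot_index_def)
qed

lemma presents_col: "fs.presents (col p t) (Gr p t) {0} (col_of p t)"
proof -
  have "finite (col_index p t)"
    by (rule finite_subset[of _ "{..nat p}"]) (auto simp: col_index_def)
  moreover have "(int (i + j) = p \<and> int (i + r) = t) \<longleftrightarrow>
      (\<exists>k\<in>col_index p t. k = i \<and> nat (p - int k) = j \<and> nat (t - int k) = r)" for i j r
    by (auto simp: col_index_def)
  ultimately show ?thesis
    unfolding Gr_def col_of_def col_def by (intro presents_direct_sum) auto
qed

lemma Gr_families: "x \<in> Gr p t \<Longrightarrow> x \<in> families" and Fil_families: "x \<in> Fil n p \<Longrightarrow> x \<in> families"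
  by (simp_all add: Gr_def Fil_def supp_on_def)

lemma tot_diff_tot_of:
  assumes "x \<in> Fil n 0"
  shows "tot_diff n (tot_of n x) = tot_of (n + 1) (hor x + ver x)"
  unfolding tot_diff_def tot_of_def[of "n + 1"] to_sum_def
proof (rule restrict_ext)
  fix k assume "k \<in> tot_index (n + 1)"
  then obtain p q r where k: "k = (p, q, r)" "p \<le> q" "int (p + q + r) = n + 1"
    by (auto simp: tot_index_def)
  note families = Fil_families[OF assms]
  have tot_of: "tot_of n x (i, j, l) = word_cochain (j - i) l (x i)" if "(i, j, l) \<in> tot_index n" for i j l
    using that by (simp add: tot_of_def to_sum_def)
  have b: "(if p < q then op_b (q - p) r (tot_of n x (p, q - 1, r)) t else 0)
      = word_cochain (q - p) r (hor x p) t" for t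
  proof -
    have "tot_of n x (p, q - 1, r) = word_cochain (q - p - 1) r (x p)" if "p < q"
      using tot_of[of p "q - 1" r] that k by (simp add: tot_index_def diff_commute)
    then show ?thesis using op_b_component[OF families, of "q - p" r p t] by (simp cong: if_cong)
  qed
  have B: "(if 0 < p then op_B (q - p) r (tot_of n x (p - 1, q, r)) t else 0)
      = word_cochain (q - p) r (ver_B x p) t" for t
  proof -
    have "tot_of n x (p - 1, q, r) = word_cochain (q - p + 1) r (x (p - 1))" if "0 < p"
    proof -
      have "q - (p - 1) = q - p + 1" using that k(2) by simp
      moreover have "(p - 1, q, r) \<in> tot_index n" using that k(2,3) by (simp add: tot_index_def)
      ultimately show ?thesis using tot_of[of "p - 1" q r] by simp
    qed
    then show ?thesis using op_B_component[OF families, of p "q - p" r t] by (simp cong: if_cong)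
  qed
  have d: "(if 0 < r then (-1) ^ (q - p) * op_delta (q - p) (r - 1) (tot_of n x (p, q, r - 1)) t else 0)
      = word_cochain (q - p) r (ver_delta x p) t" for t
  proof -
    have "tot_of n x (p, q, r - 1) = word_cochain (q - p) (r - 1) (x p)" if "0 < r"
      using tot_of[of p q "r - 1"] that k by (simp add: tot_index_def)
    then show ?thesis using op_delta_component[OF families, of r "q - p" p t] by (simp cong: if_cong)
  qed
  show "(case k of (p, q, r) \<Rightarrow> \<lambda>t.
      (if p < q then op_b (q - p) r (tot_of n x (p, q - 1, r)) t else 0)
    + (if 0 < p then op_B (q - p) r (tot_of n x (p - 1, q, r)) t else 0)
    + (if 0 < r then (-1) ^ (q - p) * op_delta (q - p) (r - 1) (tot_of n x (p, q, r - 1)) t else 0))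
    = word_cochain (fst (snd k) - fst k) (snd (snd k)) ((hor x + ver x) (fst k))"
    unfolding k(1) prod.case b B d fst_conv snd_conv
    by (rule ext) (simp only: word_cochain_total[OF families] add.assoc)
qed

lemma col_of_apply: "i \<in> col_index p t \<Longrightarrow> col_of p t x i = word_cochain (nat (p - int i)) (nat (t - int i)) (x i)"
  by (simp add: col_of_def to_sum_def)

lemma col_diff_col_of:
  assumes "x \<in> Gr p t"
  shows "col_diff p t (col_of p t x) = col_of p (t + 1) (ver x)"
  unfolding col_diff_def col_of_def[of p "t + 1"] to_sum_def
proof (rule restrict_ext)
  fix i assume "i \<in> col_index p (t + 1)"
  then have i: "int i \<le> p" "int i \<le> t + 1" by (auto simp: col_index_def)
  note families = Gr_families[OF assms]
  let ?n = "nat (p - int i)" and ?m = "nat (t + 1 - int i)"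
  have B: "(if 0 < i then op_B ?n ?m (col_of p t x (i - 1)) s else 0) = word_cochain ?n ?m (ver_B x i) s" for s
  proof -
    have "col_of p t x (i - 1) = word_cochain (?n + 1) ?m (x (i - 1))" if "0 < i"
    proof -
      have "nat (p - int (i - 1)) = ?n + 1" "nat (t - int (i - 1)) = ?m" and c: "i - 1 \<in> col_index p t"
        using that i by (auto simp: col_index_def of_nat_diff)
      then show ?thesis by (simp only: col_of_apply[OF c])
    qed
    then show ?thesis using op_B_component[OF families, of i ?n ?m s] by (simp cong: if_cong)
  qed
  have d: "(if int i \<le> t then (-1) ^ ?n * op_delta ?n (nat (t - int i)) (col_of p t x i) s else 0)
      = word_cochain ?n ?m (ver_delta x i) s" for s
  proof -
    have m: "0 < ?m \<longleftrightarrow> int i \<le> t" "?m - 1 = nat (t - int i)" by auto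
    have "col_of p t x i = word_cochain ?n (nat (t - int i)) (x i)" if "int i \<le> t"
      using col_of_apply[of i p t x] that i by (simp add: col_index_def)
    then show ?thesis using op_delta_component[OF families, of ?m ?n i s] unfolding m by (simp cong: if_cong)
  qed
  show "(\<lambda>s. (if 0 < i then op_B ?n ?m (col_of p t x (i - 1)) s else 0)
      + (if int i \<le> t then (-1) ^ ?n * op_delta ?n (nat (t - int i)) (col_of p t x i) s else 0))
    = word_cochain ?n ?m (ver x i)"
    unfolding B d by (rule ext) (simp only: word_cochain_ver[OF families])
qed

lemma col_b_col_of:
  assumes "x \<in> Gr p t"
  shows "col_b p t (col_of p t x) = col_of (p + 1) t (hor x)"
  unfolding col_b_def col_of_def[of "p + 1" t] to_sum_def
proof (rule restrict_ext)
  fix i assume "i \<in> col_index (p + 1) t"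
  then have i: "int i \<le> p + 1" "int i \<le> t" by (auto simp: col_index_def)
  let ?n = "nat (p + 1 - int i)" and ?m = "nat (t - int i)"
  have n: "0 < ?n \<longleftrightarrow> int i \<le> p" "?n - 1 = nat (p - int i)" by auto
  have "col_of p t x i = word_cochain (nat (p - int i)) ?m (x i)" if "int i \<le> p"
    using col_of_apply[of i p t x] that i by (simp add: col_index_def)
  then have "(if int i \<le> p then op_b ?n ?m (col_of p t x i) s else 0) = word_cochain ?n ?m (hor x i) s" for s
    using op_b_component[OF Gr_families[OF assms], of ?n ?m i s] unfolding n by (simp cong: if_cong)
  then show "(\<lambda>s. if int i \<le> p then op_b ?n ?m (col_of p t x i) s else 0) = word_cochain ?n ?m (hor x i)"
    by (rule ext)
qed

lemma realised: "realised_double_complex family_scale Gr Fil proj hor ver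
    tot tot_diff tot_of col col_diff col_b col_of"
  by (intro realised_double_complex.intro word_double_complex realised_double_complex_axioms.intro
      presents_tot tot_diff_tot_of presents_col col_diff_col_of col_b_col_of)

end

theorem theorem4p13:
  fixes scale :: "'k::field_char_0 \<Rightarrow> 'a::ring \<Rightarrow> 'a"
    and e :: 'a and G :: "nat \<Rightarrow> 'a set" and phi :: "'a \<Rightarrow> 'a"
  assumes "dga scale e G phi"
  shows "\<exists>(E :: nat \<Rightarrow> int \<Rightarrow> int \<Rightarrow>
             ('k, (nat \<times> nat \<times> nat \<Rightarrow> ('a list \<Rightarrow>\<^sub>0 'k) set \<Rightarrow> 'k) set) module) d.
    spectral_sequence (ring_of_type_algebra :: 'k ring) E d \<and>
    (\<forall>p q. mod_isomorphic (ring_of_type_algebra :: 'k ring) (E 2 p q)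
       (cohomology (dga.col_cohomology scale e G phi q)
          (dga.col_cohomology_diff scale e G phi q) p)) \<and>
    ss_converges (ring_of_type_algebra :: 'k ring) E d (dga.HC scale e G phi)"
proof -
  interpret dga scale e G phi by (rule assms)
  interpret R: realised_double_complex family_scale Gr Fil proj hor ver
    tot tot_diff tot_of col col_diff col_b col_of
    by (rule realised)
  have "col_cohomology q = (\<lambda>p. cohomology (col p) (col_diff p) q)"
    and "col_cohomology_diff q
      = (\<lambda>p. quot_map (col (p + 1) q) (coboundaries (col (p + 1)) (col_diff (p + 1)) q) (col_b p q))" for q
    by (simp_all add: fun_eq_iff col_cohomology_def col_cohomology_diff_def)
  moreover have "HC = cohomology tot tot_diff" by (simp add: fun_eq_iff HC_def)
  ultimately show ?thesis
    using R.spectral_sequence_E R.E2_isomorphic R.converges_E by (intro exI[of _ R.E] exI[of _ R.dE]) simp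
qed

end
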